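(* The $\tau$-functions $\tau_{k,\ell}^{(\alpha,\beta)}$ (defined in the context for all $k,\ell,\alpha,\beta\in\mathbb{Z}$) satisfy the following system of four equations, for all $\alpha,\beta\in\mathbb{Z}$ and all $k,\ell\ge 0$: $$\big(\tau_{k,\ell}^{(\alpha+1,\beta)}\big)^2=\tau_{k,\ell}^{(\alpha,\beta)}\tau_{k,\ell}^{(\alpha+2,\beta)}+\tau_{k+1,\ell+1}^{(\alpha,\beta)}\tau_{k-1,\ell-1}^{(\alpha+2,\beta)}-\tau_{k+1,\ell}^{(\alpha,\beta)}\tau_{k-1,\ell}^{(\alpha+2,\beta)},$$ $$\tau_{k-1,\ell-1}^{(\alpha+2,\beta)}\tau_{k+1,\ell}^{(\alpha+1,\beta)}+\tau_{k,\ell}^{(\alpha+1,\beta)}\tau_{k,\ell-1}^{(\alpha+2,\beta)}=\tau_{k,\ell-1}^{(\alpha+1,\beta)}\tau_{k,\ell}^{(\alpha+2,\beta)},$$ $$\big(\tau_{k,\ell}^{(\alpha,\beta+1)}\big)^2=\tau_{k,\ell}^{(\alpha,\beta)}\tau_{k,\ell}^{(\alpha,\beta+2)}-\tau_{k,\ell-1}^{(\alpha,\beta+2)}\tau_{k,\ell+1}^{(\alpha,\beta)}-\tau_{k+1,\ell}^{(\alpha,\beta+2)}\tau_{k-1,\ell}^{(\alpha,\beta)},$$ $$\tau_{k-1,\ell+1}^{(\alpha,\beta)}\tau_{k,\ell}^{(\alpha,\beta+1)}+\tau_{k-1,\ell}^{(\alpha,\beta+1)}\tau_{k,\ell+1}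^{(\alpha,\beta)}=\tau_{k-1,\ell}^{(\alpha,\beta)}\tau_{k,\ell+1}^{(\alpha,\beta+1)}.$$
   Context: Three-component Fock space. Let $e_0,e_1,e_2$ be the standard basis of $\mathbb{C}^3$ and $e_az^k$ ($a=0,1,2$, $k\in\mathbb{Z}$) the corresponding basis of $\mathbb{C}^3\otimes\mathbb{C}[z,z^{-1}]$. Let $v_0=e_0\wedge e_1\wedge e_2\wedge e_0z\wedge e_1z\wedge e_2z\wedge e_0z^2\wedge\cdots$. Let $\psi^+_{a,(k)}$ be the wedging operator $\omega\mapsto e_az^k\wedge\omega$ and $\psi^-_{a,(k)}=i(e_az^{-k-1})$ the contraction operator, where $i(e_az^m)(e_az^m\wedge\beta)=\beta$ and $i(e_az^m)$ kills wedges of basis vectors not involving $e_az^m$. They satisfy $[\psi^+_{a,(k)},\psi^-_{b,(l)}]_+=\delta_{ab}\delta_{k+l,-1}$, all other anticommutators being $0$, and $\psi^\pm_{a,(k)}v_0=0$ for $k\ge0$. $F^{(3)}$ is the span of all vectors obtained from $v_0$ by finitely many such operators. A basis is given by the elementary wedges $M_2M_1M_0v_0$, $M_a=M_a^+M_a^-$, where $M_a^\pm=\psi^\pm_{a,(k_1)}\cdots\psi^\pm_{a,(k_s)}$ with $k_1<\cdots<k_s\le-1$ ($s\geq 0$); $\langle\,,\rangle$ is the bilinear form for which the elementary wedges are orthonormal. Fields: $\psi_a^\pm(w)=\sum_{k\in\mathbb{Z}}\psi^\pm_{a,(k)}w^{-k-1}$. Fermionic translation operators: $Q_a$ ($a=0,1,2$)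 are the invertible operators on $F^{(3)}$ determined by $Q_av_0=\psi^+_{a,(-1)}v_0$, $\psi_a^\pm(w)Q_a=w^{\pm1}Q_a\psi_a^\pm(w)$, $\psi^\pm_a(w)Q_b=-Q_b\psi_a^\pm(w)$ and $Q_aQ_b=-Q_bQ_a$ for $a\neq b$. Put $T_1=Q_1Q_0^{-1}$, $T_2=Q_2Q_1^{-1}$. Series: $c_i,d_i,e_i$ ($i\in\mathbb{Z}$) are formal variables, $C(w)=\sum_{i\in\mathbb{Z}} c_iw^{-i-1}$, and similarly $D(w)$, $E(w)$ with $d_i$, $e_i$. For $X=C,D,E$ and $\alpha\in\mathbb{Z}$ put $X^{(\alpha)}(w)=(-1)^\alpha w^\alpha X(w)$. $\mathrm{Res}_w$ denotes the coefficient of $w^{-1}$. The ring $\mathbb{C}[[c_i,d_i,e_i]]_{i\in\mathbb Z}$ consists of all formal, possibly infinite, linear combinations of monomials. $\tau$-functions: with $E_{ab}(w)=\psi_a^+(w)\psi_b^-(w)$ for $a\ne b$, let $$g^{(\alpha,\beta)}=\exp\big(\mathrm{Res}_w C^{(\alpha-\beta)}(w)E_{10}(w)\big)\exp\big(\mathrm{Res}_w D^{(\alpha)}(w)E_{20}(w)\big)\exp\big(\mathrm{Res}_w E^{(\beta)}(w)E_{21}(w)\big)$$ acting on $F^{(3)}$ with values in formal series in the variables; it is the lift of the loop group element $\begin{bmatrix} 1 & 0 & 0 \\ C^{(\alpha-\beta)}(z) & 1 & 0 \\ D^{(\alpha)}(z) & E^{(\beta)}(z) & 1 \end{bmatrix}$.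 Then $$\tau_{k,\ell}^{(\alpha,\beta)}=\langle T_1^kT_2^\ell v_0,\,g^{(\alpha,\beta)}v_0\rangle\in\mathbb{C}[[c_i,d_i,e_i]]_{i\in\mathbb Z},\qquad k,\ell,\alpha,\beta\in\mathbb{Z}.$$ *)

theory Defs
  imports Complex_Main "HOL-Library.Poly_Mapping" "HOL-Library.Multiset" "HOL-Library.Numeral_Type"
begin

section \<open>The three-component Fock space\<close>

text \<open>
  The pair \<open>(a, k)\<close> stands for the basis vector \<open>e\<^sub>a z\<^sup>k\<close>, where \<open>a\<close> ranges over the
  three-element type \<open>3\<close>, whose elements are \<open>0 < 1 < 2\<close>.  The relation \<open>precedes\<close> is the
  order in which the factors of \<open>v\<^sub>0\<close> are written.
\<close>

type_synonym mode = "3 \<times> int"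

definition precedes :: "mode \<Rightarrow> mode \<Rightarrow> bool" where
  "precedes x y \<longleftrightarrow> snd x < snd y \<or> (snd x = snd y \<and> fst x < fst y)"

definition vac_set :: "mode set" where
  "vac_set = {x. 0 \<le> snd x}"

text \<open>
  A configuration \<open>S\<close> represents the semi-infinite wedge of the elements of \<open>S\<close>, written in
  increasing order; these wedges are a basis of \<open>F\<^sup>(\<^sup>3\<^sup>)\<close> (see \<open>fock_span\<close> below), so that
  \<open>F\<^sup>(\<^sup>3\<^sup>)\<close> consists of the finitely supported complex functions of \<open>S\<close>.
\<close>

typedef config = "{S :: mode set. finite (S - vac_set) \<and> finite (vac_set - S)}"
  morphisms occupied Config
  by (rule exI[of _ vac_set]) simp

type_synonym fock = "config \<Rightarrow>\<^sub>0 complex"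

definition fscale :: "complex \<Rightarrow> fock \<Rightarrow> fock" where
  "fscale c v = Poly_Mapping.map ((*) c) v"

lemma lookup_fscale [simp]: "Poly_Mapping.lookup (fscale c v) S = c * Poly_Mapping.lookup v S"
  by (simp add: fscale_def map.rep_eq when_def)

interpretation fock: vector_space fscale
  by unfold_locales (auto intro!: poly_mapping_eqI simp: lookup_add algebra_simps)

abbreviation flinear :: "(fock \<Rightarrow> fock) \<Rightarrow> bool" where
  "flinear \<equiv> Vector_Spaces.linear fscale fscale"

abbreviation fform_linear :: "(fock \<Rightarrow> complex) \<Rightarrow> bool" where
  "fform_linear \<equiv> Vector_Spaces.linear fscale (*)"

definition lin_ext :: "(config \<Rightarrow> fock) \<Rightarrow> fock \<Rightarrow> fock" where
  "lin_ext h v = (\<Sum>S\<in>Poly_Mapping.keys v. fscale (Poly_Mapping.lookup v S) (h S))"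

definition v0 :: fock where
  "v0 = Poly_Mapping.single (Config vac_set) 1"

text \<open>The sign produced by moving \<open>e\<^sub>a z\<^sup>k\<close> from the front of the wedge to its ordered position.\<close>

definition wsign :: "mode \<Rightarrow> config \<Rightarrow> complex" where
  "wsign x S = (- 1) ^ card {y \<in> occupied S. precedes y x}"

definition wedge :: "mode \<Rightarrow> fock \<Rightarrow> fock" where
  "wedge x = lin_ext (\<lambda>S. if x \<in> occupied S then 0
     else Poly_Mapping.single (Config (insert x (occupied S))) (wsign x S))"

definition contract :: "mode \<Rightarrow> fock \<Rightarrow> fock" where
  "contract x = lin_ext (\<lambda>S. if x \<in> occupied S
     then Poly_Mapping.single (Config (occupied S - {x})) (wsign x S) else 0)"

definition psi_plus :: "3 \<Rightarrow> int \<Rightarrow> fock \<Rightarrow> fock" where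
  "psi_plus a k = wedge (a, k)"

definition psi_minus :: "3 \<Rightarrow> int \<Rightarrow> fock \<Rightarrow> fock" where
  "psi_minus a k = contract (a, - k - 1)"

subsection \<open>Basic properties\<close>

lemma vac_occ [simp]: "occupied (Config vac_set) = vac_set"
  by (subst Config_inverse) auto

lemma vac_set_iff [simp]: "x \<in> vac_set \<longleftrightarrow> 0 \<le> snd x"
  by (simp add: vac_set_def)

lemma occ_fin: "finite (occupied S - vac_set)" "finite (vac_set - occupied S)"
  using occupied[of S] by auto

lemma occ_insert [simp]: "occupied (Config (insert x (occupied S))) = insert x (occupied S)"
proof (rule Config_inverse, rule CollectI, rule conjI)
  show "finite (insert x (occupied S) - vac_set)"
    by (rule finite_subset[of _ "insert x (occupied S - vac_set)"]) (auto simp: occ_fin)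
  show "finite (vac_set - insert x (occupied S))"
    by (rule finite_subset[of _ "vac_set - occupied S"]) (auto simp: occ_fin)
qed

lemma occ_delete [simp]: "occupied (Config (occupied S - {x})) = occupied S - {x}"
proof (rule Config_inverse, rule CollectI, rule conjI)
  show "finite (occupied S - {x} - vac_set)"
    by (rule finite_subset[of _ "occupied S - vac_set"]) (auto simp: occ_fin)
  show "finite (vac_set - (occupied S - {x}))"
    by (rule finite_subset[of _ "insert x (vac_set - occupied S)"]) (auto simp: occ_fin)
qed

lemma finite_below: "finite {y \<in> occupied S. snd y \<le> n}"
proof (rule finite_subset)
  show "{y \<in> occupied S. snd y \<le> n} \<subseteq> (occupied S - vac_set) \<union> (UNIV \<times> {0..n})"
    by (auto simp: vac_set_def)
qed (auto simp: occ_fin)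

lemma finite_preceding: "finite {y \<in> occupied S. precedes y x}"
  by (rule finite_subset[OF _ finite_below[of S "snd x"]]) (auto simp: precedes_def)

lemma lookup_linear_sum:
  assumes "Vector_Spaces.linear fscale s L"
  shows "L v = (\<Sum>S\<in>Poly_Mapping.keys v. s (Poly_Mapping.lookup v S) (L (Poly_Mapping.single S 1)))"
proof -
  interpret L: Vector_Spaces.linear fscale s L by fact
  have "v = (\<Sum>S\<in>Poly_Mapping.keys v. fscale (Poly_Mapping.lookup v S) (Poly_Mapping.single S 1))"
    by (rule poly_mapping_eqI)
      (auto simp: lookup_sum lookup_single when_def in_keys_iff if_distrib cong: if_cong)
  then have "L v = L (\<Sum>S\<in>Poly_Mapping.keys v. fscale (Poly_Mapping.lookup v S) (Poly_Mapping.single S 1))" by simp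
  also have "\<dots> = (\<Sum>S\<in>Poly_Mapping.keys v. s (Poly_Mapping.lookup v S) (L (Poly_Mapping.single S 1)))"
    by (simp add: L.sum L.scale)
  finally show ?thesis .
qed

lemma linear_eqI:
  assumes "Vector_Spaces.linear fscale s L" "Vector_Spaces.linear fscale s L'"
    and "\<And>S. L (Poly_Mapping.single S 1) = L' (Poly_Mapping.single S 1)"
  shows "L = L'"
  by (rule ext, subst lookup_linear_sum[OF assms(1)], subst lookup_linear_sum[OF assms(2)])
    (simp only: assms(3))

lemma lin_ext_superset:
  assumes "finite A" "Poly_Mapping.keys v \<subseteq> A"
  shows "lin_ext h v = (\<Sum>S\<in>A. fscale (Poly_Mapping.lookup v S) (h S))"
  unfolding lin_ext_def using assms
  by (intro sum.mono_neutral_left) (auto simp: in_keys_iff)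

lemma flinear_lin_ext [simp]: "flinear (lin_ext h)"
proof (unfold_locales)
  fix u v :: fock and c :: complex
  show "lin_ext h (u + v) = lin_ext h u + lin_ext h v"
    by (subst (1 2 3) lin_ext_superset[of "Poly_Mapping.keys u \<union> Poly_Mapping.keys v"])
      (auto simp: lookup_add fock.scale_left_distrib sum.distrib dest: keys_add[THEN subsetD])
  show "lin_ext h (fscale c u) = fscale c (lin_ext h u)"
    by (subst (1 2) lin_ext_superset[of "Poly_Mapping.keys u"])
      (auto simp: in_keys_iff fock.scale_sum_right)
qed

lemma lin_ext_single [simp]: "lin_ext h (Poly_Mapping.single S c) = fscale c (h S)"
  by (subst lin_ext_superset[of "{S}"]) auto

lemma fscale_single [simp]: "fscale c (Poly_Mapping.single S d) = Poly_Mapping.single S (c * d)"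
  by (rule poly_mapping_eqI) (simp add: lookup_single when_def)

lemma psi_linear [simp]: "flinear (psi_plus a k)" "flinear (psi_minus a k)"
  by (simp_all add: psi_plus_def psi_minus_def wedge_def contract_def)

lemma flinearD:
  assumes "flinear L"
  shows "L (u + v) = L u + L v" "L (u - v) = L u - L v" "L (- v) = - L v" "L (fscale c v) = fscale c (L v)" "L 0 = 0"
proof -
  interpret L: Vector_Spaces.linear fscale fscale L by fact
  show "L (u + v) = L u + L v" "L (u - v) = L u - L v" "L (- v) = - L v" "L (fscale c v) = fscale c (L v)" "L 0 = 0"
    by (simp_all add: L.add L.diff L.neg L.scale)
qed

lemma wedge_single:
  "wedge x (Poly_Mapping.single S c) = (if x \<in> occupied S then 0
     else Poly_Mapping.single (Config (insert x (occupied S))) (c * wsign x S))"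
  by (simp add: wedge_def)

lemma contract_single:
  "contract x (Poly_Mapping.single S c) = (if x \<in> occupied S
     then Poly_Mapping.single (Config (occupied S - {x})) (c * wsign x S) else 0)"
  by (simp add: contract_def)

lemma wsign_cases: "wsign x S = 1 \<or> wsign x S = - 1"
  unfolding wsign_def by (cases "even (card {y \<in> occupied S. precedes y x})") auto

lemma wsign_sq [simp]: "wsign x S * wsign x S = 1"
  using wsign_cases[of x S] by auto

lemma precedes_irrefl [simp]: "\<not> precedes x x"
  by (simp add: precedes_def)

lemma wsign_insert:
  assumes "x \<notin> occupied S"
  shows "wsign y (Config (insert x (occupied S))) = (if precedes x y then - wsign y S else wsign y S)"
proof -
  have "{z \<in> insert x (occupied S). precedes z y} =
    (if precedes x y then insert x {z \<in> occupied S. precedes z y} else {z \<in> occupied S. precedes z y})"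
    by auto
  then show ?thesis using assms by (simp add: wsign_def finite_preceding)
qed

lemma wsign_insert_self:
  "x \<notin> occupied S \<Longrightarrow> wsign x (Config (insert x (occupied S))) = wsign x S"
  by (simp add: wsign_insert)

lemma occ_eq_insert:
  assumes "x \<in> occupied S"
  obtains T where "x \<notin> occupied T" "S = Config (insert x (occupied T))"
proof
  let ?T = "Config (occupied S - {x})"
  show "x \<notin> occupied ?T" by simp
  show "S = Config (insert x (occupied ?T))"
    using assms by (simp add: insert_absorb occupied_inverse)
qed

lemma contract_wedge_single:
  assumes "x \<notin> occupied S"
  shows "contract x (wedge x (Poly_Mapping.single S c)) = Poly_Mapping.single S c"
  using assms by (simp add: wedge_single contract_single wsign_insert mult.assoc occupied_inverse)

lemma contract_wedge:
  assumes "\<And>S. S \<in> Poly_Mapping.keys v \<Longrightarrow> x \<notin> occupied S"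
  shows "contract x (wedge x v) = v" and "contract x v = 0"
proof -
  have "flinear (\<lambda>v. contract x (wedge x v))"
    using Vector_Spaces.linear_compose[of fscale fscale "wedge x" fscale "contract x"]
    by (simp add: wedge_def contract_def o_def)
  from lookup_linear_sum[OF this, of v]
  have "contract x (wedge x v) = (\<Sum>S\<in>Poly_Mapping.keys v. fscale (Poly_Mapping.lookup v S) (Poly_Mapping.single S 1))"
    using assms by (simp add: contract_wedge_single)
  also have "\<dots> = v"
    by (rule poly_mapping_eqI)
      (auto simp: lookup_sum lookup_single when_def in_keys_iff if_distrib cong: if_cong)
  finally show "contract x (wedge x v) = v" .
  show "contract x v = 0"
    using assms by (auto simp: contract_def lin_ext_def intro!: sum.neutral)
qed

lemma psi_vac: "k \<ge> 0 \<Longrightarrow> psi_plus a k v0 = 0" "k \<ge> 0 \<Longrightarrow> psi_minus a k v0 = 0"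
  by (auto simp: psi_plus_def psi_minus_def v0_def wedge_single contract_single)


lemma precedes_total: "x \<noteq> y \<Longrightarrow> precedes x y \<longleftrightarrow> \<not> precedes y x"
  by (cases x; cases y) (auto simp: precedes_def)

lemma wsign_delete:
  assumes "x \<in> occupied S"
  shows "wsign y (Config (occupied S - {x})) = (if precedes x y then - wsign y S else wsign y S)"
proof -
  have "{z \<in> occupied S. precedes z y} =
    (if precedes x y then insert x {z \<in> occupied S - {x}. precedes z y} else {z \<in> occupied S - {x}. precedes z y})"
    using assms by auto
  moreover have "finite {z \<in> occupied S - {x}. precedes z y}"
    using finite_preceding[of S y] by (rule rev_finite_subset) auto
  ultimately show ?thesis by (simp add: wsign_def)
qed

lemma flinear_comp: "flinear f \<Longrightarrow> flinear g \<Longrightarrow> flinear (\<lambda>v. f (g v))"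
  using Vector_Spaces.linear_compose[of fscale fscale g fscale f] by (simp add: o_def)

lemma flinear_add: "flinear f \<Longrightarrow> flinear g \<Longrightarrow> flinear (\<lambda>v. f v + g v)"
  by (unfold_locales) (auto simp: flinearD fock.scale_right_distrib)

lemma flinear_const_zero: "flinear (\<lambda>v. if P then v else 0)"
  by unfold_locales auto

lemma wc_linear [simp]: "flinear (wedge x)" "flinear (contract x)"
  by (simp_all add: wedge_def contract_def)

lemma wc_zero [simp]: "wedge x 0 = 0" "contract x 0 = 0"
  by (simp_all add: flinearD)

lemma single_cancel: "c + d = 0 \<Longrightarrow> Poly_Mapping.single S c + Poly_Mapping.single S d = 0"
  by (simp add: single_add[symmetric])

lemma wedge_wedge: "wedge x (wedge y v) + wedge y (wedge x v) = 0"
proof -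
  have "(\<lambda>v. wedge x (wedge y v) + wedge y (wedge x v)) = (\<lambda>v. if False then v else 0)"
  proof (rule linear_eqI[of fscale])
    fix S
    show "wedge x (wedge y (Poly_Mapping.single S 1)) + wedge y (wedge x (Poly_Mapping.single S 1)) =
        (if False then Poly_Mapping.single S 1 else 0)"
      using precedes_total[of x y]
      by (cases "x = y") (auto simp: wedge_single wsign_insert insert_commute intro!: single_cancel)
  qed (intro flinear_add flinear_comp[OF wc_linear(1) wc_linear(1)] flinear_const_zero)+
  then show ?thesis by (simp add: fun_eq_iff)
qed

lemma contract_contract: "contract x (contract y v) + contract y (contract x v) = 0"
proof -
  have "(\<lambda>v. contract x (contract y v) + contract y (contract x v)) = (\<lambda>v. if False then v else 0)"
  proof (rule linear_eqI[of fscale])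
    fix S
    show "contract x (contract y (Poly_Mapping.single S 1)) + contract y (contract x (Poly_Mapping.single S 1)) =
        (if False then Poly_Mapping.single S 1 else 0)"
      using precedes_total[of x y]
      by (cases "x = y"; cases "x \<in> occupied S"; cases "y \<in> occupied S")
        (simp_all add: contract_single wsign_delete single_cancel Diff_insert[symmetric] insert_commute)
  qed (intro flinear_add flinear_comp[OF wc_linear(2) wc_linear(2)] flinear_const_zero)+
  then show ?thesis by (simp add: fun_eq_iff)
qed

lemma wedge_contract: "wedge x (contract y v) + contract y (wedge x v) = (if x = y then v else 0)"
proof -
  have "(\<lambda>v. wedge x (contract y v) + contract y (wedge x v)) = (\<lambda>v. if x = y then v else 0)"
  proof (rule linear_eqI[of fscale])
    fix S
    show "wedge x (contract y (Poly_Mapping.single S 1)) + contract y (wedge x (Poly_Mapping.single S 1)) =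
        (if x = y then Poly_Mapping.single S 1 else 0)"
      using precedes_total[of x y]
      by (cases "x = y"; cases "x \<in> occupied S"; cases "y \<in> occupied S")
        (simp_all add: wedge_single contract_single wsign_delete wsign_insert insert_absorb occupied_inverse
          insert_Diff_if single_cancel)
  qed (intro flinear_add flinear_comp[OF wc_linear(1) wc_linear(2)] flinear_comp[OF wc_linear(2) wc_linear(1)]
      flinear_const_zero)+
  then show ?thesis by (simp add: fun_eq_iff)
qed

lemma psi_anticommutators:
  "psi_plus a k (psi_minus b l v) + psi_minus b l (psi_plus a k v) = (if a = b \<and> k + l = - 1 then v else 0)"
  "psi_plus a k (psi_plus b l v) + psi_plus b l (psi_plus a k v) = 0"
  "psi_minus a k (psi_minus b l v) + psi_minus b l (psi_minus a k v) = 0"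
proof -
  have "(a, k) = (b, - l - 1) \<longleftrightarrow> a = b \<and> k + l = - 1" by auto
  then show "psi_plus a k (psi_minus b l v) + psi_minus b l (psi_plus a k v) = (if a = b \<and> k + l = - 1 then v else 0)"
    using wedge_contract[of "(a, k)" "(b, - l - 1)" v] by (simp only: psi_plus_def psi_minus_def)
qed (simp_all only: psi_plus_def psi_minus_def wedge_wedge contract_contract)

lemma config_induct:
  assumes vac: "P (Config vac_set)"
    and ins: "\<And>S x. P S \<Longrightarrow> x \<notin> occupied S \<Longrightarrow> P (Config (insert x (occupied S)))"
    and del: "\<And>S x. P S \<Longrightarrow> x \<in> occupied S \<Longrightarrow> P (Config (occupied S - {x}))"
  shows "P S"
proof (induction "card ((occupied S - vac_set) \<union> (vac_set - occupied S))" arbitrary: S rule: less_induct)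
  case less
  let ?D = "\<lambda>S. (occupied S - vac_set) \<union> (vac_set - occupied S)"
  have fin: "finite (?D S)" by (simp add: occ_fin)
  consider "?D S = {}" | x where "x \<in> occupied S - vac_set" | x where "x \<in> vac_set - occupied S"
    by blast
  then show ?case
  proof cases
    case 1
    then have "occupied S = vac_set" by blast
    then have "S = Config vac_set" by (metis occupied_inverse)
    with vac show ?thesis by simp
  next
    case (2 x)
    let ?T = "Config (occupied S - {x})"
    have "?D ?T = ?D S - {x}" "x \<in> ?D S" using 2 by auto
    then have "card (?D ?T) < card (?D S)" using fin by (metis card_Diff1_less)
    from less[OF this] ins[of ?T x] 2 show ?thesis by (simp add: insert_absorb occupied_inverse)
  next
    case (3 x)
    let ?T = "Config (insert x (occupied S))"
    have "?D ?T = ?D S - {x}" "x \<in> ?D S" using 3 by auto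
    then have "card (?D ?T) < card (?D S)" using fin by (metis card_Diff1_less)
    from less[OF this] del[of ?T x] 3 show ?thesis by (simp add: occupied_inverse)
  qed
qed

inductive_set fock_words :: "fock set" where
  "v0 \<in> fock_words"
| "v \<in> fock_words \<Longrightarrow> psi_plus a k v \<in> fock_words"
| "v \<in> fock_words \<Longrightarrow> psi_minus a k v \<in> fock_words"

lemma wedge_uminus: "wedge x (- v) = - wedge x v" and contract_uminus: "contract x (- v) = - contract x v"
  by (simp_all add: wedge_def contract_def flinearD)

lemma single_or_neg_word: "Poly_Mapping.single S 1 \<in> fock_words \<or> - Poly_Mapping.single S 1 \<in> fock_words"
proof (induction S rule: config_induct)
  case 1
  then show ?case using fock_words.intros(1) by (simp add: v0_def)
next
  case (2 S x)
  have "wedge x v \<in> fock_words" if "v \<in> fock_words" for v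
    using fock_words.intros(2)[OF that, of "fst x" "snd x"] by (simp add: psi_plus_def)
  from this[of "Poly_Mapping.single S 1"] this[of "Poly_Mapping.single S (- 1)"] 2 wsign_cases[of x S]
  show ?case by (auto simp: wedge_single wedge_uminus single_uminus)
next
  case (3 S x)
  have "contract x v \<in> fock_words" if "v \<in> fock_words" for v
    using fock_words.intros(3)[OF that, of "fst x" "- snd x - 1"] by (simp add: psi_minus_def)
  from this[of "Poly_Mapping.single S 1"] this[of "Poly_Mapping.single S (- 1)"] 3 wsign_cases[of x S]
  show ?case by (auto simp: contract_single contract_uminus single_uminus)
qed

lemma single_expand: "v = (\<Sum>S\<in>Poly_Mapping.keys v. fscale (Poly_Mapping.lookup v S) (Poly_Mapping.single S 1))"
  by (rule poly_mapping_eqI)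
    (auto simp: lookup_sum lookup_single when_def in_keys_iff if_distrib cong: if_cong)

lemma span_if_basis:
  assumes "\<And>S. Poly_Mapping.single S 1 \<in> X \<or> - Poly_Mapping.single S 1 \<in> X"
  shows "fock.span X = UNIV"
proof -
  have basis: "Poly_Mapping.single S 1 \<in> fock.span X" for S
    using assms[of S]
  proof
    assume "- Poly_Mapping.single S 1 \<in> X"
    from fock.span_neg[OF fock.span_base[OF this]] show ?thesis by (simp only: minus_minus)
  qed (rule fock.span_base)
  have "v \<in> fock.span X" for v
  proof -
    have "(\<Sum>S\<in>Poly_Mapping.keys v. fscale (Poly_Mapping.lookup v S) (Poly_Mapping.single S 1)) \<in> fock.span X"
      by (rule fock.span_sum, rule fock.span_scale, rule basis)
    then show ?thesis by (simp only: single_expand[symmetric])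
  qed
  then show ?thesis by blast
qed

lemma fock_span: "fock.span fock_words = UNIV"
  by (rule span_if_basis) (rule single_or_neg_word)

lemma linear_eq_on_words:
  assumes "flinear L" "flinear L'" "\<And>v. v \<in> fock_words \<Longrightarrow> L v = L' v"
  shows "L = L'"
proof (rule linear_eqI[OF assms(1,2)])
  fix S
  show "L (Poly_Mapping.single S 1) = L' (Poly_Mapping.single S 1)"
    using single_or_neg_word[of S]
  proof
    assume "- Poly_Mapping.single S 1 \<in> fock_words"
    from assms(3)[OF this] show ?thesis
      unfolding flinearD(3)[OF assms(1)] flinearD(3)[OF assms(2)] neg_equal_iff_equal .
  qed (rule assms(3))
qed

subsection \<open>Elementary wedges and the bilinear form\<close>

definition incr_neg :: "int list \<Rightarrow> bool" where
  "incr_neg ks \<longleftrightarrow> sorted_wrt (<) ks \<and> (\<forall>k\<in>set ks. k \<le> - 1)"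

definition M_op :: "3 \<Rightarrow> int list \<Rightarrow> int list \<Rightarrow> fock \<Rightarrow> fock" where
  "M_op a ks ls v = foldr (psi_plus a) ks (foldr (psi_minus a) ls v)"

definition elementary_wedge :: "(3 \<Rightarrow> int list) \<Rightarrow> (3 \<Rightarrow> int list) \<Rightarrow> fock" where
  "elementary_wedge p m = M_op 2 (p 2) (m 2) (M_op 1 (p 1) (m 1) (M_op 0 (p 0) (m 0) v0))"

definition elementary_wedges :: "fock set" where
  "elementary_wedges = {elementary_wedge p m | p m. \<forall>a. incr_neg (p a) \<and> incr_neg (m a)}"

definition wedge_form :: "(fock \<Rightarrow> fock \<Rightarrow> complex) \<Rightarrow> bool" where
  "wedge_form B \<longleftrightarrow>
     (\<forall>u. fform_linear (\<lambda>v. B u v)) \<and> (\<forall>v. fform_linear (\<lambda>u. B u v)) \<and>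
     (\<forall>u\<in>elementary_wedges. \<forall>v\<in>elementary_wedges. B u v = (if u = v then 1 else 0))"

text \<open>Exactly one form satisfies \<open>wedge_form\<close>: see \<open>wedge_form_unique\<close> and \<open>wedge_form_fock_form\<close>.\<close>

definition fock_form :: "fock \<Rightarrow> fock \<Rightarrow> complex" where
  "fock_form = (THE B. wedge_form B)"

lemma UNIV_3: "(UNIV :: 3 set) = {0, 1, 2}"
proof -
  have "card {0, 1, 2 :: 3} = CARD(3)" by simp
  then show ?thesis by (metis card_subset_eq finite subset_UNIV)
qed

definition is_wedge :: "mode set \<Rightarrow> fock \<Rightarrow> bool" where
  "is_wedge X v \<longleftrightarrow> (\<exists>T. occupied T = X \<and> (v = Poly_Mapping.single T 1 \<or> v = Poly_Mapping.single T (- 1)))"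

lemma is_wedge_plus: "is_wedge X v \<Longrightarrow> (a, k) \<notin> X \<Longrightarrow> is_wedge (insert (a, k) X) (psi_plus a k v)"
proof -
  assume "is_wedge X v" and x: "(a, k) \<notin> X"
  then obtain T c where T: "occupied T = X" "v = Poly_Mapping.single T c" "c = 1 \<or> c = - 1"
    unfolding is_wedge_def by blast
  have "psi_plus a k v = Poly_Mapping.single (Config (insert (a, k) X)) (c * wsign (a, k) T)"
    using T x by (simp add: psi_plus_def wedge_single)
  moreover have "c * wsign (a, k) T = 1 \<or> c * wsign (a, k) T = - 1"
    using T(3) wsign_cases[of "(a, k)" T] by (elim disjE) simp_all
  moreover have "occupied (Config (insert (a, k) X)) = insert (a, k) X"
    using occ_insert[of "(a, k)" T] unfolding T(1) .
  ultimately show ?thesis unfolding is_wedge_def by metis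
qed

lemma is_wedge_minus: "is_wedge X v \<Longrightarrow> (a, - k - 1) \<in> X \<Longrightarrow> is_wedge (X - {(a, - k - 1)}) (psi_minus a k v)"
proof -
  assume "is_wedge X v" and x: "(a, - k - 1) \<in> X"
  then obtain T c where T: "occupied T = X" "v = Poly_Mapping.single T c" "c = 1 \<or> c = - 1"
    unfolding is_wedge_def by blast
  have "psi_minus a k v = Poly_Mapping.single (Config (X - {(a, - k - 1)})) (c * wsign (a, - k - 1) T)"
    unfolding psi_minus_def T(2) contract_single T(1) using x by (simp only: if_True)
  moreover have "c * wsign (a, - k - 1) T = 1 \<or> c * wsign (a, - k - 1) T = - 1"
    using T(3) wsign_cases[of "(a, - k - 1)" T] by (elim disjE) simp_all
  moreover have "occupied (Config (X - {(a, - k - 1)})) = X - {(a, - k - 1)}"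
    using occ_delete[of T "(a, - k - 1)"] unfolding T(1) .
  ultimately show ?thesis unfolding is_wedge_def by metis
qed

lemma is_wedge_foldr_plus:
  "is_wedge X v \<Longrightarrow> distinct ks \<Longrightarrow> \<forall>k\<in>set ks. (a, k) \<notin> X \<Longrightarrow>
   is_wedge (X \<union> Pair a ` set ks) (foldr (psi_plus a) ks v)"
proof (induction ks)
  case (Cons k ks)
  then have "is_wedge (insert (a, k) (X \<union> Pair a ` set ks)) (psi_plus a k (foldr (psi_plus a) ks v))"
    by (intro is_wedge_plus) auto
  then show ?case by simp
qed simp

lemma is_wedge_foldr_minus:
  "is_wedge X v \<Longrightarrow> distinct ks \<Longrightarrow> \<forall>k\<in>set ks. (a, - k - 1) \<in> X \<Longrightarrow>
   is_wedge (X - (\<lambda>k. (a, - k - 1)) ` set ks) (foldr (psi_minus a) ks v)"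
proof (induction ks)
  case (Cons k ks)
  then have "is_wedge (X - (\<lambda>k. (a, - k - 1)) ` set ks - {(a, - k - 1)})
      (psi_minus a k (foldr (psi_minus a) ks v))"
    by (intro is_wedge_minus) auto
  moreover have "X - (\<lambda>k. (a, - k - 1)) ` set ks - {(a, - k - 1)} =
      X - (\<lambda>k. (a, - k - 1)) ` set (k # ks)" by auto
  ultimately show ?case by simp
qed simp

lemma incr_neg_distinct: "incr_neg ks \<Longrightarrow> distinct ks"
  using strict_sorted_iff[of ks] by (simp add: incr_neg_def)

definition ew_set :: "3 set \<Rightarrow> (3 \<Rightarrow> int list) \<Rightarrow> (3 \<Rightarrow> int list) \<Rightarrow> mode set" where
  "ew_set A p m = {(a, k) | a k. if a \<in> A then k \<in> set (p a) \<or> (k \<ge> 0 \<and> - k - 1 \<notin> set (m a)) else k \<ge> 0}"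

lemma is_wedge_M:
  assumes "is_wedge (ew_set A p m) v" "b \<notin> A" "incr_neg (p b)" "incr_neg (m b)"
  shows "is_wedge (ew_set (insert b A) p m) (M_op b (p b) (m b) v)"
proof -
  let ?X = "ew_set A p m"
  let ?Y = "?X - (\<lambda>k. (b, - k - 1)) ` set (m b)"
  have "is_wedge ?Y (foldr (psi_minus b) (m b) v)"
    using assms by (intro is_wedge_foldr_minus) (auto simp: incr_neg_distinct ew_set_def incr_neg_def)
  then have "is_wedge (?Y \<union> Pair b ` set (p b)) (M_op b (p b) (m b) v)"
    unfolding M_op_def using assms
    by (intro is_wedge_foldr_plus) (auto simp: incr_neg_distinct ew_set_def incr_neg_def)
  also have "?Y \<union> Pair b ` set (p b) = ew_set (insert b A) p m"
    using assms(2-4)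
    by (force simp: ew_set_def incr_neg_def image_iff split: if_splits)
  finally show ?thesis .
qed

lemma is_wedge_elementary:
  assumes "\<forall>a. incr_neg (p a) \<and> incr_neg (m a)"
  shows "is_wedge (ew_set UNIV p m) (elementary_wedge p m)"
proof -
  have "ew_set {} p m = vac_set" by (auto simp: ew_set_def)
  then have "is_wedge (ew_set {} p m) v0" unfolding is_wedge_def v0_def using vac_occ by metis
  then have "is_wedge (ew_set {0} p m) (M_op 0 (p 0) (m 0) v0)"
    using is_wedge_M[of "{}" p m v0 0] assms by simp
  then have "is_wedge (ew_set {1, 0} p m) (M_op 1 (p 1) (m 1) (M_op 0 (p 0) (m 0) v0))"
    by (rule is_wedge_M) (use assms in auto)
  then have "is_wedge (ew_set {2, 1, 0} p m) (elementary_wedge p m)"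
    unfolding elementary_wedge_def by (rule is_wedge_M) (use assms in auto)
  moreover have "{2, 1, 0 :: 3} = UNIV" using UNIV_3 by auto
  ultimately show ?thesis by simp
qed

lemma ew_set_inj:
  assumes "\<forall>a. incr_neg (p a) \<and> incr_neg (m a)" "\<forall>a. incr_neg (p' a) \<and> incr_neg (m' a)"
    and "ew_set UNIV p m = ew_set UNIV p' m'"
  shows "p = p'" "m = m'"
proof -
  have P: "set (p a) = {k. k < 0 \<and> (a, k) \<in> ew_set UNIV p m}"
    "set (m a) = {l. l < 0 \<and> (a, - l - 1) \<notin> ew_set UNIV p m}"
    if "\<forall>a. incr_neg (p a) \<and> incr_neg (m a)" for p m a
    using that by (auto simp: ew_set_def incr_neg_def) force+
  have "set (p a) = set (p' a)" "set (m a) = set (m' a)" for a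
    using P[OF assms(1)] P[OF assms(2)] assms(3) by simp_all
  then have "p a = p' a" "m a = m' a" for a
    using assms(1,2) by (auto simp: incr_neg_def intro!: strict_sorted_equal)
  then show "p = p'" "m = m'" by auto
qed

lemma elementary_wedge_exists:
  "\<exists>v\<in>elementary_wedges. is_wedge (occupied S) v"
proof -
  define p where "p a = sorted_list_of_set {k. k < 0 \<and> (a, k) \<in> occupied S}" for a
  define m where "m a = sorted_list_of_set {l. l < 0 \<and> (a, - l - 1) \<notin> occupied S}" for a
  have f1: "finite {k. k < 0 \<and> (a, k) \<in> occupied S}" for a
  proof (rule finite_subset)
    show "{k. k < 0 \<and> (a, k) \<in> occupied S} \<subseteq> snd ` (occupied S - vac_set)" by force
  qed (simp add: occ_fin)
  have f2: "finite {l. l < 0 \<and> (a, - l - 1) \<notin> occupied S}" for a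
  proof (rule finite_subset)
    show "{l. l < 0 \<and> (a, - l - 1) \<notin> occupied S} \<subseteq> (\<lambda>x. - snd x - 1) ` (vac_set - occupied S)"
      by (force simp: image_iff)
  qed (simp add: occ_fin)
  have i: "\<forall>a. incr_neg (p a) \<and> incr_neg (m a)"
    using f1 f2 by (auto simp: incr_neg_def p_def m_def)
  have "ew_set UNIV p m = occupied S"
    using f1 f2 by (force simp: ew_set_def p_def m_def)
  with is_wedge_elementary[OF i] i show ?thesis
    by (auto simp: elementary_wedges_def)
qed

lemma elementary_wedges_basis:
  "Poly_Mapping.single S 1 \<in> elementary_wedges \<or> - Poly_Mapping.single S 1 \<in> elementary_wedges"
  using elementary_wedge_exists[of S]
  by (auto simp: is_wedge_def occupied_inject single_uminus)

lemma elementary_wedges_unique: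
  assumes "u \<in> elementary_wedges" "v \<in> elementary_wedges" "is_wedge X u" "is_wedge X v"
  shows "u = v"
proof -
  from assms(1) obtain p m where u: "u = elementary_wedge p m" "\<forall>a. incr_neg (p a) \<and> incr_neg (m a)"
    by (auto simp: elementary_wedges_def)
  from assms(2) obtain p' m' where v: "v = elementary_wedge p' m'" "\<forall>a. incr_neg (p' a) \<and> incr_neg (m' a)"
    by (auto simp: elementary_wedges_def)
  have *: "Y = Z" if "is_wedge Y w" "is_wedge Z w" for Y Z w
  proof -
    from that obtain T T' c c' where "w = Poly_Mapping.single T c" "w = Poly_Mapping.single T' c'"
      "c \<noteq> 0" "occupied T = Y" "occupied T' = Z"
      unfolding is_wedge_def by (metis one_neq_zero neg_equal_0_iff_equal)
    then show ?thesis by (metis lookup_single_eq lookup_single_not_eq)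
  qed
  have "ew_set UNIV p m = X" "ew_set UNIV p' m' = X"
    using *[OF is_wedge_elementary[OF u(2)]] *[OF is_wedge_elementary[OF v(2)]] u(1) v(1) assms(3,4)
    by blast+
  with ew_set_inj[OF u(2) v(2)] u v show ?thesis by simp
qed

definition coord_form :: "fock \<Rightarrow> fock \<Rightarrow> complex" where
  "coord_form u v = (\<Sum>S\<in>Poly_Mapping.keys u. Poly_Mapping.lookup u S * Poly_Mapping.lookup v S)"

lemma coord_form_superset:
  assumes "finite A" "Poly_Mapping.keys u \<subseteq> A"
  shows "coord_form u v = (\<Sum>S\<in>A. Poly_Mapping.lookup u S * Poly_Mapping.lookup v S)"
  unfolding coord_form_def using assms
  by (intro sum.mono_neutral_left) (auto simp: in_keys_iff)

lemma elementary_wedge_single: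
  assumes "u \<in> elementary_wedges"
  obtains S c where "u = Poly_Mapping.single S c" "c = 1 \<or> c = - 1" "is_wedge (occupied S) u"
proof -
  from assms obtain X where "is_wedge X u"
    by (auto simp: elementary_wedges_def dest!: is_wedge_elementary)
  then obtain T c where T: "occupied T = X" "u = Poly_Mapping.single T c" "c = 1 \<or> c = - 1"
    unfolding is_wedge_def by blast
  show thesis by (rule that[OF T(2,3)]) (use \<open>is_wedge X u\<close> T in simp)
qed

lemma fform_linearI:
  assumes "\<And>u v. f (u + v) = f u + f v" "\<And>c u. f (fscale c u) = c * f u"
  shows "fform_linear f"
  using assms by unfold_locales (auto simp: algebra_simps)

lemma wedge_form_coord_form: "wedge_form coord_form"
  unfolding wedge_form_def
proof (intro conjI allI ballI)
  fix u :: fock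
  show "fform_linear (coord_form u)"
    by (rule fform_linearI)
      (auto simp: coord_form_def lookup_add algebra_simps sum.distrib sum_distrib_left)
next
  fix w :: fock
  show "fform_linear (\<lambda>u. coord_form u w)"
  proof (rule fform_linearI)
    fix u v :: fock and c :: complex
    show "coord_form (u + v) w = coord_form u w + coord_form v w"
      by (subst (1 2 3) coord_form_superset[of "Poly_Mapping.keys u \<union> Poly_Mapping.keys v"])
        (auto simp: lookup_add algebra_simps sum.distrib dest: keys_add[THEN subsetD])
    show "coord_form (fscale c u) w = c * coord_form u w"
      by (subst (1 2) coord_form_superset[of "Poly_Mapping.keys u"])
        (auto simp: in_keys_iff sum_distrib_left mult.assoc)
  qed
next
  fix u v assume uv: "u \<in> elementary_wedges" "v \<in> elementary_wedges"
  from elementary_wedge_single[OF uv(1)] obtain S c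
    where S: "u = Poly_Mapping.single S c" "c = 1 \<or> c = - 1" "is_wedge (occupied S) u" .
  from elementary_wedge_single[OF uv(2)] obtain T d
    where T: "v = Poly_Mapping.single T d" "d = 1 \<or> d = - 1" "is_wedge (occupied T) v" .
  show "coord_form u v = (if u = v then 1 else 0)"
  proof (cases "S = T")
    case True
    then have "u = v" using elementary_wedges_unique[OF uv S(3)] T(3) by simp
    then show ?thesis using S by (auto simp: coord_form_def)
  next
    case False
    moreover have "u \<noteq> v"
    proof
      assume "u = v"
      then have "Poly_Mapping.lookup (Poly_Mapping.single S c) S = Poly_Mapping.lookup (Poly_Mapping.single T d) S"
        using S T by simp
      then show False using False S(2) by (auto simp: lookup_single when_def)
    qed
    ultimately show ?thesis using S T by (auto simp: coord_form_def lookup_single_not_eq)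
  qed
qed

lemma form_linear_eqI:
  assumes "fform_linear f" "fform_linear g" "\<And>u. u \<in> elementary_wedges \<Longrightarrow> f u = g u"
  shows "f = g"
proof (rule linear_eqI[OF assms(1,2)])
  interpret f: Vector_Spaces.linear fscale "(*)" f by fact
  interpret g: Vector_Spaces.linear fscale "(*)" g by fact
  fix S
  show "f (Poly_Mapping.single S 1) = g (Poly_Mapping.single S 1)"
    using elementary_wedges_basis[of S]
  proof
    assume "- Poly_Mapping.single S 1 \<in> elementary_wedges"
    from assms(3)[OF this] show ?thesis unfolding f.neg g.neg neg_equal_iff_equal .
  qed (rule assms(3))
qed

lemma wedge_form_unique:
  assumes "wedge_form B" "wedge_form B'"
  shows "B = B'"
proof -
  have "(\<lambda>v. B u v) = (\<lambda>v. B' u v)" if "u \<in> elementary_wedges" for u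
    using assms that by (intro form_linear_eqI) (auto simp: wedge_form_def)
  then have "(\<lambda>u. B u v) = (\<lambda>u. B' u v)" for v
    using assms by (intro form_linear_eqI) (auto simp: wedge_form_def dest: fun_cong)
  then show ?thesis by (auto simp: fun_eq_iff)
qed

lemma fock_form_eq: "fock_form = coord_form"
  unfolding fock_form_def using wedge_form_coord_form wedge_form_unique by (metis the_equality)

lemma wedge_form_fock_form: "wedge_form fock_form"
  using fock_form_eq wedge_form_coord_form by simp

section \<open>Fields and the fermionic translation operators\<close>

text \<open>A formal distribution in \<open>w\<close> is the function giving its coefficient of \<open>w\<^sup>n\<close> for every \<open>n\<close>.\<close>

definition plus_field :: "3 \<Rightarrow> int \<Rightarrow> fock \<Rightarrow> fock" where
  "plus_field a n = psi_plus a (- n - 1)"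

definition minus_field :: "3 \<Rightarrow> int \<Rightarrow> fock \<Rightarrow> fock" where
  "minus_field a n = psi_minus a (- n - 1)"

text \<open>Multiplication of a formal distribution by \<open>w\<^sup>p\<close>.\<close>

definition wshift :: "int \<Rightarrow> (int \<Rightarrow> 'a) \<Rightarrow> int \<Rightarrow> 'a" where
  "wshift p f n = f (n - p)"

definition translation_ops :: "(3 \<Rightarrow> fock \<Rightarrow> fock) \<Rightarrow> bool" where
  "translation_ops Q \<longleftrightarrow>
     (\<forall>a. flinear (Q a) \<and> bij (Q a)) \<and>
     (\<forall>a. Q a v0 = psi_plus a (- 1) v0) \<and>
     (\<forall>a v. (\<lambda>n. plus_field a n (Q a v)) = wshift 1 (\<lambda>n. Q a (plus_field a n v))) \<and>
     (\<forall>a v. (\<lambda>n. minus_field a n (Q a v)) = wshift (- 1) (\<lambda>n. Q a (minus_field a n v))) \<and>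
     (\<forall>a b v. a \<noteq> b \<longrightarrow> (\<lambda>n. plus_field a n (Q b v)) = (\<lambda>n. - Q b (plus_field a n v))) \<and>
     (\<forall>a b v. a \<noteq> b \<longrightarrow> (\<lambda>n. minus_field a n (Q b v)) = (\<lambda>n. - Q b (minus_field a n v))) \<and>
     (\<forall>a b v. a \<noteq> b \<longrightarrow> Q a (Q b v) = - Q b (Q a v))"

text \<open>Exactly one family satisfies \<open>translation_ops\<close>: see \<open>translation_ops_unique\<close> and
  \<open>translation_ops_Q_op\<close>.\<close>

definition Q_op :: "3 \<Rightarrow> fock \<Rightarrow> fock" where
  "Q_op = (THE Q. translation_ops Q)"

definition T1 :: "fock \<Rightarrow> fock" where
  "T1 = Q_op 1 \<circ> inv (Q_op 0)"

definition T2 :: "fock \<Rightarrow> fock" where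
  "T2 = Q_op 2 \<circ> inv (Q_op 1)"

definition int_power :: "('a \<Rightarrow> 'a) \<Rightarrow> int \<Rightarrow> 'a \<Rightarrow> 'a" where
  "int_power f k = (if k \<ge> 0 then f ^^ nat k else inv f ^^ nat (- k))"

subsection \<open>Existence and uniqueness of the translation operators\<close>

definition shift_mode :: "3 \<Rightarrow> mode \<Rightarrow> mode" where
  "shift_mode a x = (fst x, if fst x = a then snd x - 1 else snd x)"

definition unshift_mode :: "3 \<Rightarrow> mode \<Rightarrow> mode" where
  "unshift_mode a x = (fst x, if fst x = a then snd x + 1 else snd x)"

lemma shift_unshift [simp]: "shift_mode a (unshift_mode a x) = x" "unshift_mode a (shift_mode a x) = x"
  by (auto simp: shift_mode_def unshift_mode_def)

lemma inj_shift: "inj (shift_mode a)" "inj (unshift_mode a)"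
  by (metis injI shift_unshift)+

lemma shift_eq_iff [simp]: "shift_mode a x = shift_mode a y \<longleftrightarrow> x = y"
  by (metis shift_unshift(2))

lemma mem_shift_image [simp]: "shift_mode a x \<in> shift_mode a ` X \<longleftrightarrow> x \<in> X"
  by auto

lemma occ_shift [simp]: "occupied (Config (shift_mode a ` occupied S)) = shift_mode a ` occupied S"
proof (rule Config_inverse, rule CollectI, rule conjI)
  have "shift_mode a ` occupied S - vac_set \<subseteq> shift_mode a ` (occupied S - vac_set) \<union> {(a, - 1)}"
    by (auto simp: shift_mode_def split: if_splits)
  then show "finite (shift_mode a ` occupied S - vac_set)"
    by (rule finite_subset) (auto simp: occ_fin)
  have "vac_set - shift_mode a ` occupied S \<subseteq> shift_mode a ` (vac_set - occupied S)"
  proof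
    fix x assume x: "x \<in> vac_set - shift_mode a ` occupied S"
    then have "unshift_mode a x \<notin> occupied S" by (metis DiffD2 imageI shift_unshift(1))
    moreover have "unshift_mode a x \<in> vac_set" using x by (simp add: unshift_mode_def)
    ultimately have "unshift_mode a x \<in> vac_set - occupied S" by blast
    then show "x \<in> shift_mode a ` (vac_set - occupied S)" by (metis imageI shift_unshift(1))
  qed
  then show "finite (vac_set - shift_mode a ` occupied S)"
    by (rule finite_subset) (auto simp: occ_fin)
qed

lemma occ_unshift [simp]: "occupied (Config (unshift_mode a ` occupied S)) = unshift_mode a ` occupied S"
proof (rule Config_inverse, rule CollectI, rule conjI)
  have "unshift_mode a ` occupied S - vac_set \<subseteq> unshift_mode a ` (occupied S - vac_set)"
    by (auto simp: unshift_mode_def split: if_splits)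
  then show "finite (unshift_mode a ` occupied S - vac_set)"
    by (rule finite_subset) (auto simp: occ_fin)
  have "vac_set - unshift_mode a ` occupied S \<subseteq> unshift_mode a ` (vac_set - occupied S) \<union> {(a, 0)}"
  proof
    fix x assume x: "x \<in> vac_set - unshift_mode a ` occupied S"
    then have "shift_mode a x \<notin> occupied S" by (metis DiffD2 imageI shift_unshift(2))
    moreover have "shift_mode a x \<in> vac_set \<or> x = (a, 0)"
      using x by (cases x) (auto simp: shift_mode_def)
    ultimately show "x \<in> unshift_mode a ` (vac_set - occupied S) \<union> {(a, 0)}"
      by (metis DiffI UnCI imageI insertI1 shift_unshift(2))
  qed
  then show "finite (vac_set - unshift_mode a ` occupied S)"
    by (rule finite_subset) (auto simp: occ_fin)
qed

definition partner :: "3 \<Rightarrow> mode \<Rightarrow> mode" where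
  "partner a x = (a, if fst x < a then snd x else snd x + 1)"

definition unpaired :: "3 \<Rightarrow> mode set \<Rightarrow> mode set" where
  "unpaired a X = {y \<in> X. fst y \<noteq> a \<and> partner a y \<notin> X}"

definition trans_sign :: "3 \<Rightarrow> config \<Rightarrow> complex" where
  "trans_sign a S = (- 1) ^ card (unpaired a (occupied S))"

definition trans_op :: "3 \<Rightarrow> fock \<Rightarrow> fock" where
  "trans_op a = lin_ext (\<lambda>S. Poly_Mapping.single (Config (shift_mode a ` occupied S)) (trans_sign a S))"

definition untrans_op :: "3 \<Rightarrow> fock \<Rightarrow> fock" where
  "untrans_op a = lin_ext (\<lambda>S. Poly_Mapping.single (Config (unshift_mode a ` occupied S))
     (trans_sign a (Config (unshift_mode a ` occupied S))))"

definition eta :: "3 \<Rightarrow> mode \<Rightarrow> complex" where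
  "eta a x = (if fst x = a then 1 else - 1)"

lemma finite_unpaired: "finite (unpaired a (occupied S))"
proof (rule finite_subset)
  let ?V = "snd ` (vac_set - occupied S)"
  show "unpaired a (occupied S) \<subseteq> (occupied S - vac_set) \<union> (UNIV \<times> (?V \<union> (\<lambda>k. k - 1) ` ?V))"
  proof
    fix y assume y: "y \<in> unpaired a (occupied S)"
    obtain b j where yb: "y = (b, j)" by force
    show "y \<in> (occupied S - vac_set) \<union> (UNIV \<times> (?V \<union> (\<lambda>k. k - 1) ` ?V))"
    proof (cases "j \<ge> 0")
      case True
      then have "partner a y \<in> vac_set - occupied S"
        using y yb by (auto simp: unpaired_def partner_def)
      then have "snd (partner a y) \<in> ?V" by blast
      moreover have "j = snd (partner a y) \<or> j = snd (partner a y) - 1"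
        using yb by (auto simp: partner_def)
      ultimately have "j \<in> ?V \<union> (\<lambda>k. k - 1) ` ?V" by (metis UnI1 UnI2 imageI)
      then show ?thesis unfolding yb by blast
    next
      case False
      then show ?thesis using y yb by (auto simp: unpaired_def)
    qed
  qed
qed (auto simp: occ_fin)

lemma trans_sign_sq [simp]: "trans_sign a S * trans_sign a S = 1"
  by (simp add: trans_sign_def flip: power_add power2_eq_square power_mult)

lemma wsign_shift:
  "wsign (shift_mode a x) (Config (shift_mode a ` occupied S)) =
   (- 1) ^ card {y \<in> occupied S. precedes (shift_mode a y) (shift_mode a x)}"
proof -
  have "{z \<in> shift_mode a ` occupied S. precedes z (shift_mode a x)} =
    shift_mode a ` {y \<in> occupied S. precedes (shift_mode a y) (shift_mode a x)}" by auto
  then show ?thesis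
    by (simp add: wsign_def card_image inj_on_subset[OF inj_shift(1)])
qed

lemma finite_shift_preceding:
  "finite {y \<in> occupied S. precedes (shift_mode a y) (shift_mode a x)}"
  by (rule finite_subset[OF _ finite_below[of S "snd x + 1"]])
    (auto simp: precedes_def shift_mode_def split: if_splits)

lemma trans_sign_step:
  assumes x: "x \<notin> occupied S"
  shows "trans_sign a S * wsign (shift_mode a x) (Config (shift_mode a ` occupied S)) =
    eta a x * trans_sign a (Config (insert x (occupied S))) * wsign x S"
proof -
  let ?S = "occupied S"
  let ?A = "{y \<in> ?S. precedes (shift_mode a y) (shift_mode a x)}"
  let ?B = "{y \<in> ?S. precedes y x}"
  let ?N = "unpaired a ?S" and ?N' = "unpaired a (insert x ?S)"
  have fin: "finite ?A" "finite ?B" "finite ?N" "finite ?N'"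
    using finite_shift_preceding finite_preceding finite_unpaired finite_unpaired[of a "Config (insert x ?S)"]
    by auto
  show ?thesis
  proof (cases "fst x = a")
    case True
    let ?D = "{y \<in> ?S. fst y \<noteq> a \<and> partner a y = x}"
    obtain k where xk: "x = (a, k)" using True by (metis prod.collapse)
    have B: "?B = ?A \<union> ?D" "?A \<inter> ?D = {}"
      by (auto simp: precedes_def shift_mode_def partner_def xk split: if_splits)
    have N: "?N = ?N' \<union> ?D" "?N' \<inter> ?D = {}"
      using x True by (auto simp: unpaired_def)
    have finD: "finite ?D" by (rule finite_subset[OF _ fin(2)]) (subst B(1), blast)
    have "card ?B = card ?A + card ?D"
      by (subst B(1), rule card_Un_disjoint[OF fin(1) finD B(2)])
    moreover have "card ?N = card ?N' + card ?D"
      by (subst N(1), rule card_Un_disjoint[OF fin(4) finD N(2)])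
    ultimately show ?thesis using True
      by (simp add: trans_sign_def wsign_shift eta_def) (simp add: wsign_def power_add)
  next
    case False
    let ?p = "partner a x"
    have pn: "partner a y \<noteq> x" for y using False by (metis fst_conv partner_def)
    have key: "precedes (shift_mode a y) (shift_mode a x) \<longleftrightarrow> precedes y x \<or> y = ?p" for y
    proof -
      obtain b j c k where xy: "x = (b, j)" "y = (c, k)" by (metis prod.collapse)
      show ?thesis using False unfolding xy
        by (cases "c = a"; cases "b < a") (auto simp: precedes_def shift_mode_def partner_def)
    qed
    have np: "\<not> precedes ?p x" using False by (auto simp: precedes_def partner_def)
    have A: "?A = (if ?p \<in> ?S then insert ?p ?B else ?B)" "?p \<notin> ?B"
      using np by (auto simp: key)
    have N: "?N' = (if ?p \<in> ?S then ?N else insert x ?N)" "x \<notin> ?N"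
      using False x pn by (auto simp: unpaired_def)
    show ?thesis using False A(2) N(2) fin
      by (simp add: trans_sign_def wsign_shift eta_def A(1) N(1)) (simp add: wsign_def)
  qed
qed

lemma trans_single:
  "trans_op a (Poly_Mapping.single S c) = Poly_Mapping.single (Config (shift_mode a ` occupied S)) (c * trans_sign a S)"
  by (simp add: trans_op_def)

lemma trans_linear [simp]: "flinear (trans_op a)" "flinear (untrans_op a)"
  by (simp_all add: trans_op_def untrans_op_def)

lemma flinear_scale: "flinear f \<Longrightarrow> flinear (\<lambda>v. fscale c (f v))"
proof -
  assume f: "flinear f"
  have "flinear (fscale c)"
    by unfold_locales (auto simp: fock.scale_right_distrib mult.commute)
  from flinear_comp[OF this f] show ?thesis .
qed

lemma flinear_neg: "flinear f \<Longrightarrow> flinear (\<lambda>v. - f v)"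
  using flinear_scale[of f "- 1"] by simp

lemma wedge_trans: "wedge (shift_mode a x) (trans_op a v) = fscale (eta a x) (trans_op a (wedge x v))"
proof -
  have "(\<lambda>v. wedge (shift_mode a x) (trans_op a v)) = (\<lambda>v. fscale (eta a x) (trans_op a (wedge x v)))"
  proof (rule linear_eqI[of fscale])
    fix S
    have "shift_mode a ` insert x (occupied S) = insert (shift_mode a x) (shift_mode a ` occupied S)" by simp
    then show "wedge (shift_mode a x) (trans_op a (Poly_Mapping.single S 1)) =
        fscale (eta a x) (trans_op a (wedge x (Poly_Mapping.single S 1)))"
      using trans_sign_step[of x S a]
      by (auto simp: trans_single wedge_single flinearD(5)[OF trans_linear(1)] mult_ac)
  qed (intro flinear_scale flinear_comp[OF wc_linear(1) trans_linear(1)] flinear_comp[OF trans_linear(1) wc_linear(1)])+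
  then show ?thesis by (rule fun_cong)
qed

lemma contract_trans: "contract (shift_mode a x) (trans_op a v) = fscale (eta a x) (trans_op a (contract x v))"
proof -
  have "(\<lambda>v. contract (shift_mode a x) (trans_op a v)) = (\<lambda>v. fscale (eta a x) (trans_op a (contract x v)))"
  proof (rule linear_eqI[of fscale])
    fix S
    show "contract (shift_mode a x) (trans_op a (Poly_Mapping.single S 1)) =
        fscale (eta a x) (trans_op a (contract x (Poly_Mapping.single S 1)))"
    proof (cases "x \<in> occupied S")
      case False
      then show ?thesis by (simp add: trans_single contract_single flinearD(5)[OF trans_linear(1)])
    next
      case True
      let ?T = "Config (occupied S - {x})"
      have xT: "x \<notin> occupied ?T" and S: "S = Config (insert x (occupied ?T))"
        using True by (simp_all add: insert_absorb occupied_inverse)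
      let ?U = "Config (shift_mode a ` occupied ?T)"
      have 1: "wsign x S = wsign x ?T"
        using wsign_insert_self[OF xT] unfolding S[symmetric] .
      have "insert (shift_mode a x) (shift_mode a ` (occupied S - {x})) = shift_mode a ` occupied S"
        using True by blast
      then have e: "Config (shift_mode a ` occupied S) = Config (insert (shift_mode a x) (occupied ?U))"
        unfolding occ_shift unfolding occ_delete by (rule arg_cong[OF sym])
      have "shift_mode a x \<notin> occupied ?U"
        unfolding occ_shift mem_shift_image by (rule xT)
      then have 2: "wsign (shift_mode a x) (Config (shift_mode a ` occupied S)) = wsign (shift_mode a x) ?U"
        unfolding e by (rule wsign_insert_self)
      have 3: "trans_sign a ?T * wsign (shift_mode a x) (Config (shift_mode a ` occupied ?T)) =
          eta a x * trans_sign a S * wsign x ?T"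
        using trans_sign_step[OF xT, of a] unfolding S[symmetric] .
      have "trans_sign a S * wsign (shift_mode a x) ?U =
          trans_sign a S * (trans_sign a ?T * trans_sign a ?T * wsign (shift_mode a x) ?U)"
        by (simp only: trans_sign_sq mult_1)
      also have "\<dots> = trans_sign a S * (trans_sign a ?T * (eta a x * trans_sign a S * wsign x ?T))"
        by (simp only: mult.assoc 3)
      also have "\<dots> = trans_sign a S * trans_sign a S * (eta a x * wsign x ?T * trans_sign a ?T)"
        by (simp only: mult_ac)
      finally have 4: "trans_sign a S * wsign (shift_mode a x) (Config (shift_mode a ` occupied S)) =
          eta a x * (wsign x S * trans_sign a ?T)"
        by (simp only: 1 2 trans_sign_sq mult_1 mult.assoc)
      have "shift_mode a ` (occupied S - {x}) = shift_mode a ` occupied S - {shift_mode a x}" by auto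
      moreover have "occupied (Config (shift_mode a ` (occupied S - {x}))) = shift_mode a ` (occupied S - {x})"
        using occ_shift[of a ?T] unfolding occ_delete .
      ultimately show ?thesis using True 4
        by (simp add: trans_single contract_single)
    qed
  qed (intro flinear_scale flinear_comp[OF wc_linear(2) trans_linear(1)] flinear_comp[OF trans_linear(1) wc_linear(2)])+
  then show ?thesis by (rule fun_cong)
qed

lemma untrans_single:
  "untrans_op a (Poly_Mapping.single S c) = Poly_Mapping.single (Config (unshift_mode a ` occupied S))
     (c * trans_sign a (Config (unshift_mode a ` occupied S)))"
  by (simp add: untrans_op_def)

lemma bij_trans: "bij (trans_op a)"
proof (rule o_bij)
  have id: "flinear (\<lambda>v. v)" by unfold_locales auto
  have "(\<lambda>v. untrans_op a (trans_op a v)) = (\<lambda>v. v)"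
    by (rule linear_eqI[of fscale])
      (simp_all add: flinear_comp[OF trans_linear(2) trans_linear(1)] flinear_comp[OF trans_linear(1) trans_linear(2)] id trans_single untrans_single image_image occupied_inverse)
  then show "untrans_op a \<circ> trans_op a = id" by (simp add: o_def id_def)
  have "(\<lambda>v. trans_op a (untrans_op a v)) = (\<lambda>v. v)"
    by (rule linear_eqI[of fscale])
      (simp_all add: flinear_comp[OF trans_linear(2) trans_linear(1)] flinear_comp[OF trans_linear(1) trans_linear(2)] id trans_single untrans_single image_image occupied_inverse)
  then show "trans_op a \<circ> untrans_op a = id" by (simp add: o_def id_def)
qed

lemma wsign_vac [simp]: "wsign (a, - 1) (Config vac_set) = 1"
proof -
  have "{y \<in> vac_set. precedes y (a, - 1)} = {}" by (auto simp: precedes_def)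
  then show ?thesis by (simp only: wsign_def vac_occ card.empty power_0)
qed

lemma trans_v0: "trans_op a v0 = psi_plus a (- 1) v0"
proof -
  have "unpaired a vac_set = {}" by (auto simp: unpaired_def partner_def)
  moreover have "shift_mode a ` vac_set = insert (a, - 1) vac_set"
  proof (intro subset_antisym subsetI)
    fix x assume "x \<in> insert (a, - 1) vac_set"
    then have "unshift_mode a x \<in> vac_set" by (auto simp: unshift_mode_def)
    then show "x \<in> shift_mode a ` vac_set" by (metis imageI shift_unshift(1))
  qed (auto simp: shift_mode_def split: if_splits)
  ultimately show ?thesis
    by (simp add: v0_def psi_plus_def trans_single wedge_single trans_sign_def)
qed

lemma trans_psi:
  "trans_op a (psi_plus b k v) = fscale (if a = b then 1 else - 1) (psi_plus b (if a = b then k - 1 else k) (trans_op a v))"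
  "trans_op a (psi_minus b k v) = fscale (if a = b then 1 else - 1) (psi_minus b (if a = b then k + 1 else k) (trans_op a v))"
  using wedge_trans[of a "(b, k)" v] contract_trans[of a "(b, - k - 1)" v]
  by (auto simp: psi_plus_def psi_minus_def shift_mode_def eta_def algebra_simps split: if_splits)

lemma psi_plus_anticomm_v0:
  assumes "a \<noteq> b"
  shows "psi_plus a (- 1) (psi_plus b (- 1) v0) = - psi_plus b (- 1) (psi_plus a (- 1) v0)"
proof -
  have i: "wsign (c, - 1) (Config (insert (d, - 1) vac_set)) = (if precedes (d, - 1) (c, - 1) then - 1 else 1)" for c d
    using wsign_insert[of "(d, - 1)" "Config vac_set" "(c, - 1)"] by simp
  have o: "occupied (Config (insert (d, - 1) vac_set)) = insert (d, - 1) vac_set" for d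
    using occ_insert[of "(d, - 1)" "Config vac_set"] by simp
  show ?thesis using assms
    by (auto simp: psi_plus_def v0_def wedge_single i o insert_commute precedes_def single_uminus)
qed

lemma trans_anticomm:
  assumes "a \<noteq> b"
  shows "trans_op a (trans_op b v) = - trans_op b (trans_op a v)"
proof -
  have "(\<lambda>v. trans_op a (trans_op b v)) = (\<lambda>v. - trans_op b (trans_op a v))"
  proof (rule linear_eq_on_words)
    fix v assume "v \<in> fock_words"
    then show "trans_op a (trans_op b v) = - trans_op b (trans_op a v)"
    proof induction
      case 1
      show ?case using psi_plus_anticomm_v0[OF assms] assms by (simp add: trans_v0 trans_psi)
    next
      case (2 v c k)
      then show ?case using assms
        by (auto simp: trans_psi flinearD(3,4)[OF trans_linear(1)] flinearD(3,4)[OF psi_linear(1)])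
    next
      case (3 v c k)
      then show ?case using assms
        by (auto simp: trans_psi flinearD(3,4)[OF trans_linear(1)] flinearD(3,4)[OF psi_linear(2)])
    qed
  qed (intro flinear_neg flinear_comp[OF trans_linear(1) trans_linear(1)])+
  then show ?thesis by (rule fun_cong)
qed

lemma translation_ops_trans: "translation_ops trans_op"
  unfolding translation_ops_def
proof (intro conjI allI impI)
  show "trans_op a (trans_op b v) = - trans_op b (trans_op a v)" if "a \<noteq> b" for a b v
    using that by (rule trans_anticomm)
qed (simp_all add: bij_trans trans_v0 trans_psi plus_field_def minus_field_def wshift_def fun_eq_iff algebra_simps)

lemma translation_ops_psi:
  assumes "translation_ops Q"
  shows "Q a (psi_plus b k v) = (if a = b then psi_plus b (k - 1) (Q a v) else - psi_plus b k (Q a v))"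
    and "Q a (psi_minus b k v) = (if a = b then psi_minus b (k + 1) (Q a v) else - psi_minus b k (Q a v))"
proof -
  have "plus_field b (- k) (Q b v) = Q b (plus_field b (- k - 1) v)"
    "minus_field b (- k - 2) (Q b v) = Q b (minus_field b (- k - 2 + 1) v)"
    "a \<noteq> b \<Longrightarrow> plus_field b (- k - 1) (Q a v) = - Q a (plus_field b (- k - 1) v)"
    "a \<noteq> b \<Longrightarrow> minus_field b (- k - 1) (Q a v) = - Q a (minus_field b (- k - 1) v)"
    using assms unfolding translation_ops_def by (auto simp: wshift_def fun_eq_iff)
  then show "Q a (psi_plus b k v) = (if a = b then psi_plus b (k - 1) (Q a v) else - psi_plus b k (Q a v))"
    and "Q a (psi_minus b k v) = (if a = b then psi_minus b (k + 1) (Q a v) else - psi_minus b k (Q a v))"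
    by (auto simp: plus_field_def minus_field_def algebra_simps)
qed

lemma translation_ops_unique:
  assumes "translation_ops Q" "translation_ops Q'"
  shows "Q = Q'"
proof
  fix a
  show "Q a = Q' a"
  proof (rule linear_eq_on_words)
    show "flinear (Q a)" "flinear (Q' a)" using assms by (auto simp: translation_ops_def)
    fix v assume "v \<in> fock_words"
    then show "Q a v = Q' a v"
    proof induction
      case 1
      show ?case using assms by (simp add: translation_ops_def)
    qed (auto simp: translation_ops_psi[OF assms(1)] translation_ops_psi[OF assms(2)])
  qed
qed

lemma Q_op_eq: "Q_op = trans_op"
  unfolding Q_op_def using translation_ops_trans translation_ops_unique by (metis the_equality)

lemma translation_ops_Q_op: "translation_ops Q_op"
  using Q_op_eq translation_ops_trans by simp


section \<open>Formal power series\<close>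

text \<open>
  A monomial in variables of type \<open>'x\<close> is a multiset over \<open>'x\<close>; a formal, possibly infinite,
  linear combination of monomials is the function giving its coefficients.
\<close>

typedef 'x fseries = "UNIV :: ('x multiset \<Rightarrow> complex) set"
  morphisms fs_coeff FSeries
  by blast

lemma fs_coeff_FSeries [simp]: "fs_coeff (FSeries f) = f"
  by (simp add: FSeries_inverse)

lemma fseries_eqI: "(\<And>m. fs_coeff f m = fs_coeff g m) \<Longrightarrow> f = g"
  by (metis ext fs_coeff_inject)

lemma finite_submultisets [simp]: "finite {A. A \<subseteq># M}"
proof (induction M)
  case (add x M)
  have "{A. A \<subseteq># add_mset x M} \<subseteq> {A. A \<subseteq># M} \<union> add_mset x ` {A. A \<subseteq># M}"
  proof
    fix A assume A: "A \<in> {A. A \<subseteq># add_mset x M}"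
    show "A \<in> {A. A \<subseteq># M} \<union> add_mset x ` {A. A \<subseteq># M}"
    proof (cases "x \<in># A")
      case True
      then obtain B where "A = add_mset x B" by (metis multi_member_split)
      with A show ?thesis by auto
    next
      case False
      with A have "A \<subseteq># M"
        by (simp add: subseteq_mset_def split: if_splits) (metis le0 not_in_iff)
      then show ?thesis by simp
    qed
  qed
  then show ?case by (rule finite_subset) (use add in auto)
qed simp

lemma submultiset_diff:
  "a \<subseteq># m \<Longrightarrow> m - (m - a) = a"
  "b \<subseteq># m \<Longrightarrow> c \<subseteq># m - b \<Longrightarrow> b + c \<subseteq># m"
  "b \<subseteq># a \<Longrightarrow> a \<subseteq># m \<Longrightarrow> a - b \<subseteq># m - b"
  "b \<subseteq># a \<Longrightarrow> a \<subseteq># m \<Longrightarrow> m - b - (a - b) = m - a"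
  by (auto simp: mset_subset_eq_exists_conv add.assoc)

instantiation fseries :: (type) comm_ring_1
begin

definition "0 = FSeries (\<lambda>m. 0)"
definition "1 = FSeries (\<lambda>m. if m = {#} then 1 else 0)"
definition "f + g = FSeries (\<lambda>m. fs_coeff f m + fs_coeff g m)"
definition "f - g = FSeries (\<lambda>m. fs_coeff f m - fs_coeff g m)"
definition "- f = FSeries (\<lambda>m. - fs_coeff f m)"
definition "f * g = FSeries (\<lambda>m. \<Sum>a | a \<subseteq># m. fs_coeff f a * fs_coeff g (m - a))"

instance
proof
  fix f g h :: "'a fseries"
  show "f * g = g * f"
  proof (rule fseries_eqI)
    fix m
    have "(\<Sum>a | a \<subseteq># m. fs_coeff f a * fs_coeff g (m - a)) =
        (\<Sum>a | a \<subseteq># m. fs_coeff g a * fs_coeff f (m - a))"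
      by (rule sum.reindex_bij_witness[of _ "\<lambda>a. m - a" "\<lambda>a. m - a"])
        (auto simp: submultiset_diff mult.commute)
    then show "fs_coeff (f * g) m = fs_coeff (g * f) m" by (simp add: times_fseries_def)
  qed
  show "f * g * h = f * (g * h)"
  proof (rule fseries_eqI)
    fix m
    have "(\<Sum>a | a \<subseteq># m. (\<Sum>b | b \<subseteq># a. fs_coeff f b * fs_coeff g (a - b)) * fs_coeff h (m - a)) =
      (\<Sum>(a, b) \<in> (SIGMA a:{a. a \<subseteq># m}. {b. b \<subseteq># a}). fs_coeff f b * fs_coeff g (a - b) * fs_coeff h (m - a))"
      by (simp add: sum_distrib_right sum.Sigma)
    also have "\<dots> = (\<Sum>(b, c) \<in> (SIGMA b:{b. b \<subseteq># m}. {c. c \<subseteq># m - b}).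
        fs_coeff f b * fs_coeff g c * fs_coeff h (m - b - c))"
      by (rule sum.reindex_bij_witness[of _ "\<lambda>(b, c). (b + c, b)" "\<lambda>(a, b). (b, a - b)"])
        (auto simp: submultiset_diff subset_mset.add_diff_inverse intro: subset_mset.order_trans)
    also have "\<dots> = (\<Sum>b | b \<subseteq># m. fs_coeff f b * (\<Sum>c | c \<subseteq># m - b. fs_coeff g c * fs_coeff h (m - b - c)))"
      by (simp add: sum_distrib_left sum.Sigma mult.assoc)
    finally show "fs_coeff (f * g * h) m = fs_coeff (f * (g * h)) m"
      by (simp add: times_fseries_def)
  qed
  show "1 * f = f"
  proof (rule fseries_eqI)
    fix m
    have "(\<Sum>a | a \<subseteq># m. (if a = {#} then 1 else 0) * fs_coeff f (m - a)) =
        (\<Sum>a | a \<subseteq># m. if a = {#} then fs_coeff f m else 0)"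
      by (rule sum.cong) auto
    then show "fs_coeff (1 * f) m = fs_coeff f m"
      by (simp add: times_fseries_def one_fseries_def)
  qed
  show "(f + g) * h = f * h + g * h"
    by (rule fseries_eqI) (simp add: times_fseries_def plus_fseries_def algebra_simps sum.distrib)
  show "(0 :: 'a fseries) \<noteq> 1"
    by (metis (mono_tags) fs_coeff_FSeries one_fseries_def zero_fseries_def zero_neq_one)
qed (auto intro!: fseries_eqI simp: zero_fseries_def plus_fseries_def minus_fseries_def uminus_fseries_def)

end

definition fs_var :: "'x \<Rightarrow> 'x fseries" where
  "fs_var x = FSeries (\<lambda>m. if m = {#x#} then 1 else 0)"

definition fs_const :: "complex \<Rightarrow> 'x fseries" where
  "fs_const c = FSeries (\<lambda>m. if m = {#} then c else 0)"

datatype svar = CVar int | DVar int | EVar int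

text \<open>For \<open>x = CVar\<close> this is \<open>C(w)\<close>, as a formal distribution in \<open>w\<close>: the coefficient of \<open>w\<^sup>n\<close> is \<open>c\<^sub>-\<^sub>n\<^sub>-\<^sub>1\<close>.\<close>

definition gen_series :: "(int \<Rightarrow> svar) \<Rightarrow> int \<Rightarrow> svar fseries" where
  "gen_series x n = fs_var (x (- n - 1))"

text \<open>\<open>X\<^sup>(\<^sup>\<alpha>\<^sup>)(w) = (-1)\<^sup>\<alpha> w\<^sup>\<alpha> X(w)\<close>\<close>

definition twist :: "int \<Rightarrow> (int \<Rightarrow> svar fseries) \<Rightarrow> int \<Rightarrow> svar fseries" where
  "twist \<alpha> X n = fs_const ((- 1) powi \<alpha>) * wshift \<alpha> X n"

section \<open>The tau functions\<close>

text \<open>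
  Formal series with coefficients in \<open>F\<^sup>(\<^sup>3\<^sup>)\<close>.  The sums over all integers below are
  coefficientwise finite (see \<open>finite_E_op\<close>, \<open>finite_res_op\<close>, \<open>finite_exp_op\<close>);
  \<open>Sum_any\<close> adds up the nonzero terms.
\<close>

type_synonym fock_series = "svar multiset \<Rightarrow> fock"

definition fock_const :: "fock \<Rightarrow> fock_series" where
  "fock_const v m = (if m = {#} then v else 0)"

definition fs_act :: "svar fseries \<Rightarrow> fock_series \<Rightarrow> fock_series" where
  "fs_act f u m = (\<Sum>a | a \<subseteq># m. fscale (fs_coeff f a) (u (m - a)))"

text \<open>The coefficient of \<open>w\<^sup>n\<close> in \<open>E\<^sub>a\<^sub>b(w) = \<psi>\<^sub>a\<^sup>+(w) \<psi>\<^sub>b\<^sup>-(w)\<close>.\<close>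

definition E_op :: "3 \<Rightarrow> 3 \<Rightarrow> int \<Rightarrow> fock \<Rightarrow> fock" where
  "E_op a b n v = Sum_any (\<lambda>i. plus_field a i (minus_field b (n - i) v))"

text \<open>The operator \<open>Res\<^sub>w X(w) A(w)\<close>, for \<open>X\<close> with coefficients in the series ring and
  \<open>A\<close> with coefficients operators on \<open>F\<^sup>(\<^sup>3\<^sup>)\<close>.\<close>

definition res_op :: "(int \<Rightarrow> svar fseries) \<Rightarrow> (int \<Rightarrow> fock \<Rightarrow> fock) \<Rightarrow> fock_series \<Rightarrow> fock_series" where
  "res_op X A u m = Sum_any (\<lambda>n. fs_act (X n) (\<lambda>m'. A (- 1 - n) (u m')) m)"

definition exp_op :: "(fock_series \<Rightarrow> fock_series) \<Rightarrow> fock_series \<Rightarrow> fock_series" where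
  "exp_op H u m = Sum_any (\<lambda>n. fscale (1 / fact n) ((H ^^ n) u m))"

definition g_op :: "int \<Rightarrow> int \<Rightarrow> fock_series \<Rightarrow> fock_series" where
  "g_op \<alpha> \<beta> =
     exp_op (res_op (twist (\<alpha> - \<beta>) (gen_series CVar)) (E_op 1 0)) \<circ>
     exp_op (res_op (twist \<alpha> (gen_series DVar)) (E_op 2 0)) \<circ>
     exp_op (res_op (twist \<beta> (gen_series EVar)) (E_op 2 1))"

definition tau :: "int \<Rightarrow> int \<Rightarrow> int \<Rightarrow> int \<Rightarrow> svar fseries" where
  "tau k l \<alpha> \<beta> = FSeries (\<lambda>m.
     fock_form (int_power T1 k (int_power T2 l v0)) (g_op \<alpha> \<beta> (fock_const v0) m))"

lemma finite_E_op:
  assumes "a \<noteq> b"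
  shows "finite {i. plus_field a i (minus_field b (n - i) v) \<noteq> 0}"
proof -
  let ?I = "\<lambda>S. {i. (b, n - i) \<in> occupied S \<and> (a, - i - 1) \<notin> occupied S}"
  have fin: "finite (?I S)" for S
  proof (rule finite_subset)
    show "?I S \<subseteq> {0..n} \<union> (\<lambda>x. - snd x - 1) ` (vac_set - occupied S) \<union> (\<lambda>x. n - snd x) ` (occupied S - vac_set)"
    proof
      fix i assume i: "i \<in> ?I S"
      consider "i \<in> {0..n}" | "i < 0" | "n < i" by fastforce
      then show "i \<in> {0..n} \<union> (\<lambda>x. - snd x - 1) ` (vac_set - occupied S) \<union> (\<lambda>x. n - snd x) ` (occupied S - vac_set)"
      proof cases
        case 2
        then have "(a, - i - 1) \<in> vac_set - occupied S" using i by simp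
        then have "- snd (a, - i - 1) - 1 \<in> (\<lambda>x. - snd x - 1) ` (vac_set - occupied S)" by (rule imageI)
        then show ?thesis by simp
      next
        case 3
        then have "(b, n - i) \<in> occupied S - vac_set" using i by simp
        then have "n - snd (b, n - i) \<in> (\<lambda>x. n - snd x) ` (occupied S - vac_set)" by (rule imageI)
        then show ?thesis by simp
      qed blast
    qed
  qed (simp add: occ_fin)
  have "i \<in> \<Union> (?I ` Poly_Mapping.keys v)" if nz: "plus_field a i (minus_field b (n - i) v) \<noteq> 0" for i
  proof (rule ccontr)
    assume out: "\<not> ?thesis"
    have lin: "flinear (\<lambda>v. plus_field a i (minus_field b (n - i) v))"
      unfolding plus_field_def minus_field_def by (rule flinear_comp[OF psi_linear])
    have "plus_field a i (minus_field b (n - i) (Poly_Mapping.single S 1)) = 0"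
      if "S \<in> Poly_Mapping.keys v" for S
    proof -
      have "i \<notin> ?I S" using out that by blast
      then show ?thesis using assms
        by (auto simp: plus_field_def minus_field_def psi_plus_def psi_minus_def contract_single
            wedge_single flinearD(5)[OF wc_linear(1)] algebra_simps)
    qed
    then have "plus_field a i (minus_field b (n - i) v) = 0"
      by (subst lookup_linear_sum[OF lin]) (rule sum.neutral, simp)
    with nz show False by simp
  qed
  then have "{i. plus_field a i (minus_field b (n - i) v) \<noteq> 0} \<subseteq> \<Union> (?I ` Poly_Mapping.keys v)"
    by blast
  then show ?thesis by (rule finite_subset) (simp add: fin)
qed

lemma E_op_0 [simp]: "E_op a b n 0 = 0"
  by (simp add: E_op_def plus_field_def minus_field_def flinearD(5))

lemma fs_coeff_const_mult: "fs_coeff (fs_const c * f) m = c * fs_coeff f m"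
proof -
  have "(\<Sum>a | a \<subseteq># m. (if a = {#} then c else 0) * fs_coeff f (m - a)) =
      (\<Sum>a | a \<subseteq># m. if a = {#} then c * fs_coeff f m else 0)"
    by (rule sum.cong) auto
  then show ?thesis by (simp add: times_fseries_def fs_const_def)
qed

lemma fs_coeff_twist:
  "fs_coeff (twist \<gamma> (gen_series x) n) m = (if m = {#x (\<gamma> - n - 1)#} then (- 1) powi \<gamma> else 0)"
  by (simp add: twist_def fs_coeff_const_mult wshift_def gen_series_def fs_var_def)

lemma finite_res_op:
  assumes "inj x"
  shows "finite {n. fs_act (twist \<gamma> (gen_series x) n) u m \<noteq> 0}"
proof (rule finite_subset)
  show "{n. fs_act (twist \<gamma> (gen_series x) n) u m \<noteq> 0} \<subseteq> (\<lambda>n. x (\<gamma> - n - 1)) -` set_mset m"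
  proof (rule subsetI, rule ccontr)
    fix n assume n: "n \<in> {n. fs_act (twist \<gamma> (gen_series x) n) u m \<noteq> 0}"
      and "n \<notin> (\<lambda>n. x (\<gamma> - n - 1)) -` set_mset m"
    then have "a \<noteq> {#x (\<gamma> - n - 1)#}" if "a \<subseteq># m" for a
      using that by (auto dest: mset_subset_eqD)
    then have "fs_act (twist \<gamma> (gen_series x) n) u m = 0"
      unfolding fs_act_def by (intro sum.neutral ballI) (simp add: fs_coeff_twist)
    with n show False by simp
  qed
  have "inj (\<lambda>n. x (\<gamma> - n - 1))"
    using assms by (auto intro!: injI dest: injD)
  then show "finite ((\<lambda>n. x (\<gamma> - n - 1)) -` set_mset m)" by (intro finite_vimageI) auto
qed

lemma finite_exp_op:
  assumes "\<And>k. A k 0 = 0"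
  shows "finite {n. fscale (1 / fact n) ((res_op (twist \<gamma> (gen_series x)) A ^^ n) u m) \<noteq> 0}"
proof -
  let ?H = "res_op (twist \<gamma> (gen_series x)) A"
  have *: "(?H ^^ n) u m = 0" if "size m < n" for n m
    using that
  proof (induction n arbitrary: m)
    case (Suc n)
    have "fs_act (twist \<gamma> (gen_series x) j) (\<lambda>m'. A (- 1 - j) ((?H ^^ n) u m')) m = 0" for j
      unfolding fs_act_def
    proof (rule sum.neutral, rule ballI)
      fix a assume "a \<in> {a. a \<subseteq># m}"
      then have a: "a \<subseteq># m" by simp
      show "fscale (fs_coeff (twist \<gamma> (gen_series x) j) a) (A (- 1 - j) ((?H ^^ n) u (m - a))) = 0"
      proof (cases "a = {#x (\<gamma> - j - 1)#}")
        case True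
        then have "size a = 1" by simp
        moreover have "size a + size (m - a) = size m"
          using a by (metis size_union subset_mset.add_diff_inverse)
        ultimately have "size (m - a) < n" using Suc.prems by linarith
        then show ?thesis using Suc.IH assms by simp
      qed (simp add: fs_coeff_twist)
    qed
    then have "?H ((?H ^^ n) u) m = 0" unfolding res_op_def[of _ _ "(?H ^^ n) u"] by simp
    then show ?case by simp
  qed simp
  have "{n. fscale (1 / fact n) ((?H ^^ n) u m) \<noteq> 0} \<subseteq> {..size m}"
    using * by (auto simp: not_less[symmetric])
  then show ?thesis by (rule finite_subset) simp
qed

end

theory Submission
  imports Defs
begin

text \<open>
  Up to sign, every \<open>tau k l \<alpha> \<beta>\<close> is a matrix coefficient of the single operator \<open>g = g_op 0 0\<close>
  between two charged vacua. Write \<open>|p,q,r>\<close> for \<open>Q\<^sub>0\<^sup>p Q\<^sub>1\<^sup>q Q\<^sub>2\<^sup>r v\<^sub>0\<close>.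
  Conjugation by a translation operator multiplies each current \<open>E\<^sub>a\<^sub>b(w)\<close> by \<open>- w\<close>, \<open>- 1 / w\<close> or \<open>1\<close>,
  so conjugation by \<open>Q\<^sub>0\<close> raises \<open>\<alpha>\<close> and conjugation by \<open>Q\<^sub>1\<close> raises \<open>\<beta>\<close>; since the \<open>Q\<^sub>a\<close> preserve
  the form, the shifts by \<open>\<alpha>\<close> and \<open>\<beta>\<close> move from \<open>g\<close> to the vacua (\<open>tau_eq\<close>).
  Moreover \<open>Q\<^sub>0 Q\<^sub>1 Q\<^sub>2\<close>, the lift of multiplication by \<open>1 / z\<close>, commutes with \<open>g\<close>, so both
  vacua may be moved by \<open>(1,1,1)\<close> at the cost of a sign (\<open>mat_coeff_shift\<close>).

  The relations among these coefficients come from the operator \<open>\<Omega> = \<Sum>\<^sub>x \<psi>\<^sup>+\<^sub>x \<otimes> \<psi>\<^sup>-\<^sub>x\<close>, the sum of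
  wedging with \<open>x\<close> in the first factor and contracting with \<open>x\<close> in the second one. It commutes with
  \<open>E \<otimes> 1 + 1 \<otimes> E\<close> for every mode \<open>E\<close> of a current (\<open>casimir_deriv_E_op\<close>), hence with \<open>g \<otimes> g\<close>
  (\<open>casimir_pair_coeff\<close>). Pair \<open>\<Omega> (g u \<otimes> g v) = (g \<otimes> g) \<Omega> (u \<otimes> v)\<close> with
  \<open>|p+1,q+1,r+1> \<otimes> |p,q,r>\<close>. The two vacua differ by one mode in each component, so the left side
  has three terms, one for each component (\<open>bilinear_identity\<close>). On the right side take charged
  vacua for \<open>u\<close> and \<open>v\<close>. If every mode of \<open>v\<close> occurs in \<open>u\<close>, then \<open>\<Omega> (u \<otimes> v) = 0\<close>; this is
  the source of the second and the fourth equation. If exactly one mode of \<open>v\<close> is missing in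
  \<open>u\<close>, and it is the lowest mode of \<open>v\<close> in its component, then \<open>\<Omega> (u \<otimes> v)\<close> is again a product of
  two charged vacua, up to sign. With \<open>u\<close> obtained from the vacuum of
  \<open>(\<alpha> + 2, \<beta>)\<close> by the translation \<open>(1,1,1)\<close> and \<open>v\<close> the vacuum of \<open>(\<alpha>, \<beta>)\<close>, both of these vacua are equivalent to that of \<open>(\<alpha> + 1, \<beta>)\<close>, which
  yields the square in the first equation. The third one arises in the same way from \<open>\<beta>\<close>.

  Infinite sums over modes and tensor products of completed spaces are avoided by two devices. The
  operator \<open>\<Omega>\<close> acts on bilinear forms, where for each pair of vectors only finitely many terms are
  nonzero. The exponentials enter through the recursion that Euler's homogeneity relation gives
  for the coefficients of \<open>g v\<close> (\<open>solves\<close>), so that statements about \<open>g\<close> are proved by induction on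
  the degree of a monomial.
\<close>

section \<open>Signs and linear maps\<close>



definition sg :: "int \<Rightarrow> 'a::ring_1" where
  "sg n = (if even n then 1 else - 1)"

lemma powi_minus_one: "(- 1 :: complex) powi n = sg n"
  by (simp add: sg_def power_int_def even_nat_iff)

lemma sg_add: "sg (m + n) = sg m * sg n"
  by (auto simp: sg_def)

lemma flinear_sum: "flinear L \<Longrightarrow> L (\<Sum>i\<in>I. f i) = (\<Sum>i\<in>I. L (f i))"
proof -
  assume "flinear L"
  then interpret L: Vector_Spaces.linear fscale fscale L .
  show ?thesis by (rule L.sum)
qed

lemma flinearI:
  assumes "\<And>u v. L (u + v) = L u + L v" "\<And>c v. L (fscale c v) = fscale c (L v)"
  shows "flinear L"
  using assms by unfold_locales auto

lemma field_modes: "plus_field a i = wedge (a, - i - 1)" "minus_field b j = contract (b, j)"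
  by (simp_all add: plus_field_def minus_field_def psi_plus_def psi_minus_def)

section \<open>The modes of the currents\<close>

lemma E_op_superset:
  assumes "finite I" "{i. wedge (a, - i - 1) (contract (b, n - i) v) \<noteq> 0} \<subseteq> I"
  shows "E_op a b n v = (\<Sum>i\<in>I. wedge (a, - i - 1) (contract (b, n - i) v))"
  unfolding E_op_def field_modes using assms by (rule Sum_any.expand_superset)

lemma finite_hops: "a \<noteq> b \<Longrightarrow> finite {i. wedge (a, - i - 1) (contract (b, n - i) v) \<noteq> 0}"
  using finite_E_op[of a b n v] by (simp add: field_modes)

lemma flinear_E_op: 
  assumes "a \<noteq> b"
  shows "flinear (E_op a b n)"
proof (rule flinearI)
  let ?N = "\<lambda>v. {i. wedge (a, - i - 1) (contract (b, n - i) v) \<noteq> 0}"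
  show "E_op a b n (u + v) = E_op a b n u + E_op a b n v" for u v
  proof -
    have "finite (?N u \<union> ?N v \<union> ?N (u + v))" using assms by (simp add: finite_hops)
    then show ?thesis
      by (subst (1 2 3) E_op_superset[of "?N u \<union> ?N v \<union> ?N (u + v)"])
        (auto simp: flinearD(1) sum.distrib)
  qed
  show "E_op a b n (fscale c v) = fscale c (E_op a b n v)" for c v
  proof -
    have "finite (?N v \<union> ?N (fscale c v))" using assms by (simp add: finite_hops)
    then show ?thesis
      by (subst (1 2) E_op_superset[of "?N v \<union> ?N (fscale c v)"])
        (auto simp: flinearD(4) fock.scale_sum_right)
  qed
qed

text \<open>
  The mode \<open>E_op a b n\<close> acts on the underlying vectors by \<open>e\<^sub>b z\<^sup>j \<mapsto> e\<^sub>a z\<^sup>j\<^sup>-\<^sup>n\<^sup>-\<^sup>1\<close> and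
  kills the other basis vectors; wedging follows this action and contraction
  follows its negative transpose.
\<close>
lemma E_op_wedge:
  assumes "a \<noteq> b"
  shows "E_op a b n (wedge x u) = wedge x (E_op a b n u) + (if fst x = b then wedge (a, snd x - n - 1) u else 0)"
proof -
  let ?N = "\<lambda>v. {i. wedge (a, - i - 1) (contract (b, n - i) v) \<noteq> 0}"
  define I where "I = ?N u \<union> ?N (wedge x u) \<union> {n - snd x}"
  have fin: "finite I" and I: "?N u \<subseteq> I" "?N (wedge x u) \<subseteq> I" "n - snd x \<in> I"
    using assms by (auto simp: I_def finite_hops)
  have *: "wedge (a, - i - 1) (contract (b, n - i) (wedge x u)) =
      wedge x (wedge (a, - i - 1) (contract (b, n - i) u)) +
      (if i = n - snd x then if fst x = b then wedge (a, snd x - n - 1) u else 0 else 0)" for i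
  proof -
    have 1: "contract (b, n - i) (wedge x u) = (if x = (b, n - i) then u else 0) - wedge x (contract (b, n - i) u)"
      using wedge_contract[of x "(b, n - i)" u] by (auto simp: algebra_simps)
    have 2: "wedge (a, - i - 1) (wedge x w) = - wedge x (wedge (a, - i - 1) w)" for w
      using wedge_wedge[of "(a, - i - 1)" x w] by (simp add: eq_neg_iff_add_eq_0)
    have 3: "x = (b, n - i) \<longleftrightarrow> i = n - snd x \<and> fst x = b" by (cases x) auto
    have 4: "i = n - snd x \<Longrightarrow> - i - 1 = snd x - n - 1" by simp
    show ?thesis unfolding 1 flinearD(2)[OF wc_linear(1)] 2
      by (auto simp: 3 4 flinearD(5))
  qed
  have "E_op a b n (wedge x u) = (\<Sum>i\<in>I. wedge (a, - i - 1) (contract (b, n - i) (wedge x u)))"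
    by (rule E_op_superset[OF fin I(2)])
  also have "\<dots> = (\<Sum>i\<in>I. wedge x (wedge (a, - i - 1) (contract (b, n - i) u))) +
      (if fst x = b then wedge (a, snd x - n - 1) u else 0)"
    unfolding * sum.distrib sum.delta[OF fin] using I(3) by simp
  also have "(\<Sum>i\<in>I. wedge x (wedge (a, - i - 1) (contract (b, n - i) u))) = wedge x (E_op a b n u)"
    by (subst E_op_superset[OF fin I(1)]) (simp add: flinear_sum)
  finally show ?thesis .
qed

lemma E_op_contract:
  assumes "a \<noteq> b"
  shows "E_op a b n (contract x u) = contract x (E_op a b n u) - (if fst x = a then contract (b, snd x + n + 1) u else 0)"
proof -
  let ?N = "\<lambda>v. {i. wedge (a, - i - 1) (contract (b, n - i) v) \<noteq> 0}"
  define I where "I = ?N u \<union> ?N (contract x u) \<union> {- snd x - 1}"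
  have fin: "finite I" and I: "?N u \<subseteq> I" "?N (contract x u) \<subseteq> I" "- snd x - 1 \<in> I"
    using assms by (auto simp: I_def finite_hops)
  have *: "wedge (a, - i - 1) (contract (b, n - i) (contract x u)) =
      contract x (wedge (a, - i - 1) (contract (b, n - i) u)) -
      (if i = - snd x - 1 then if fst x = a then contract (b, snd x + n + 1) u else 0 else 0)" for i
  proof -
    have 1: "wedge (a, - i - 1) (contract x w) = (if (a, - i - 1) = x then w else 0) - contract x (wedge (a, - i - 1) w)" for w
      using wedge_contract[of "(a, - i - 1)" x w] by (auto simp: algebra_simps)
    have 2: "contract (b, n - i) (contract x u) = - contract x (contract (b, n - i) u)"
      using contract_contract[of "(b, n - i)" x u] by (simp add: eq_neg_iff_add_eq_0)
    have 3: "(a, - i - 1) = x \<longleftrightarrow> i = - snd x - 1 \<and> fst x = a" by (cases x) auto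
    show ?thesis unfolding 2 flinearD(3)[OF wc_linear(1)] 1
      by (auto simp: 3) (simp add: algebra_simps)
  qed
  have "E_op a b n (contract x u) = (\<Sum>i\<in>I. wedge (a, - i - 1) (contract (b, n - i) (contract x u)))"
    by (rule E_op_superset[OF fin I(2)])
  also have "\<dots> = (\<Sum>i\<in>I. contract x (wedge (a, - i - 1) (contract (b, n - i) u))) -
      (if fst x = a then contract (b, snd x + n + 1) u else 0)"
    unfolding * sum_subtractf sum.delta[OF fin] using I(3) by simp
  also have "(\<Sum>i\<in>I. contract x (wedge (a, - i - 1) (contract (b, n - i) u))) = contract x (E_op a b n u)"
    by (subst E_op_superset[OF fin I(1)]) (simp add: flinear_sum)
  finally show ?thesis .
qed

section \<open>The invariant operator on the tensor square\<close>

definition bilin :: "(fock \<Rightarrow> fock \<Rightarrow> complex) \<Rightarrow> bool" where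
  "bilin B \<longleftrightarrow> (\<forall>u. fform_linear (B u)) \<and> (\<forall>v. fform_linear (\<lambda>u. B u v))"

lemma bilinI:
  assumes "\<And>u v w. B (u + v) w = B u w + B v w" "\<And>u v w. B w (u + v) = B w u + B w v"
    and "\<And>c u w. B (fscale c u) w = c * B u w" "\<And>c u w. B w (fscale c u) = c * B w u"
  shows "bilin B"
  using assms by (auto simp: bilin_def intro!: fform_linearI)

lemma bilinD:
  assumes "bilin B"
  shows "B (u + v) w = B u w + B v w" "B w (u + v) = B w u + B w v"
    and "B (u - v) w = B u w - B v w" "B w (u - v) = B w u - B w v"
    and "B (fscale c u) w = c * B u w" "B w (fscale c u) = c * B w u"
    and "B 0 w = 0" "B w 0 = 0"
    and "B (sum f I) w = (\<Sum>i\<in>I. B (f i) w)" "B w (sum f I) = (\<Sum>i\<in>I. B w (f i))"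
proof -
  interpret L: Vector_Spaces.linear fscale "(*)" "\<lambda>u. B u w" using assms by (simp add: bilin_def)
  interpret R: Vector_Spaces.linear fscale "(*)" "B w" using assms by (simp add: bilin_def)
  show "B (u + v) w = B u w + B v w" "B w (u + v) = B w u + B w v"
    and "B (u - v) w = B u w - B v w" "B w (u - v) = B w u - B w v"
    and "B (fscale c u) w = c * B u w" "B w (fscale c u) = c * B w u"
    and "B 0 w = 0" "B w 0 = 0"
    and "B (sum f I) w = (\<Sum>i\<in>I. B (f i) w)" "B w (sum f I) = (\<Sum>i\<in>I. B w (f i))"
    by (rule L.add R.add L.diff R.diff L.scale R.scale L.zero R.zero L.sum R.sum)+
qed

text \<open>
  The transpose of \<open>\<Omega> = \<Sum>\<^sub>x \<psi>\<^sup>+\<^sub>x \<otimes> \<psi>\<^sup>-\<^sub>x\<close>: as a functional on the tensor square,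
  \<open>casimir B\<close> is \<open>B \<circ> \<Omega>\<close>, and \<open>deriv_form e B\<close> below is \<open>B \<circ> (e \<otimes> 1 + 1 \<otimes> e)\<close>.
\<close>
definition casimir :: "(fock \<Rightarrow> fock \<Rightarrow> complex) \<Rightarrow> fock \<Rightarrow> fock \<Rightarrow> complex" where
  "casimir B u v = Sum_any (\<lambda>x. B (wedge x u) (contract x v))"

definition deriv_form :: "(fock \<Rightarrow> fock) \<Rightarrow> (fock \<Rightarrow> fock \<Rightarrow> complex) \<Rightarrow> fock \<Rightarrow> fock \<Rightarrow> complex" where
  "deriv_form e B u v = B (e u) v + B u (e v)"

definition exchange :: "fock \<Rightarrow> fock \<Rightarrow> mode set" where
  "exchange u v = {x. wedge x u \<noteq> 0 \<and> contract x v \<noteq> 0}"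

lemma finite_occ_diff: "finite (occupied T - occupied S)"
  by (rule finite_subset[of _ "(occupied T - vac_set) \<union> (vac_set - occupied S)"]) (auto simp: occ_fin)

text \<open>
  A mode in \<open>exchange u v\<close> is free in some configuration of \<open>u\<close> and occupied in some configuration
  of \<open>v\<close>, and any two configurations differ in finitely many modes.
\<close>
lemma finite_exchange: "finite (exchange u v)"
proof (rule finite_subset)
  show "exchange u v \<subseteq> (\<Union>S\<in>Poly_Mapping.keys u. \<Union>T\<in>Poly_Mapping.keys v. occupied T - occupied S)"
  proof
    fix x assume x: "x \<in> exchange u v"
    have "\<exists>S\<in>Poly_Mapping.keys u. x \<notin> occupied S"
    proof (rule ccontr)
      assume "\<not> ?thesis"
      then have "wedge x u = 0" by (auto simp: wedge_def lin_ext_def intro!: sum.neutral)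
      with x show False by (simp add: exchange_def)
    qed
    moreover have "\<exists>T\<in>Poly_Mapping.keys v. x \<in> occupied T"
    proof (rule ccontr)
      assume "\<not> ?thesis"
      then have "contract x v = 0" by (auto simp: contract_def lin_ext_def intro!: sum.neutral)
      with x show False by (simp add: exchange_def)
    qed
    ultimately show "x \<in> (\<Union>S\<in>Poly_Mapping.keys u. \<Union>T\<in>Poly_Mapping.keys v. occupied T - occupied S)"
      by blast
  qed
qed (intro finite_UN_I finite_keys finite_occ_diff)

lemma casimir_superset:
  assumes "bilin B" "finite X" "exchange u v \<subseteq> X"
  shows "casimir B u v = (\<Sum>x\<in>X. B (wedge x u) (contract x v))"
  unfolding casimir_def
proof (rule Sum_any.expand_superset[OF assms(2)])
  show "{x. B (wedge x u) (contract x v) \<noteq> 0} \<subseteq> X"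
    using assms(1,3) by (auto simp: exchange_def bilinD)
qed

lemma bilin_casimir: 
  assumes B: "bilin B"
  shows "bilin (casimir B)"
proof (rule bilinI)
  fix u v w :: fock and c :: complex
  note D = flinearD(1,4)[OF wc_linear(1)] flinearD(1,4)[OF wc_linear(2)] bilinD(1,2,5,6)[OF B]
  show "casimir B (u + v) w = casimir B u w + casimir B v w"
    by (subst (1 2 3) casimir_superset[OF B, of "exchange (u + v) w \<union> exchange u w \<union> exchange v w"])
      (auto simp: finite_exchange D sum.distrib)
  show "casimir B w (u + v) = casimir B w u + casimir B w v"
    by (subst (1 2 3) casimir_superset[OF B, of "exchange w (u + v) \<union> exchange w u \<union> exchange w v"])
      (auto simp: finite_exchange D sum.distrib)
  show "casimir B (fscale c u) w = c * casimir B u w"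
    by (subst (1 2) casimir_superset[OF B, of "exchange (fscale c u) w \<union> exchange u w"])
      (auto simp: finite_exchange D sum_distrib_left)
  show "casimir B w (fscale c u) = c * casimir B w u"
    by (subst (1 2) casimir_superset[OF B, of "exchange w (fscale c u) \<union> exchange w u"])
      (auto simp: finite_exchange D sum_distrib_left)
qed

lemma bilin_deriv_form: "bilin B \<Longrightarrow> flinear e \<Longrightarrow> bilin (deriv_form e B)"
  by (rule bilinI) (simp_all add: deriv_form_def bilinD flinearD algebra_simps)

text \<open>
  The two commutators of \<open>E\<close> contribute \<open>\<Sum>\<^sub>j \<psi>\<^sup>+\<^sub>s\<^sub>(\<^sub>j\<^sub>) \<otimes> \<psi>\<^sup>-\<^sub>j\<close> and its
  negative, where \<open>j\<close> runs over the modes of component \<open>b\<close> and \<open>s(j)\<close> is the mode of component \<open>a\<close> to which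
  \<open>E\<close> moves \<open>j\<close>. In the second sum the index is \<open>s(j)\<close>, so the sums cancel after a reindexing.
\<close>
lemma casimir_deriv_E_op:
  assumes ab: "a \<noteq> b" and B: "bilin B"
  shows "casimir (deriv_form (E_op a b n) B) u v = deriv_form (E_op a b n) (casimir B) u v"
proof -
  let ?E = "E_op a b n"
  \<comment> \<open>The involution that exchanges the source and the target of each hop.\<close>
  define \<sigma> where "\<sigma> = (\<lambda>x :: mode. if fst x = b then (a, snd x - n - 1)
    else if fst x = a then (b, snd x + n + 1) else x)"
  have \<sigma>\<sigma>: "\<sigma> (\<sigma> x) = x" for x using ab by (cases x) (auto simp: \<sigma>_def)
  define Y where "Y = exchange u v \<union> exchange (?E u) v \<union> exchange u (?E v)"
  define X where "X = Y \<union> \<sigma> ` Y"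
  have X: "finite X" "exchange u v \<subseteq> X" "exchange (?E u) v \<subseteq> X" "exchange u (?E v) \<subseteq> X"
    by (auto simp: X_def Y_def finite_exchange)
  have \<sigma>X: "\<sigma> x \<in> X" if "x \<in> X" for x using that by (auto simp: X_def \<sigma>\<sigma>)
  let ?f = "\<lambda>x. if fst x = b then B (wedge (a, snd x - n - 1) u) (contract x v) else 0"
  let ?g = "\<lambda>x. if fst x = a then B (wedge x u) (contract (b, snd x + n + 1) v) else 0"
  have fg: "sum ?f X = sum ?g X"
  proof (rule sum.reindex_bij_witness[of _ \<sigma> \<sigma>])
    fix x assume "x \<in> X"
    show "?g (\<sigma> x) = ?f x" using ab by (cases x) (auto simp: \<sigma>_def)
  qed (simp_all only: \<sigma>\<sigma> \<sigma>X)
  have "deriv_form ?E B (wedge x u) (contract x v) =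
    B (wedge x (?E u)) (contract x v) + B (wedge x u) (contract x (?E v)) + ?f x - ?g x" for x
    by (simp add: deriv_form_def E_op_wedge[OF ab] E_op_contract[OF ab] bilinD[OF B])
  then have "casimir (deriv_form ?E B) u v =
    (\<Sum>x\<in>X. B (wedge x (?E u)) (contract x v) + B (wedge x u) (contract x (?E v)) + ?f x - ?g x)"
    by (simp add: casimir_superset[OF bilin_deriv_form[OF B flinear_E_op[OF ab]] X(1,2)])
  also have "\<dots> = (\<Sum>x\<in>X. B (wedge x (?E u)) (contract x v)) + (\<Sum>x\<in>X. B (wedge x u) (contract x (?E v)))"
    using fg by (simp add: sum.distrib sum_subtractf)
  also have "\<dots> = deriv_form ?E (casimir B) u v"
    by (simp add: deriv_form_def casimir_superset[OF B X(1,3)] casimir_superset[OF B X(1,4)])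
  finally show ?thesis .
qed

definition casimir_invariant :: "(fock \<Rightarrow> fock) \<Rightarrow> bool" where
  "casimir_invariant e \<longleftrightarrow> flinear e \<and>
     (\<forall>B u v. bilin B \<longrightarrow> casimir (deriv_form e B) u v = deriv_form e (casimir B) u v)"

lemma casimir_invariant_E_op:
  assumes "a \<noteq> b"
  shows "casimir_invariant (\<lambda>v. fscale c (E_op a b n v))"
  unfolding casimir_invariant_def
proof (intro conjI allI impI)
  show "flinear (\<lambda>v. fscale c (E_op a b n v))" by (rule flinear_scale[OF flinear_E_op[OF assms]])
  fix B u v assume B: "bilin B"
  let ?E = "E_op a b n"
  have D: "deriv_form (\<lambda>v. fscale c (?E v)) B' u v = c * deriv_form ?E B' u v" if "bilin B'" for B' u v
    using that by (simp add: deriv_form_def bilinD algebra_simps)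
  note b = bilin_deriv_form[OF B flinear_E_op[OF assms]]
    bilin_deriv_form[OF B flinear_scale[OF flinear_E_op[OF assms]]]
  show "casimir (deriv_form (\<lambda>v. fscale c (?E v)) B) u v = deriv_form (\<lambda>v. fscale c (?E v)) (casimir B) u v"
    unfolding D[OF bilin_casimir[OF B]] casimir_deriv_E_op[OF assms B, symmetric]
    by (simp add: casimir_superset[OF b(1) finite_exchange order_refl] casimir_superset[OF b(2) finite_exchange order_refl]
        D[OF B] sum_distrib_left)
qed

section \<open>Formal exponentials as solutions of a recursion\<close>

text \<open>The kinds number the three exponentials of \<open>g_op\<close> from left to right, by their variables.\<close>
fun kind :: "svar \<Rightarrow> nat" where
  "kind (CVar j) = 0" | "kind (DVar j) = 1" | "kind (EVar j) = 2"

definition kdeg :: "nat \<Rightarrow> svar multiset \<Rightarrow> nat" where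
  "kdeg \<kappa> m = size {#s \<in># m. kind s = \<kappa>#}"

definition kvars :: "nat \<Rightarrow> svar multiset \<Rightarrow> svar set" where
  "kvars \<kappa> m = {s \<in> set_mset m. kind s = \<kappa>}"

lemma finite_kvars [simp]: "finite (kvars \<kappa> m)"
  by (simp add: kvars_def)

lemma kdeg_add: "kdeg \<kappa> (m + n) = kdeg \<kappa> m + kdeg \<kappa> n"
  by (simp add: kdeg_def)

lemma kdeg_split: "a \<subseteq># m \<Longrightarrow> kdeg \<kappa> m = kdeg \<kappa> a + kdeg \<kappa> (m - a)"
  by (metis kdeg_add subset_mset.add_diff_inverse)

lemma kdeg_pos: "s \<in># m \<Longrightarrow> kdeg (kind s) m > 0"
  by (auto simp: kdeg_def nonempty_has_size[symmetric] filter_mset_eq_conv)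

text \<open>
  If \<open>y = exp(\<Sum>\<^sub>s s e\<^sub>s) w\<close>, where \<open>s\<close> runs over the variables of kind \<open>\<kappa>\<close> and \<open>w\<close> does not involve
  them, then the Euler operator of these variables acts on \<open>y\<close> as \<open>\<Sum>\<^sub>s s e\<^sub>s\<close>. Comparing coefficients
  gives the recursion below. For a product of exponentials it holds for the leftmost one in
  general and, for the others, on monomials that are free of the variables further left; this is the
  role of the condition \<open>\<kappa> \<le> kind s\<close>. Each nonempty monomial meets some \<open>\<kappa>\<close> with
  \<open>kdeg \<kappa> m > 0\<close>, so the recursion determines \<open>y\<close> completely.
\<close>
definition solves :: "(svar \<Rightarrow> fock \<Rightarrow> fock) \<Rightarrow> fock \<Rightarrow> fock_series \<Rightarrow> bool" where
  "solves e v y \<longleftrightarrow> y {#} = v \<and>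
     (\<forall>\<kappa> m. (\<forall>s\<in>#m. \<kappa> \<le> kind s) \<longrightarrow>
        fscale (of_nat (kdeg \<kappa> m)) (y m) = (\<Sum>s\<in>kvars \<kappa> m. e s (y (m - {#s#}))))"

lemma solves_base: "solves e v y \<Longrightarrow> y {#} = v"
  by (simp add: solves_def)

lemma solvesD:
  assumes "solves e v y" "\<forall>s\<in>#m. \<kappa> \<le> kind s"
  shows "fscale (of_nat (kdeg \<kappa> m)) (y m) = (\<Sum>s\<in>kvars \<kappa> m. e s (y (m - {#s#})))"
  using assms unfolding solves_def by blast

lemma leading_kind:
  assumes "m \<noteq> {#}"
  obtains \<kappa> where "\<forall>s\<in>#m. \<kappa> \<le> kind s" "kdeg \<kappa> m > 0"
proof -
  let ?K = "kind ` set_mset m"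
  have "Min ?K \<in> ?K" using assms by (intro Min_in) auto
  then obtain s where s: "s \<in># m" "Min ?K = kind s" by auto
  show thesis
  proof (rule that)
    show "\<forall>t\<in>#m. Min ?K \<le> kind t" by simp
    show "kdeg (Min ?K) m > 0" unfolding s(2) by (rule kdeg_pos[OF s(1)])
  qed
qed

lemma fscale_cancel: "c \<noteq> 0 \<Longrightarrow> fscale c u = fscale c v \<Longrightarrow> u = v"
  by simp

lemma solves_unique:
  assumes "solves e v y" "solves e v z"
  shows "y m = z m"
proof (induction "size m" arbitrary: m rule: less_induct)
  case less
  show ?case
  proof (cases "m = {#}")
    case False
    then obtain \<kappa> where \<kappa>: "\<forall>s\<in>#m. \<kappa> \<le> kind s" "kdeg \<kappa> m > 0" by (rule leading_kind)
    have "(\<Sum>s\<in>kvars \<kappa> m. e s (y (m - {#s#}))) = (\<Sum>s\<in>kvars \<kappa> m. e s (z (m - {#s#})))"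
    proof (rule sum.cong[OF refl])
      fix s assume "s \<in> kvars \<kappa> m"
      then have "size (m - {#s#}) < size m" by (intro size_Diff1_less) (simp add: kvars_def)
      then show "e s (y (m - {#s#})) = e s (z (m - {#s#}))" by (simp only: less)
    qed
    then have "fscale (of_nat (kdeg \<kappa> m)) (y m) = fscale (of_nat (kdeg \<kappa> m)) (z m)"
      by (simp only: solvesD[OF assms(1) \<kappa>(1)] solvesD[OF assms(2) \<kappa>(1)])
    then show ?thesis by (rule fscale_cancel[rotated]) (use \<kappa>(2) in simp)
  qed (simp add: solves_base[OF assms(1)] solves_base[OF assms(2)])
qed

text \<open>
  Together with uniqueness this transports a relation \<open>L e\<^sub>s = e'\<^sub>s L\<close> from the exponents to
  the exponentials.
\<close>
lemma solves_intertwine: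
  assumes y: "solves e v y" and L: "flinear L" and e: "\<And>s w. L (e s w) = e' s (L w)"
  shows "solves e' (L v) (\<lambda>m. L (y m))"
  unfolding solves_def
proof (intro conjI allI impI)
  show "L (y {#}) = L v" using y by (simp add: solves_def)
  fix \<kappa> m assume "\<forall>s\<in>#m. \<kappa> \<le> kind s"
  from arg_cong[OF solvesD[OF y this], of L]
  show "fscale (of_nat (kdeg \<kappa> m)) (L (y m)) = (\<Sum>s\<in>kvars \<kappa> m. e' s (L (y (m - {#s#}))))"
    by (simp only: flinear_sum[OF L] e flinearD(4)[OF L])
qed

section \<open>The bilinear identity for exponentials\<close>

text \<open>The coefficient of the monomial \<open>m\<close> in the pairing of \<open>B\<close> with \<open>y \<otimes> z\<close>.\<close>
definition pair_coeff :: "(fock \<Rightarrow> fock \<Rightarrow> complex) \<Rightarrow> fock_series \<Rightarrow> fock_series \<Rightarrow> svar multiset \<Rightarrow> complex" where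
  "pair_coeff B y z m = (\<Sum>a | a \<subseteq># m. B (y a) (z (m - a)))"

lemma pair_coeff_flip: "pair_coeff B y z m = pair_coeff (\<lambda>u v. B v u) z y m"
  unfolding pair_coeff_def
  by (rule sum.reindex_bij_witness[of _ "\<lambda>a. m - a" "\<lambda>a. m - a"]) (auto simp: submultiset_diff)

lemma mset_remove_mono: "a \<subseteq># m \<Longrightarrow> a - c \<subseteq># m - c"
  by (simp add: subseteq_mset_def diff_le_mono)

lemma sum_submultisets_remove:
  "(\<Sum>a | a \<subseteq># m. \<Sum>s\<in>kvars \<kappa> a. f s (a - {#s#}) (m - a)) =
   (\<Sum>s\<in>kvars \<kappa> m. \<Sum>a | a \<subseteq># m - {#s#}. f s a (m - {#s#} - a))"
proof -
  have "(\<Sum>a | a \<subseteq># m. \<Sum>s\<in>kvars \<kappa> a. f s (a - {#s#}) (m - a)) =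
    (\<Sum>(a, s) \<in> (SIGMA a:{a. a \<subseteq># m}. kvars \<kappa> a). f s (a - {#s#}) (m - a))"
    by (simp add: sum.Sigma)
  also have "\<dots> = (\<Sum>(s, a) \<in> (SIGMA s:kvars \<kappa> m. {a. a \<subseteq># m - {#s#}}). f s a (m - {#s#} - a))"
    by (rule sum.reindex_bij_witness[of _ "\<lambda>(s, a). (add_mset s a, s)" "\<lambda>(a, s). (s, a - {#s#})"])
      (auto simp: kvars_def insert_subset_eq_iff mset_remove_mono dest: mset_subset_eqD)
  finally show ?thesis by (simp add: sum.Sigma)
qed

lemma pair_coeff_left:
  assumes B: "bilin B" and y: "solves e v y" and m: "\<forall>s\<in>#m. \<kappa> \<le> kind s"
  shows "(\<Sum>a | a \<subseteq># m. of_nat (kdeg \<kappa> a) * B (y a) (z (m - a))) =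
    (\<Sum>s\<in>kvars \<kappa> m. pair_coeff (\<lambda>u v. B (e s u) v) y z (m - {#s#}))"
proof -
  have "of_nat (kdeg \<kappa> a) * B (y a) (z (m - a)) = (\<Sum>s\<in>kvars \<kappa> a. B (e s (y (a - {#s#}))) (z (m - a)))"
    if "a \<subseteq># m" for a
  proof -
    have "\<forall>s\<in>#a. \<kappa> \<le> kind s" using m that by (auto dest: mset_subset_eqD)
    then show ?thesis
      by (simp only: bilinD(5)[OF B, symmetric] bilinD(9)[OF B] solvesD[OF y])
  qed
  then have "(\<Sum>a | a \<subseteq># m. of_nat (kdeg \<kappa> a) * B (y a) (z (m - a))) =
      (\<Sum>a | a \<subseteq># m. \<Sum>s\<in>kvars \<kappa> a. B (e s (y (a - {#s#}))) (z (m - a)))"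
    by simp
  then show ?thesis
    by (simp add: sum_submultisets_remove[of "\<lambda>s a b. B (e s (y a)) (z b)"] pair_coeff_def)
qed

lemma bilin_flip: "bilin B \<Longrightarrow> bilin (\<lambda>u v. B v u)"
  by (simp add: bilin_def)

text \<open>
  The Euler operator is a derivation, so \<open>y \<otimes> z\<close> obeys the recursion of \<open>e\<^sub>s \<otimes> 1 + 1 \<otimes> e\<^sub>s\<close>.
\<close>
lemma pair_coeff_rec:
  assumes B: "bilin B" and y: "solves e v y" and z: "solves e w z" and m: "\<forall>s\<in>#m. \<kappa> \<le> kind s"
  shows "of_nat (kdeg \<kappa> m) * pair_coeff B y z m = (\<Sum>s\<in>kvars \<kappa> m. pair_coeff (deriv_form (e s) B) y z (m - {#s#}))"
proof -
  have "of_nat (kdeg \<kappa> m) * pair_coeff B y z m =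
      (\<Sum>a | a \<subseteq># m. of_nat (kdeg \<kappa> a) * B (y a) (z (m - a))) +
      (\<Sum>a | a \<subseteq># m. of_nat (kdeg \<kappa> (m - a)) * B (y a) (z (m - a)))"
    by (simp add: pair_coeff_def sum_distrib_left kdeg_split[of _ m] algebra_simps flip: sum.distrib)
  also have "(\<Sum>a | a \<subseteq># m. of_nat (kdeg \<kappa> (m - a)) * B (y a) (z (m - a))) =
      (\<Sum>a | a \<subseteq># m. of_nat (kdeg \<kappa> a) * B (y (m - a)) (z a))"
    by (rule sum.reindex_bij_witness[of _ "\<lambda>a. m - a" "\<lambda>a. m - a"]) (auto simp: submultiset_diff)
  also have "\<dots> = (\<Sum>s\<in>kvars \<kappa> m. pair_coeff (\<lambda>u v. B u (e s v)) y z (m - {#s#}))"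
    using pair_coeff_left[OF bilin_flip[OF B] z m, of y] pair_coeff_flip[of _ z y] by simp
  also note pair_coeff_left[OF B y m, of z]
  finally show ?thesis by (simp add: pair_coeff_def deriv_form_def sum.distrib)
qed

text \<open>
  The relation \<open>\<Omega> (g u \<otimes> g v) = (g \<otimes> g) \<Omega> (u \<otimes> v)\<close>: both sides obey the same recursion because \<open>\<Omega>\<close>
  commutes with \<open>e\<^sub>s \<otimes> 1 + 1 \<otimes> e\<^sub>s\<close>. The form \<open>B\<close> varies in the induction, since the recursion
  replaces it by its derivatives.
\<close>
lemma casimir_pair_coeff:
  assumes e: "\<And>s. casimir_invariant (e s)" and y: "\<And>v. solves e v (y v)" and B: "bilin B"
  shows "pair_coeff (casimir B) (y u) (y v) m =
    (\<Sum>x\<in>exchange u v. pair_coeff B (y (wedge x u)) (y (contract x v)) m)"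
  using B
proof (induction "size m" arbitrary: m B rule: less_induct)
  case less
  note B = \<open>bilin B\<close>
  have y0: "y v {#} = v" for v using y by (simp add: solves_def)
  show ?case
  proof (cases "m = {#}")
    case True
    then show ?thesis
      by (simp add: pair_coeff_def y0 casimir_superset[OF B finite_exchange order_refl])
  next
    case False
    then obtain \<kappa> where \<kappa>: "\<forall>s\<in>#m. \<kappa> \<le> kind s" "kdeg \<kappa> m > 0" by (rule leading_kind)
    have lin: "flinear (e s)" for s using e by (simp add: casimir_invariant_def)
    have inv: "deriv_form (e s) (casimir B) = casimir (deriv_form (e s) B)" for s
      using e B by (simp add: casimir_invariant_def fun_eq_iff)
    have "of_nat (kdeg \<kappa> m) * pair_coeff (casimir B) (y u) (y v) m =
        (\<Sum>s\<in>kvars \<kappa> m. pair_coeff (casimir (deriv_form (e s) B)) (y u) (y v) (m - {#s#}))"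
      unfolding pair_coeff_rec[OF bilin_casimir[OF B] y y \<kappa>(1)] inv ..
    also have "\<dots> = (\<Sum>s\<in>kvars \<kappa> m. \<Sum>x\<in>exchange u v.
        pair_coeff (deriv_form (e s) B) (y (wedge x u)) (y (contract x v)) (m - {#s#}))"
      by (intro sum.cong refl less(1) bilin_deriv_form[OF B lin] size_Diff1_less) (simp add: kvars_def)
    also have "\<dots> = (\<Sum>x\<in>exchange u v. of_nat (kdeg \<kappa> m) * pair_coeff B (y (wedge x u)) (y (contract x v)) m)"
      unfolding pair_coeff_rec[OF B y y \<kappa>(1)] by (rule sum.swap)
    finally show ?thesis using \<kappa>(2) by (simp flip: sum_distrib_left)
  qed
qed

section \<open>The group element satisfies the recursion\<close>

text \<open>
  This is the exponent \<open>\<Sum>\<^sub>s s e\<^sub>s\<close> acting on series; multiplication by the variable \<open>s\<close> shifts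
  coefficients, whence the monomial \<open>m - {#s#}\<close>.
\<close>
definition deriv_series :: "(svar \<Rightarrow> fock \<Rightarrow> fock) \<Rightarrow> nat \<Rightarrow> fock_series \<Rightarrow> fock_series" where
  "deriv_series e \<kappa> u m = (\<Sum>s\<in>kvars \<kappa> m. e s (u (m - {#s#})))"

lemma fs_act_twist:
  "fs_act (twist \<gamma> (gen_series x) n) w m =
    (if x (\<gamma> - n - 1) \<in># m then fscale (sg \<gamma>) (w (m - {#x (\<gamma> - n - 1)#})) else 0)"
proof -
  let ?s = "x (\<gamma> - n - 1)"
  have "fs_act (twist \<gamma> (gen_series x) n) w m =
      (\<Sum>a | a \<subseteq># m. if a = {#?s#} then fscale (sg \<gamma>) (w (m - {#?s#})) else 0)"
    unfolding fs_act_def by (rule sum.cong) (simp_all add: fs_coeff_twist powi_minus_one)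
  then show ?thesis by (simp add: sum.delta)
qed

lemma res_op_eq_deriv_series:
  assumes x: "inj x" "range x = {s. kind s = \<kappa>}" and A: "\<And>n. flinear (A n)"
    and e: "\<And>j v. e (x j) v = fscale (sg \<gamma>) (A (j - \<gamma>) v)"
  shows "res_op (twist \<gamma> (gen_series x)) A = deriv_series e \<kappa>"
proof (intro ext)
  fix u m
  define t where "t = (\<lambda>n. x (\<gamma> - n - 1))"
  have inj: "inj t" unfolding t_def using x(1) by (auto intro!: injI dest: injD)
  have rng: "range t = {s. kind s = \<kappa>}"
  proof -
    have "x j = t (\<gamma> - j - 1)" for j by (simp add: t_def)
    then have "range x \<subseteq> range t" by blast
    moreover have "range t \<subseteq> range x" by (auto simp: t_def)
    ultimately show ?thesis using x(2) by blast
  qed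
  have img: "t ` (t -` set_mset m) = kvars \<kappa> m"
    using rng by (auto simp: kvars_def)
  have act: "fs_act (twist \<gamma> (gen_series x) n) (\<lambda>m'. A (- 1 - n) (u m')) m =
      (if t n \<in># m then e (t n) (u (m - {#t n#})) else 0)" for n
  proof -
    have "\<gamma> - n - 1 - \<gamma> = - 1 - n" by simp
    then show ?thesis unfolding fs_act_twist t_def e by (simp only:)
  qed
  have "res_op (twist \<gamma> (gen_series x)) A u m = Sum_any (\<lambda>n. if t n \<in># m then e (t n) (u (m - {#t n#})) else 0)"
    unfolding res_op_def act ..
  also have "\<dots> = (\<Sum>n\<in>t -` set_mset m. if t n \<in># m then e (t n) (u (m - {#t n#})) else 0)"
    using inj by (intro Sum_any.expand_superset finite_vimageI) auto
  also have "\<dots> = (\<Sum>n\<in>t -` set_mset m. e (t n) (u (m - {#t n#})))"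
    by (rule sum.cong) auto
  also have "\<dots> = deriv_series e \<kappa> u m"
    unfolding deriv_series_def img[symmetric] using inj
    by (subst sum.reindex) (auto simp: inj_on_def inj_def)
  finally show "res_op (twist \<gamma> (gen_series x)) A u m = deriv_series e \<kappa> u m" .
qed

lemma kdeg_remove:
  assumes "s \<in> kvars \<kappa> m"
  shows "kdeg \<mu> m = (if \<mu> = \<kappa> then Suc (kdeg \<mu> (m - {#s#})) else kdeg \<mu> (m - {#s#}))"
proof -
  have "{#s#} \<subseteq># m" using assms by (simp add: kvars_def)
  then have "kdeg \<mu> m = kdeg \<mu> {#s#} + kdeg \<mu> (m - {#s#})" by (rule kdeg_split)
  moreover have "kdeg \<mu> {#s#} = (if \<mu> = \<kappa> then 1 else 0)"
    using assms by (auto simp: kdeg_def kvars_def)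
  ultimately show ?thesis by (cases "\<mu> = \<kappa>") simp_all
qed

lemma kvars_empty: "kdeg \<kappa> m = 0 \<Longrightarrow> kvars \<kappa> m = {}"
  using kdeg_remove[of _ \<kappa> m \<kappa>] by auto

definition free_of :: "nat \<Rightarrow> fock_series \<Rightarrow> bool" where
  "free_of \<kappa> u \<longleftrightarrow> (\<forall>m. kdeg \<kappa> m > 0 \<longrightarrow> u m = 0)"

context
  fixes e :: "svar \<Rightarrow> fock \<Rightarrow> fock" and \<kappa> :: nat and u :: fock_series
  assumes lin: "\<And>s. flinear (e s)" and free: "free_of \<kappa> u"
begin

text \<open>
  Each application of the exponent raises the degree in the variables of kind \<open>\<kappa>\<close> by one, and \<open>u\<close>
  has degree zero. Hence a given coefficient of the exponential comes from exactly one power.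
\<close>
lemma deriv_series_power_support: "kdeg \<kappa> m \<noteq> n \<Longrightarrow> (deriv_series e \<kappa> ^^ n) u m = 0"
proof (induction n arbitrary: m)
  case 0
  then show ?case using free by (simp add: free_of_def)
next
  case (Suc n)
  have "(deriv_series e \<kappa> ^^ n) u (m - {#s#}) = 0" if "s \<in> kvars \<kappa> m" for s
    using kdeg_remove[OF that, of \<kappa>] Suc.prems by (intro Suc.IH) simp
  then have "deriv_series e \<kappa> ((deriv_series e \<kappa> ^^ n) u) m = 0"
    unfolding deriv_series_def[of e \<kappa> "(deriv_series e \<kappa> ^^ n) u" m]
    by (intro sum.neutral ballI) (simp only: flinearD(5)[OF lin])
  then show ?case by simp
qed

lemma exp_deriv_series_eq:
  "exp_op (deriv_series e \<kappa>) u m = fscale (1 / fact (kdeg \<kappa> m)) ((deriv_series e \<kappa> ^^ kdeg \<kappa> m) u m)"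
proof -
  have "{n. fscale (1 / fact n) ((deriv_series e \<kappa> ^^ n) u m) \<noteq> 0} \<subseteq> {kdeg \<kappa> m}"
  proof
    fix n assume "n \<in> {n. fscale (1 / fact n) ((deriv_series e \<kappa> ^^ n) u m) \<noteq> 0}"
    then have "(deriv_series e \<kappa> ^^ n) u m \<noteq> 0" by auto
    then show "n \<in> {kdeg \<kappa> m}" using deriv_series_power_support[of m n] by auto
  qed
  from Sum_any.expand_superset[OF _ this] show ?thesis by (simp add: exp_op_def)
qed

lemma exp_deriv_series_base: "kdeg \<kappa> m = 0 \<Longrightarrow> exp_op (deriv_series e \<kappa>) u m = u m"
  by (simp add: exp_deriv_series_eq)

lemma exp_deriv_series_rec:
  "fscale (of_nat (kdeg \<kappa> m)) (exp_op (deriv_series e \<kappa>) u m) =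
    (\<Sum>s\<in>kvars \<kappa> m. e s (exp_op (deriv_series e \<kappa>) u (m - {#s#})))"
proof (cases "kdeg \<kappa> m")
  case 0
  then show ?thesis by (simp add: kvars_empty)
next
  case (Suc n)
  have k: "kdeg \<kappa> (m - {#s#}) = n" if "s \<in> kvars \<kappa> m" for s
    using kdeg_remove[OF that, of \<kappa>] Suc by simp
  have c: "of_nat (Suc n) * (1 / fact (Suc n)) = (1 / fact n :: complex)"
    by (simp add: field_simps del: of_nat_Suc)
  have "fscale (of_nat (kdeg \<kappa> m)) (exp_op (deriv_series e \<kappa>) u m) =
      fscale (1 / fact n) (deriv_series e \<kappa> ((deriv_series e \<kappa> ^^ n) u) m)"
    unfolding exp_deriv_series_eq Suc fock.scale_scale c by simp
  also have "\<dots> = (\<Sum>s\<in>kvars \<kappa> m. e s (fscale (1 / fact n) ((deriv_series e \<kappa> ^^ n) u (m - {#s#}))))"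
    unfolding deriv_series_def[of e \<kappa> "(deriv_series e \<kappa> ^^ n) u" m]
    by (simp only: fock.scale_sum_right flinearD(4)[OF lin])
  also have "\<dots> = (\<Sum>s\<in>kvars \<kappa> m. e s (exp_op (deriv_series e \<kappa>) u (m - {#s#})))"
    by (rule sum.cong) (simp_all add: exp_deriv_series_eq k)
  finally show ?thesis .
qed

lemma free_of_exp_deriv_series:
  assumes "\<mu> \<noteq> \<kappa>" "free_of \<mu> u"
  shows "free_of \<mu> (exp_op (deriv_series e \<kappa>) u)"
proof -
  have "(deriv_series e \<kappa> ^^ n) u m = 0" if "kdeg \<mu> m > 0" for n m
    using that
  proof (induction n arbitrary: m)
    case 0
    then show ?case using assms(2) by (simp add: free_of_def)
  next
    case (Suc n)
    have "(deriv_series e \<kappa> ^^ n) u (m - {#s#}) = 0" if "s \<in> kvars \<kappa> m" for s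
      using kdeg_remove[OF that, of \<mu>] Suc.prems assms(1) by (intro Suc.IH) simp
    then have "deriv_series e \<kappa> ((deriv_series e \<kappa> ^^ n) u) m = 0"
      unfolding deriv_series_def[of e \<kappa> "(deriv_series e \<kappa> ^^ n) u" m]
      by (intro sum.neutral ballI) (simp only: flinearD(5)[OF lin])
    then show ?case by simp
  qed
  then show ?thesis by (simp add: free_of_def exp_deriv_series_eq)
qed

end

text \<open>
  The operators \<open>e\<^sub>s\<close> for \<open>g_op \<alpha> \<beta>\<close>: the residue pairs \<open>c\<^sub>j\<close> with the coefficient of
  \<open>w\<^sup>j\<^sup>-\<^sup>\<gamma>\<close> in \<open>E\<^sub>1\<^sub>0(w)\<close>, where \<open>\<gamma> = \<alpha> - \<beta>\<close>, and the others are analogous.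
\<close>
fun var_op :: "int \<Rightarrow> int \<Rightarrow> svar \<Rightarrow> fock \<Rightarrow> fock" where
  "var_op \<alpha> \<beta> (CVar j) v = fscale (sg (\<alpha> - \<beta>)) (E_op 1 0 (j - (\<alpha> - \<beta>)) v)"
| "var_op \<alpha> \<beta> (DVar j) v = fscale (sg \<alpha>) (E_op 2 0 (j - \<alpha>) v)"
| "var_op \<alpha> \<beta> (EVar j) v = fscale (sg \<beta>) (E_op 2 1 (j - \<beta>) v)"

lemma casimir_invariant_var_op: "casimir_invariant (var_op \<alpha> \<beta> s)"
proof (cases s)
  case (CVar j)
  show ?thesis unfolding CVar var_op.simps[abs_def] by (rule casimir_invariant_E_op) simp
next
  case (DVar j)
  show ?thesis unfolding DVar var_op.simps[abs_def] by (rule casimir_invariant_E_op) simp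
next
  case (EVar j)
  show ?thesis unfolding EVar var_op.simps[abs_def] by (rule casimir_invariant_E_op) simp
qed

lemma flinear_var_op: "flinear (var_op \<alpha> \<beta> s)"
  using casimir_invariant_var_op by (simp add: casimir_invariant_def)

lemma kind_le: "kind s \<le> 2"
  by (cases s) auto

lemma range_vars: "range CVar = {s. kind s = 0}" "range DVar = {s. kind s = 1}" "range EVar = {s. kind s = 2}"
  by (auto simp: image_iff elim: kind.elims)

lemma g_op_eq:
  "g_op \<alpha> \<beta> u = exp_op (deriv_series (var_op \<alpha> \<beta>) 0)
     (exp_op (deriv_series (var_op \<alpha> \<beta>) 1) (exp_op (deriv_series (var_op \<alpha> \<beta>) 2) u))"
proof -
  have "res_op (twist (\<alpha> - \<beta>) (gen_series CVar)) (E_op 1 0) = deriv_series (var_op \<alpha> \<beta>) 0"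
    by (rule res_op_eq_deriv_series) (simp_all add: flinear_E_op range_vars inj_def)
  moreover have "res_op (twist \<alpha> (gen_series DVar)) (E_op 2 0) = deriv_series (var_op \<alpha> \<beta>) 1"
    by (rule res_op_eq_deriv_series) (simp_all add: flinear_E_op range_vars inj_def)
  moreover have "res_op (twist \<beta> (gen_series EVar)) (E_op 2 1) = deriv_series (var_op \<alpha> \<beta>) 2"
    by (rule res_op_eq_deriv_series) (simp_all add: flinear_E_op range_vars inj_def)
  ultimately show ?thesis by (simp add: g_op_def)
qed

lemma g_op_solves: "solves (var_op \<alpha> \<beta>) v (g_op \<alpha> \<beta> (fock_const v))"
proof -
  let ?e = "var_op \<alpha> \<beta>"
  define yE where "yE = exp_op (deriv_series ?e 2) (fock_const v)"
  define yD where "yD = exp_op (deriv_series ?e 1) yE"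
  define y where "y = exp_op (deriv_series ?e 0) yD"
  have const: "free_of \<kappa> (fock_const v)" for \<kappa>
    by (auto simp: free_of_def fock_const_def kdeg_def)
  note lin = flinear_var_op[of \<alpha> \<beta>]
  have fE: "free_of 0 yE" "free_of 1 yE"
    unfolding yE_def by (rule free_of_exp_deriv_series[OF lin const _ const]; simp)+
  have fD: "free_of 0 yD"
    unfolding yD_def by (rule free_of_exp_deriv_series[OF lin fE(2) _ fE(1)]) simp
  have C: "kdeg 0 m = 0 \<Longrightarrow> y m = yD m"
    "fscale (of_nat (kdeg 0 m)) (y m) = (\<Sum>s\<in>kvars 0 m. ?e s (y (m - {#s#})))" for m
    unfolding y_def by (rule exp_deriv_series_base[OF lin fD] exp_deriv_series_rec[OF lin fD]; assumption?)+
  have D: "kdeg 1 m = 0 \<Longrightarrow> yD m = yE m"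
    "fscale (of_nat (kdeg 1 m)) (yD m) = (\<Sum>s\<in>kvars 1 m. ?e s (yD (m - {#s#})))" for m
    unfolding yD_def by (rule exp_deriv_series_base[OF lin fE(2)] exp_deriv_series_rec[OF lin fE(2)]; assumption?)+
  have E: "kdeg 2 m = 0 \<Longrightarrow> yE m = fock_const v m"
    "fscale (of_nat (kdeg 2 m)) (yE m) = (\<Sum>s\<in>kvars 2 m. ?e s (yE (m - {#s#})))" for m
    unfolding yE_def by (rule exp_deriv_series_base[OF lin const] exp_deriv_series_rec[OF lin const]; assumption?)+
  have kd: "kdeg \<mu> m = 0" if "\<forall>s\<in>#m. \<kappa> \<le> kind s" "\<mu> < \<kappa>" for \<kappa> \<mu> m
  proof -
    have "{#s \<in># m. kind s = \<mu>#} = {#}"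
    proof (rule multiset_eqI)
      fix s
      have "kind s = \<mu> \<Longrightarrow> s \<notin># m" using that by fastforce
      then show "count {#s \<in># m. kind s = \<mu>#} s = count {#} s" by (simp add: not_in_iff)
    qed
    then show ?thesis by (simp add: kdeg_def)
  qed
  have sub: "\<forall>t\<in>#m - {#s#}. \<kappa> \<le> kind t" if "\<forall>s\<in>#m. \<kappa> \<le> kind s" for \<kappa> m s
    using that by (meson in_diffD)
  have "solves ?e v y"
    unfolding solves_def
  proof (intro conjI allI impI)
    have "kdeg \<mu> {#} = 0" for \<mu> by (simp add: kdeg_def)
    then show "y {#} = v" by (simp add: C(1) D(1) E(1)) (simp add: fock_const_def)
    fix \<kappa> m assume m: "\<forall>s\<in>#m. \<kappa> \<le> kind s"
    consider "\<kappa> = 0" | "\<kappa> = 1" | "\<kappa> = 2" | "\<kappa> > 2" by linarith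
    then show "fscale (of_nat (kdeg \<kappa> m)) (y m) = (\<Sum>s\<in>kvars \<kappa> m. ?e s (y (m - {#s#})))"
    proof cases
      case 1
      then show ?thesis using C(2) by simp
    next
      case 2
      then show ?thesis using D(2)[of m] C(1)[OF kd[OF m]] C(1)[OF kd[OF sub[OF m]]] by simp
    next
      case 3
      then show ?thesis
        using E(2)[of m] D(1)[OF kd[OF m]] D(1)[OF kd[OF sub[OF m]]] C(1)[OF kd[OF m]] C(1)[OF kd[OF sub[OF m]]]
        by simp
    next
      case 4
      have "m = {#}"
      proof (rule ccontr)
        assume "m \<noteq> {#}"
        then obtain s where "s \<in># m" by blast
        then show False using m 4 kind_le[of s] by force
      qed
      then show ?thesis by (simp add: kdeg_def kvars_def)
    qed
  qed
  then show ?thesis by (simp add: g_op_eq y_def yD_def yE_def)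
qed

section \<open>Integer powers of a bijection\<close>

lemma int_power_0 [simp]: "int_power f 0 x = x"
  by (simp add: int_power_def)

lemma int_power_step:
  assumes "bij f"
  shows "int_power f (n + 1) x = f (int_power f n x)"
proof (cases "n \<ge> 0")
  case True
  then have "nat (n + 1) = Suc (nat n)" by simp
  then show ?thesis using True by (simp add: int_power_def)
next
  case False
  then have n: "nat (- n) = Suc (nat (- (n + 1)))" by simp
  have "int_power f (n + 1) x = (inv f ^^ nat (- (n + 1))) x"
    using False by (cases "n = - 1") (auto simp: int_power_def)
  moreover have "int_power f n x = inv f ((inv f ^^ nat (- (n + 1))) x)"
    using False n by (simp add: int_power_def)
  ultimately show ?thesis using assms by (simp add: bij_is_surj surj_f_inv_f)
qed

lemma int_power_pred:
  assumes "bij f"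
  shows "int_power f n x = f (int_power f (n - 1) x)"
  using int_power_step[OF assms, of "n - 1"] by simp

text \<open>
  A relation with \<open>Q\<close> that shifts the index of a family by \<open>\<delta>\<close> and multiplies by \<open>\<eta>\<close> propagates to all
  powers of \<open>Q\<close>. It serves for wedging and contraction, for other translation operators and for
  the family of all \<open>g_op \<alpha> \<beta>\<close>.
\<close>
lemma int_power_twisted_commute:
  fixes F :: "int \<Rightarrow> fock \<Rightarrow> fock"
  assumes Q: "bij Q" "flinear Q" and \<eta>: "\<eta> \<noteq> 0"
    and F: "\<And>j v. F j (Q v) = fscale \<eta> (Q (F (j + \<delta>) v))"
  shows "F j (int_power Q n v) = fscale (\<eta> powi n) (int_power Q n (F (j + n * \<delta>) v))"
proof (induction n arbitrary: j rule: int_induct[where k = 0])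
  case base
  show ?case by simp
next
  case (step1 n)
  have "F j (int_power Q (n + 1) v) = fscale \<eta> (Q (F (j + \<delta>) (int_power Q n v)))"
    by (simp add: int_power_step[OF Q(1)] F)
  also have "\<dots> = fscale (\<eta> powi (n + 1)) (int_power Q (n + 1) (F (j + \<delta> + n * \<delta>) v))"
    using \<eta> by (simp add: step1(2) int_power_step[OF Q(1)] flinearD(4)[OF Q(2)] power_int_add mult.commute)
  finally show ?case by (simp add: algebra_simps)
next
  case (step2 n)
  have "fscale \<eta> (Q (F j (int_power Q (n - 1) v))) = F (j - \<delta>) (int_power Q n v)"
    by (simp add: int_power_pred[OF Q(1), of n] F)
  also have "\<dots> = fscale (\<eta> powi n) (int_power Q n (F (j - \<delta> + n * \<delta>) v))"
    by (rule step2(2))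
  also have "\<dots> = fscale \<eta> (Q (fscale (\<eta> powi (n - 1)) (int_power Q (n - 1) (F (j - \<delta> + n * \<delta>) v))))"
    using \<eta> by (simp add: int_power_pred[OF Q(1), of n] flinearD(4)[OF Q(2)] power_int_diff)
  finally have "F j (int_power Q (n - 1) v) = fscale (\<eta> powi (n - 1)) (int_power Q (n - 1) (F (j - \<delta> + n * \<delta>) v))"
    using \<eta> bij_is_inj[OF Q(1)] by (simp add: inj_eq)
  then show ?case by (simp add: algebra_simps)
qed

lemma flinear_int_power:
  assumes "bij Q" "flinear Q"
  shows "flinear (int_power Q n)"
proof (induction n rule: int_induct[where k = 0])
  case base
  show ?case by (rule flinearI) simp_all
next
  case (step1 n)
  have "int_power Q (n + 1) = (\<lambda>v. Q (int_power Q n v))" by (rule ext) (rule int_power_step[OF assms(1)])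
  then show ?case using flinear_comp[OF assms(2) step1(2)] by simp
next
  case (step2 n)
  show ?case
  proof (rule flinearI)
    note inj = bij_is_inj[OF assms(1), THEN injD]
    note D = flinearD[OF assms(2)] flinearD[OF step2(2)] int_power_pred[OF assms(1), symmetric]
    show "int_power Q (n - 1) (u + v) = int_power Q (n - 1) u + int_power Q (n - 1) v" for u v
      by (rule inj) (simp only: D)
    show "int_power Q (n - 1) (fscale c v) = fscale c (int_power Q (n - 1) v)" for c v
      by (rule inj) (simp only: D)
  qed
qed

lemma int_power_add:
  assumes "bij f"
  shows "int_power f (m + n) x = int_power f m (int_power f n x)"
proof (induction m rule: int_induct[where k = 0])
  case (step1 m)
  have "m + 1 + n = m + n + 1" by simp
  then show ?case using step1(2) by (simp only: int_power_step[OF assms])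
next
  case (step2 m)
  have "f (int_power f (m - 1 + n) x) = f (int_power f (m - 1) (int_power f n x))"
    using step2(2) by (simp add: int_power_step[OF assms, symmetric] algebra_simps)
  then show ?case using bij_is_inj[OF assms] by (simp add: inj_eq)
qed simp

text \<open>
  The triangular numbers arise as the exponent of the sign collected by the powers of \<open>T\<^sub>1\<close> and \<open>T\<^sub>2\<close>
  on charged vacua.
\<close>
definition triangle :: "int \<Rightarrow> int" where
  "triangle n = n * (n + 1) div 2"

lemma triangle_succ: "triangle (n + 1) = triangle n + (n + 1)"
proof -
  have "(n + 1) * (n + 1 + 1) = n * (n + 1) + (n + 1) * 2" by (simp add: algebra_simps)
  then show ?thesis unfolding triangle_def by (simp only: div_mult_self1)
qed

lemma int_power_orbit:
  assumes Q: "bij Q" "flinear Q" and w: "\<And>n. Q (w n) = fscale (sg (n + 1)) (w (n + 1))"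
  shows "int_power Q n (w 0) = fscale (sg (triangle n)) (w n)"
proof (induction n rule: int_induct[where k = 0])
  case base
  show ?case by (simp add: triangle_def sg_def)
next
  case (step1 n)
  then show ?case
    by (simp add: int_power_step[OF Q(1)] flinearD(4)[OF Q(2)] w triangle_succ sg_add)
next
  case (step2 n)
  have t: "triangle n = triangle (n - 1) + n" using triangle_succ[of "n - 1"] by simp
  have s: "sg n * sg n = (1 :: complex)" by (simp add: sg_def)
  have w': "Q (w (n - 1)) = fscale (sg n) (w n)" using w[of "n - 1"] by simp
  have "Q (int_power Q (n - 1) (w 0)) = Q (fscale (sg (triangle (n - 1))) (w (n - 1)))"
    using step2(2) by (simp add: int_power_pred[OF Q(1), symmetric] flinearD(4)[OF Q(2)] w' t sg_add)
  then show ?case using bij_is_inj[OF Q(1)] by (simp add: inj_eq)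
qed

section \<open>The form and its adjoints\<close>

lemma bilin_fock_form: "bilin fock_form"
  using wedge_form_fock_form by (simp add: bilin_def wedge_form_def)

lemma bilin_eqI:
  assumes "bilin B" "bilin B'"
    and "\<And>S T. B (Poly_Mapping.single S 1) (Poly_Mapping.single T 1) = B' (Poly_Mapping.single S 1) (Poly_Mapping.single T 1)"
  shows "B u v = B' u v"
proof -
  have "B (Poly_Mapping.single S 1) = B' (Poly_Mapping.single S 1)" for S
    using assms by (intro linear_eqI) (auto simp: bilin_def)
  then have "(\<lambda>u. B u v) = (\<lambda>u. B' u v)"
    using assms by (intro linear_eqI) (auto simp: bilin_def)
  then show ?thesis by (rule fun_cong)
qed

lemma fock_form_single: "fock_form (Poly_Mapping.single S c) (Poly_Mapping.single T d) = (if S = T then c * d else 0)"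
  by (cases "c = 0") (auto simp: fock_form_eq coord_form_def lookup_single when_def)

lemma fock_form_wedge: "fock_form u (wedge x v) = fock_form (contract x u) v"
proof (rule bilin_eqI[of "\<lambda>u v. fock_form u (wedge x v)" "\<lambda>u v. fock_form (contract x u) v"])
  note D = bilinD[OF bilin_fock_form] flinearD(1,4)[OF wc_linear(1)] flinearD(1,4)[OF wc_linear(2)]
  show "bilin (\<lambda>u v. fock_form u (wedge x v))" "bilin (\<lambda>u v. fock_form (contract x u) v)"
    by (rule bilinI; simp add: D)+
  fix S T
  show "fock_form (Poly_Mapping.single S 1) (wedge x (Poly_Mapping.single T 1)) =
    fock_form (contract x (Poly_Mapping.single S 1)) (Poly_Mapping.single T 1)"
  proof (cases "x \<in> occupied S")
    case True
    then obtain S' where S': "x \<notin> occupied S'" "S = Config (insert x (occupied S'))" by (rule occ_eq_insert)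
    have "S = Config (insert x (occupied T)) \<longleftrightarrow> S' = T" if "x \<notin> occupied T"
      using that S' by (metis insert_ident occ_insert occupied_inject)
    then show ?thesis using S' True
      by (auto simp: wedge_single contract_single fock_form_single wsign_insert_self occupied_inverse bilinD(7,8)[OF bilin_fock_form])
  next
    case False
    then have "S \<noteq> Config (insert x (occupied T))" by (metis insertI1 occ_insert)
    then show ?thesis using False
      by (simp add: wedge_single contract_single fock_form_single bilinD(7,8)[OF bilin_fock_form])
  qed
qed

lemma fock_form_sym: "fock_form u v = fock_form v u"
  by (rule bilin_eqI[OF bilin_fock_form bilin_flip[OF bilin_fock_form]]) (simp add: fock_form_single)

lemma fock_form_contract: "fock_form u (contract x v) = fock_form (wedge x u) v"
  by (metis fock_form_sym fock_form_wedge)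

lemma fock_form_trans_op: "fock_form (trans_op a u) (trans_op a v) = fock_form u v"
proof (rule bilin_eqI[OF _ bilin_fock_form])
  show "bilin (\<lambda>u v. fock_form (trans_op a u) (trans_op a v))"
    by (rule bilinI) (simp_all add: bilinD[OF bilin_fock_form] flinearD(1,4)[OF trans_linear(1)])
  fix S T
  have "Config (shift_mode a ` occupied S) = Config (shift_mode a ` occupied T) \<longleftrightarrow> S = T"
    by (metis inj_image_eq_iff inj_shift(1) occ_shift occupied_inject)
  then show "fock_form (trans_op a (Poly_Mapping.single S 1)) (trans_op a (Poly_Mapping.single T 1)) =
      fock_form (Poly_Mapping.single S 1) (Poly_Mapping.single T 1)"
    by (simp add: trans_single fock_form_single)
qed

lemma fock_form_int_power: "fock_form (int_power (trans_op a) n u) (int_power (trans_op a) n v) = fock_form u v"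
proof (induction n rule: int_induct[where k = 0])
  case (step1 n)
  then show ?case by (simp add: int_power_step[OF bij_trans] fock_form_trans_op)
next
  case (step2 n)
  then show ?case by (simp add: int_power_pred[OF bij_trans, of _ n] fock_form_trans_op)
qed simp

section \<open>Conjugation by translation operators\<close>

lemma E_op_trans_op:
  assumes ab: "a \<noteq> b"
  shows "E_op a b n (trans_op c v) =
    fscale (if c = a \<or> c = b then - 1 else 1) (trans_op c (E_op a b (n - of_bool (c = a) + of_bool (c = b)) v))"
proof -
  let ?n = "n - of_bool (c = a) + of_bool (c = b)"
  let ?\<sigma> = "if c = a \<or> c = b then - 1 else 1 :: complex"
  let ?h = "\<lambda>n i v. wedge (a, - i - 1) (contract (b, n - i) v)"
  define t where "t = (\<lambda>i. i - of_bool (c = a) :: int)"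
  define I where "I = {i. ?h n i (trans_op c v) \<noteq> 0} \<union> (\<lambda>i. i + of_bool (c = a)) ` {i. ?h ?n i v \<noteq> 0}"
  have I: "finite I" "{i. ?h n i (trans_op c v) \<noteq> 0} \<subseteq> I"
    unfolding I_def by (intro finite_UnI finite_imageI finite_hops ab) blast
  have tI: "finite (t ` I)" "{i. ?h ?n i v \<noteq> 0} \<subseteq> t ` I"
    using I(1) by (simp, force simp: I_def t_def)
  have step: "?h n i (trans_op c v) = fscale ?\<sigma> (trans_op c (?h ?n (t i) v))" for i
  proof -
    have 1: "(a, - i - 1) = shift_mode c (a, - t i - 1)" "(b, n - i) = shift_mode c (b, ?n - t i)"
      using ab by (auto simp: shift_mode_def t_def)
    show ?thesis unfolding 1 contract_trans wedge_trans flinearD(4)[OF wc_linear(1)] fock.scale_scale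
      using ab by (auto simp: eta_def)
  qed
  have "E_op a b n (trans_op c v) = (\<Sum>i\<in>I. fscale ?\<sigma> (trans_op c (?h ?n (t i) v)))"
    unfolding E_op_superset[OF I] step ..
  also have "\<dots> = fscale ?\<sigma> (trans_op c (\<Sum>i\<in>I. ?h ?n (t i) v))"
    unfolding flinear_sum[OF trans_linear(1)] fock.scale_sum_right ..
  also have "(\<Sum>i\<in>I. ?h ?n (t i) v) = (\<Sum>i\<in>t ` I. ?h ?n i v)"
    by (subst sum.reindex) (auto simp: t_def inj_on_def)
  also have "\<dots> = E_op a b ?n v" by (rule E_op_superset[OF tI, symmetric])
  finally show ?thesis .
qed

text \<open>
  The signs and shifts in the definition of \<open>X\<^sup>(\<^sup>\<alpha>\<^sup>)\<close> are exactly those produced by conjugation.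
\<close>
lemma var_op_trans_op:
  "trans_op 0 (var_op \<alpha> \<beta> s v) = var_op (\<alpha> + 1) \<beta> s (trans_op 0 v)"
  "trans_op 1 (var_op \<alpha> \<beta> s v) = var_op \<alpha> (\<beta> + 1) s (trans_op 1 v)"
  "trans_op 2 (var_op \<alpha> \<beta> s v) = var_op (\<alpha> - 1) (\<beta> - 1) s (trans_op 2 v)"
  by (cases s; simp add: E_op_trans_op flinearD(4)[OF trans_linear(1)]; simp add: sg_def algebra_simps)+

lemma g_op_intertwine:
  assumes L: "flinear L" and e: "\<And>s v. L (var_op \<alpha> \<beta> s v) = var_op \<alpha>' \<beta>' s (L v)"
  shows "g_op \<alpha>' \<beta>' (fock_const (L v)) m = L (g_op \<alpha> \<beta> (fock_const v) m)"
proof -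
  have "solves (var_op \<alpha>' \<beta>') (L v) (\<lambda>m. L (g_op \<alpha> \<beta> (fock_const v) m))"
    using g_op_solves L e by (rule solves_intertwine)
  from solves_unique[OF g_op_solves this] show ?thesis .
qed

lemma g_op_scale: "g_op \<alpha> \<beta> (fock_const (fscale c v)) m = fscale c (g_op \<alpha> \<beta> (fock_const v) m)"
proof (rule g_op_intertwine)
  show "flinear (fscale c)" by (rule flinearI) (simp_all add: fock.scale_right_distrib mult.commute)
qed (simp add: flinearD(4)[OF flinear_var_op])

lemma sg_sq [simp]: "sg n * sg n = 1"
  by (simp add: sg_def)

lemma powi_sg: "(sg n :: complex) powi m = sg (n * m)"
  by (simp add: powi_minus_one[symmetric] power_int_mult)

section \<open>Charged vacua\<close>

definition charged :: "int \<Rightarrow> int \<Rightarrow> int \<Rightarrow> fock" where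
  "charged p q r = int_power (trans_op 0) p (int_power (trans_op 1) q (int_power (trans_op 2) r v0))"

lemma trans_op_swap:
  "trans_op b (trans_op a v) = fscale (if a = b then 1 else - 1) (trans_op a (trans_op b v))"
  using trans_anticomm[of b a v] by auto

lemmas trans_int_power_commute = int_power_twisted_commute[OF bij_trans trans_linear(1)]

lemma trans_op_int_power:
  assumes "a \<noteq> b"
  shows "trans_op b (int_power (trans_op a) n v) = fscale (sg n) (int_power (trans_op a) n (trans_op b v))"
  using trans_int_power_commute[of "- 1" "\<lambda>_. trans_op b" a 0 0 n v] trans_op_swap[of b a] assms
  by (simp add: powi_minus_one)

lemma int_power_trans_op:
  assumes "a \<noteq> b"
  shows "int_power (trans_op a) n (trans_op b v) = fscale (sg n) (trans_op b (int_power (trans_op a) n v))"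
  by (simp add: trans_op_int_power[OF assms])

lemma trans_op_charged:
  "trans_op 0 (charged p q r) = charged (p + 1) q r"
  "trans_op 1 (charged p q r) = fscale (sg p) (charged p (q + 1) r)"
  "trans_op 2 (charged p q r) = fscale (sg (p + q)) (charged p q (r + 1))"
  by (simp_all add: charged_def int_power_step[OF bij_trans] trans_op_int_power
      flinearD(4)[OF flinear_int_power[OF bij_trans trans_linear(1)]] sg_add)

lemma int_power_charged:
  "int_power (trans_op 0) n (charged p q r) = charged (p + n) q r"
  "int_power (trans_op 1) n (charged p q r) = fscale (sg (n * p)) (charged p (q + n) r)"
proof -
  show "int_power (trans_op 0) n (charged p q r) = charged (p + n) q r"
    by (simp add: charged_def int_power_add[OF bij_trans, symmetric] add.commute)
  have "int_power (trans_op 1) n (int_power (trans_op 0) p w) =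
      fscale (sg n powi p) (int_power (trans_op 0) p (int_power (trans_op 1) n w))" for w
    using trans_int_power_commute[of "sg n" "\<lambda>_. int_power (trans_op 1) n" 0 0 0 p w] int_power_trans_op[of 1 0 n]
    by (simp add: sg_def)
  then show "int_power (trans_op 1) n (charged p q r) = fscale (sg (n * p)) (charged p (q + n) r)"
    by (simp add: charged_def int_power_add[OF bij_trans, symmetric] powi_sg add.commute)
qed

definition charge :: "int \<Rightarrow> int \<Rightarrow> int \<Rightarrow> 3 \<Rightarrow> int" where
  "charge p q r b = (if b = 0 then p else if b = 1 then q else r)"

lemma three_cases: "b = 0 \<or> b = 1 \<or> b = (2::3)"
  using UNIV_3 by blast

text \<open>
  A family with the commutation rules of \<open>wedge (b, j)\<close> passes through the translation operators to the
  vacuum, and the resulting sign depends only on \<open>b\<close> and the charges. Therefore \<open>Q\<^sub>b\<close> and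
  wedging with the highest free mode of component \<open>b\<close>, which agree on \<open>v\<^sub>0\<close>, agree on all charged vacua
  (\<open>wedge_charged_top\<close>).
\<close>
lemma charged_commute:
  assumes F: "\<And>a j v. F j (trans_op a v) = fscale (if a = b then 1 else - 1) (trans_op a (F (j + of_bool (a = b)) v))"
  shows "F j (charged p q r) = fscale (sg (p + q + r - charge p q r b))
    (int_power (trans_op 0) p (int_power (trans_op 1) q (int_power (trans_op 2) r (F (j + charge p q r b) v0))))"
proof -
  have *: "F j (int_power (trans_op a) n v) =
      fscale (if a = b then 1 else sg n) (int_power (trans_op a) n (F (j + n * of_bool (a = b)) v))" for a j n v
  proof -
    have "F j (int_power (trans_op a) n v) =
        fscale ((if a = b then 1 else - 1) powi n) (int_power (trans_op a) n (F (j + n * of_bool (a = b)) v))"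
      by (rule trans_int_power_commute[where F = F and \<eta> = "if a = b then 1 else - 1" and \<delta> = "of_bool (a = b)"])
        (simp, rule F)
    then show ?thesis by (simp add: powi_minus_one)
  qed
  show ?thesis
    using three_cases[of b]
    by (elim disjE)
      (simp_all add: charged_def * flinearD(4)[OF flinear_int_power[OF bij_trans trans_linear(1)]] charge_def sg_add)
qed

lemma wedge_trans_op:
  "wedge (b, j) (trans_op a v) = fscale (if a = b then 1 else - 1) (trans_op a (wedge (b, j + of_bool (a = b)) v))"
  using wedge_trans[of a "(b, j + of_bool (a = b))" v] by (auto simp: shift_mode_def eta_def split: if_splits)

lemma contract_trans_op:
  "contract (b, j) (trans_op a v) = fscale (if a = b then 1 else - 1) (trans_op a (contract (b, j + of_bool (a = b)) v))"
  using contract_trans[of a "(b, j + of_bool (a = b))" v] by (auto simp: shift_mode_def eta_def split: if_splits)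

lemmas wedge_charged = charged_commute[of "\<lambda>j. wedge (b, j)" b for b, OF wedge_trans_op]
lemmas contract_charged = charged_commute[of "\<lambda>j. contract (b, j)" b for b, OF contract_trans_op]

lemma int_power_trans_0: "int_power (trans_op a) n 0 = 0"
  by (rule flinearD(5)[OF flinear_int_power[OF bij_trans trans_linear(1)]])

lemma wedge_charged_eq_0: "j \<ge> - charge p q r b \<Longrightarrow> wedge (b, j) (charged p q r) = 0"
  by (simp add: wedge_charged v0_def wedge_single int_power_trans_0)

lemma contract_charged_eq_0: "j < - charge p q r b \<Longrightarrow> contract (b, j) (charged p q r) = 0"
  by (simp add: contract_charged v0_def contract_single int_power_trans_0)

lemma wedge_charged_top: "wedge (b, - charge p q r b - 1) (charged p q r) = trans_op b (charged p q r)"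
proof -
  have "wedge (b, - 1) v0 = trans_op b v0" by (simp add: trans_v0 psi_plus_def)
  then show ?thesis
    using charged_commute[of "\<lambda>_. trans_op b" b, OF trans_op_swap] by (simp add: wedge_charged)
qed

lemma contract_trans_charged: "contract (b, - charge p q r b - 1) (trans_op b (charged p q r)) = charged p q r"
  using wedge_contract[of "(b, - charge p q r b - 1)" "(b, - charge p q r b - 1)" "charged p q r"]
  by (simp add: contract_charged_eq_0 wedge_charged_top)

lemma wedge_charged_add:
  "wedge (0, - p - 1) (charged p q r) = charged (p + 1) q r"
  "wedge (1, - q - 1) (charged p q r) = fscale (sg p) (charged p (q + 1) r)"
  "wedge (2, - r - 1) (charged p q r) = fscale (sg (p + q)) (charged p q (r + 1))"
  using wedge_charged_top[of 0 p q r] wedge_charged_top[of 1 p q r] wedge_charged_top[of 2 p q r]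
  by (simp_all add: charge_def trans_op_charged)

lemma contract_charged_remove:
  "contract (0, - p - 1) (charged (p + 1) q r) = charged p q r"
  "contract (1, - q - 1) (charged p (q + 1) r) = fscale (sg p) (charged p q r)"
  "contract (2, - r - 1) (charged p q (r + 1)) = fscale (sg (p + q)) (charged p q r)"
proof -
  show "contract (0, - p - 1) (charged (p + 1) q r) = charged p q r"
    using contract_trans_charged[of 0 p q r] by (simp add: charge_def trans_op_charged)
  have "fscale (sg p) (contract (1, - q - 1) (charged p (q + 1) r)) = charged p q r"
    using contract_trans_charged[of 1 p q r] by (simp add: charge_def trans_op_charged flinearD(4)[OF wc_linear(2)])
  from arg_cong[OF this, of "fscale (sg p)"]
  show "contract (1, - q - 1) (charged p (q + 1) r) = fscale (sg p) (charged p q r)" by simp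
  have "fscale (sg (p + q)) (contract (2, - r - 1) (charged p q (r + 1))) = charged p q r"
    using contract_trans_charged[of 2 p q r] by (simp add: charge_def trans_op_charged flinearD(4)[OF wc_linear(2)])
  from arg_cong[OF this, of "fscale (sg (p + q))"]
  show "contract (2, - r - 1) (charged p q (r + 1)) = fscale (sg (p + q)) (charged p q r)" by simp
qed

text \<open>In component \<open>b\<close>, the occupied modes of a vacuum with charge \<open>c\<close> are those from \<open>- c\<close> on.\<close>
lemma exchange_charged:
  "x \<in> exchange (charged p q r) (charged p' q' r') \<Longrightarrow>
    - charge p' q' r' (fst x) \<le> snd x \<and> snd x < - charge p q r (fst x)"
  using wedge_charged_eq_0[of p q r "fst x" "snd x"] contract_charged_eq_0[of "snd x" p' q' r' "fst x"]
  by (force simp: exchange_def)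

section \<open>Bilinear identities for matrix coefficients\<close>

definition mat_coeff :: "fock \<Rightarrow> fock \<Rightarrow> svar fseries" where
  "mat_coeff u v = FSeries (\<lambda>m. fock_form u (g_op 0 0 (fock_const v) m))"

lemma fs_coeff_ring:
  "fs_coeff 0 m = 0" "fs_coeff (f + g) m = fs_coeff f m + fs_coeff g m"
  "fs_coeff (f - g) m = fs_coeff f m - fs_coeff g m" "fs_coeff (- f) m = - fs_coeff f m"
  by (simp_all add: zero_fseries_def plus_fseries_def minus_fseries_def uminus_fseries_def)

lemma fs_coeff_sum: "fs_coeff (\<Sum>x\<in>X. f x) m = (\<Sum>x\<in>X. fs_coeff (f x) m)"
  by (induction X rule: infinite_finite_induct) (simp_all add: fs_coeff_ring)

lemma fs_coeff_sg: "fs_coeff (sg n * f) m = sg n * fs_coeff f m"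
  by (simp add: sg_def fs_coeff_ring)

lemma mat_coeff_scale:
  "mat_coeff (fscale (sg n) u) v = sg n * mat_coeff u v"
  "mat_coeff u (fscale (sg n) v) = sg n * mat_coeff u v"
  by (rule fseries_eqI; simp add: mat_coeff_def fs_coeff_sg g_op_scale bilinD[OF bilin_fock_form])+

lemma mat_coeff_0: "mat_coeff u 0 = 0"
proof (rule fseries_eqI)
  fix m
  have "g_op 0 0 (fock_const 0) m = 0" using g_op_scale[of 0 0 0 0 m] by simp
  then show "fs_coeff (mat_coeff u 0) m = fs_coeff 0 m"
    by (simp add: mat_coeff_def fs_coeff_ring bilinD[OF bilin_fock_form])
qed

definition prod_form :: "fock \<Rightarrow> fock \<Rightarrow> fock \<Rightarrow> fock \<Rightarrow> complex" where
  "prod_form a b u v = fock_form a u * fock_form b v"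

lemma bilin_prod_form: "bilin (prod_form a b)"
  by (rule bilinI) (simp_all add: prod_form_def bilinD[OF bilin_fock_form] algebra_simps)

lemma fs_coeff_mat_coeff_mult:
  "fs_coeff (mat_coeff a u * mat_coeff b v) m =
    pair_coeff (prod_form a b) (g_op 0 0 (fock_const u)) (g_op 0 0 (fock_const v)) m"
  by (simp add: times_fseries_def mat_coeff_def pair_coeff_def prod_form_def)

text \<open>
  The adjoint of \<open>\<Omega>\<close> removes a mode from the first vacuum and adds it to the second one. The vacua differ
  by one mode in each of the three components, hence three terms; the alternating sign comes
  from the order of the components.
\<close>
lemma casimir_prod_form:
  "casimir (prod_form (charged (p + 1) (q + 1) (r + 1)) (charged p q r)) u v =
     prod_form (charged p (q + 1) (r + 1)) (charged (p + 1) q r) u v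
     - prod_form (charged (p + 1) q (r + 1)) (charged p (q + 1) r) u v
     + prod_form (charged (p + 1) (q + 1) r) (charged p q (r + 1)) u v"
proof -
  let ?A = "charged (p + 1) (q + 1) (r + 1)" and ?B = "charged p q r"
  let ?X = "{(0, - p - 1), (1, - q - 1), (2, - r - 1)} :: mode set"
  let ?f = "\<lambda>x. fock_form (contract x ?A) u * fock_form (wedge x ?B) v"
  have "{x. ?f x \<noteq> 0} \<subseteq> ?X"
  proof
    fix x assume "x \<in> {x. ?f x \<noteq> 0}"
    then have "x \<in> exchange ?B ?A" by (auto simp: exchange_def bilinD[OF bilin_fock_form])
    from exchange_charged[OF this] show "x \<in> ?X"
      using three_cases[of "fst x"] by (cases x) (auto simp: charge_def)
  qed
  then have "casimir (prod_form ?A ?B) u v = sum ?f ?X"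
    unfolding casimir_def prod_form_def fock_form_wedge fock_form_contract
    by (intro Sum_any.expand_superset) simp
  also have "\<dots> = ?f (0, - p - 1) + ?f (1, - q - 1) + ?f (2, - r - 1)"
    by simp
  also have "\<dots> = prod_form (charged p (q + 1) (r + 1)) (charged (p + 1) q r) u v
     - prod_form (charged (p + 1) q (r + 1)) (charged p (q + 1) r) u v
     + prod_form (charged (p + 1) (q + 1) r) (charged p q (r + 1)) u v"
    by (simp add: contract_charged_remove wedge_charged_add prod_form_def bilinD[OF bilin_fock_form])
      (simp add: sg_def)
  finally show ?thesis .
qed

lemma bilinear_identity:
  "mat_coeff (charged p (q + 1) (r + 1)) u * mat_coeff (charged (p + 1) q r) v
   - mat_coeff (charged (p + 1) q (r + 1)) u * mat_coeff (charged p (q + 1) r) v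
   + mat_coeff (charged (p + 1) (q + 1) r) u * mat_coeff (charged p q (r + 1)) v =
   (\<Sum>x\<in>exchange u v. mat_coeff (charged (p + 1) (q + 1) (r + 1)) (wedge x u) * mat_coeff (charged p q r) (contract x v))"
proof (rule fseries_eqI)
  fix m
  let ?g = "\<lambda>v. g_op 0 0 (fock_const v)"
  let ?A = "charged (p + 1) (q + 1) (r + 1)" and ?B = "charged p q r"
  have "pair_coeff (casimir (prod_form ?A ?B)) (?g u) (?g v) m =
      (\<Sum>x\<in>exchange u v. pair_coeff (prod_form ?A ?B) (?g (wedge x u)) (?g (contract x v)) m)"
    by (rule casimir_pair_coeff[where y = ?g, OF casimir_invariant_var_op g_op_solves bilin_prod_form])
  then show "fs_coeff (mat_coeff (charged p (q + 1) (r + 1)) u * mat_coeff (charged (p + 1) q r) v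
     - mat_coeff (charged (p + 1) q (r + 1)) u * mat_coeff (charged p (q + 1) r) v
     + mat_coeff (charged (p + 1) (q + 1) r) u * mat_coeff (charged p q (r + 1)) v) m =
    fs_coeff (\<Sum>x\<in>exchange u v. mat_coeff ?A (wedge x u) * mat_coeff ?B (contract x v)) m"
    by (simp add: fs_coeff_ring fs_coeff_sum fs_coeff_mat_coeff_mult pair_coeff_def casimir_prod_form
        sum.distrib sum_subtractf)
qed

lemma exchange_sum_single:
  assumes "exchange u v \<subseteq> {x}"
  shows "(\<Sum>x\<in>exchange u v. mat_coeff a (wedge x u) * mat_coeff b (contract x v)) =
    mat_coeff a (wedge x u) * mat_coeff b (contract x v)"
proof (cases "x \<in> exchange u v")
  case True
  then have "exchange u v = {x}" using assms by blast
  then show ?thesis by simp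
next
  case False
  then have "exchange u v = {}" using assms by blast
  moreover have "wedge x u = 0 \<or> contract x v = 0" using False by (simp add: exchange_def)
  ultimately show ?thesis by (auto simp: mat_coeff_0)
qed

text \<open>
  Each mode of \<open>v\<close> is occupied in \<open>u\<close>, so no mode can be moved from \<open>v\<close> to \<open>u\<close>.
\<close>
lemma bilinear_identity_vanishing:
  fixes p q r p\<^sub>1 q\<^sub>1 r\<^sub>1 p\<^sub>2 q\<^sub>2 r\<^sub>2 :: int
  assumes "p\<^sub>2 \<le> p\<^sub>1" "q\<^sub>2 \<le> q\<^sub>1" "r\<^sub>2 \<le> r\<^sub>1"
  defines "u \<equiv> charged p\<^sub>1 q\<^sub>1 r\<^sub>1" and "v \<equiv> charged p\<^sub>2 q\<^sub>2 r\<^sub>2"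
  shows "mat_coeff (charged p (q + 1) (r + 1)) u * mat_coeff (charged (p + 1) q r) v
   - mat_coeff (charged (p + 1) q (r + 1)) u * mat_coeff (charged p (q + 1) r) v
   + mat_coeff (charged (p + 1) (q + 1) r) u * mat_coeff (charged p q (r + 1)) v = 0"
proof -
  have "exchange u v = {}"
    using assms exchange_charged[of _ p\<^sub>1 q\<^sub>1 r\<^sub>1 p\<^sub>2 q\<^sub>2 r\<^sub>2] by (force simp: charge_def split: if_splits)
  then show ?thesis unfolding bilinear_identity by simp
qed

text \<open>
  Only the lowest mode of component \<open>0\<close> of \<open>v\<close> is free in \<open>u\<close>; moving it turns both vectors
  into charged vacua again. The next lemma is the analogue for component \<open>1\<close>.
\<close>
lemma bilinear_identity_first:
  fixes p q r p\<^sub>1 q\<^sub>1 r\<^sub>1 q\<^sub>2 r\<^sub>2 :: int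
  assumes "q\<^sub>2 \<le> q\<^sub>1" "r\<^sub>2 \<le> r\<^sub>1"
  defines "u \<equiv> charged p\<^sub>1 q\<^sub>1 r\<^sub>1" and "v \<equiv> charged (p\<^sub>1 + 1) q\<^sub>2 r\<^sub>2"
  shows "mat_coeff (charged p (q + 1) (r + 1)) u * mat_coeff (charged (p + 1) q r) v
   - mat_coeff (charged (p + 1) q (r + 1)) u * mat_coeff (charged p (q + 1) r) v
   + mat_coeff (charged (p + 1) (q + 1) r) u * mat_coeff (charged p q (r + 1)) v =
   mat_coeff (charged (p + 1) (q + 1) (r + 1)) (charged (p\<^sub>1 + 1) q\<^sub>1 r\<^sub>1) * mat_coeff (charged p q r) (charged p\<^sub>1 q\<^sub>2 r\<^sub>2)"
proof -
  have "exchange u v \<subseteq> {(0, - p\<^sub>1 - 1)}"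
    using assms exchange_charged[of _ p\<^sub>1 q\<^sub>1 r\<^sub>1 "p\<^sub>1 + 1" q\<^sub>2 r\<^sub>2] by (force simp: charge_def split: if_splits)
  then show ?thesis
    unfolding bilinear_identity exchange_sum_single[OF \<open>exchange u v \<subseteq> _\<close>] by (simp add: u_def v_def wedge_charged_add contract_charged_remove)
qed

lemma bilinear_identity_second:
  fixes p q r p\<^sub>1 q\<^sub>1 r\<^sub>1 p\<^sub>2 r\<^sub>2 :: int
  assumes "p\<^sub>2 \<le> p\<^sub>1" "r\<^sub>2 \<le> r\<^sub>1"
  defines "u \<equiv> charged p\<^sub>1 q\<^sub>1 r\<^sub>1" and "v \<equiv> charged p\<^sub>2 (q\<^sub>1 + 1) r\<^sub>2"
  shows "mat_coeff (charged p (q + 1) (r + 1)) u * mat_coeff (charged (p + 1) q r) v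
   - mat_coeff (charged (p + 1) q (r + 1)) u * mat_coeff (charged p (q + 1) r) v
   + mat_coeff (charged (p + 1) (q + 1) r) u * mat_coeff (charged p q (r + 1)) v =
   sg (p\<^sub>1 + p\<^sub>2) * (mat_coeff (charged (p + 1) (q + 1) (r + 1)) (charged p\<^sub>1 (q\<^sub>1 + 1) r\<^sub>1) *
     mat_coeff (charged p q r) (charged p\<^sub>2 q\<^sub>1 r\<^sub>2))"
proof -
  have "exchange u v \<subseteq> {(1, - q\<^sub>1 - 1)}"
    using assms exchange_charged[of _ p\<^sub>1 q\<^sub>1 r\<^sub>1 p\<^sub>2 "q\<^sub>1 + 1" r\<^sub>2] by (force simp: charge_def split: if_splits)
  then show ?thesis
    unfolding bilinear_identity exchange_sum_single[OF \<open>exchange u v \<subseteq> _\<close>]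
    by (simp add: u_def v_def wedge_charged_add contract_charged_remove mat_coeff_scale sg_add mult_ac)
qed

text \<open>
  \<open>Q\<^sub>0 Q\<^sub>1 Q\<^sub>2\<close> acts as multiplication by \<open>1 / z\<close>, which commutes with the loop group.
\<close>
lemma mat_coeff_shift:
  "mat_coeff (charged (p + 1) (q + 1) (r + 1)) (charged (p' + 1) (q' + 1) (r' + 1)) =
    sg (q + q') * mat_coeff (charged p q r) (charged p' q' r')"
proof -
  let ?Z = "\<lambda>v. trans_op 0 (trans_op 1 (trans_op 2 v))"
  have Z: "?Z (charged p q r) = fscale (sg q) (charged (p + 1) (q + 1) (r + 1))" for p q r
    by (simp add: trans_op_charged flinearD(4)[OF trans_linear(1)] sg_add)
  have "g_op 0 0 (fock_const (?Z v)) m = ?Z (g_op 0 0 (fock_const v) m)" for v m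
    by (rule g_op_intertwine[of ?Z, OF flinear_comp[OF trans_linear(1) flinear_comp[OF trans_linear(1) trans_linear(1)]]])
      (simp add: var_op_trans_op)
  then have "mat_coeff (?Z u) (?Z v) = mat_coeff u v" for u v
    by (simp add: mat_coeff_def fock_form_trans_op)
  from this[of "charged p q r" "charged p' q' r'"]
  have "mat_coeff (charged p q r) (charged p' q' r') =
      sg q' * (sg q * mat_coeff (charged (p + 1) (q + 1) (r + 1)) (charged (p' + 1) (q' + 1) (r' + 1)))"
    unfolding Z mat_coeff_scale by (rule sym)
  then show ?thesis by (simp only: sg_add) (simp add: sg_def)
qed

section \<open>The tau functions as matrix coefficients\<close>

lemma T_ops: "T1 = (\<lambda>v. trans_op 1 (inv (trans_op 0) v))" "T2 = (\<lambda>v. trans_op 2 (inv (trans_op 1) v))"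
  by (simp_all add: T1_def T2_def Q_op_eq o_def)

lemma bij_T: "bij T1" "bij T2"
  unfolding T1_def T2_def Q_op_eq by (intro bij_comp bij_trans bij_imp_bij_inv)+

lemma inv_trans_linear: "flinear (inv (trans_op a))"
proof (rule flinearI)
  note inv = bij_is_inj[OF bij_trans, THEN inv_f_eq] surj_f_inv_f[OF bij_is_surj[OF bij_trans]]
  show "inv (trans_op a) (u + v) = inv (trans_op a) u + inv (trans_op a) v" for u v
    by (rule inv(1)) (simp add: flinearD(1)[OF trans_linear(1)] inv(2))
  show "inv (trans_op a) (fscale c v) = fscale c (inv (trans_op a) v)" for c v
    by (rule inv(1)) (simp add: flinearD(4)[OF trans_linear(1)] inv(2))
qed

lemma flinear_T: "flinear T1" "flinear T2"
  unfolding T_ops by (rule flinear_comp[OF trans_linear(1) inv_trans_linear])+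

lemma T_charged:
  "T1 (charged p q r) = fscale (sg (p - 1)) (charged (p - 1) (q + 1) r)"
  "T2 (charged p q r) = fscale (sg (q - 1)) (charged p (q - 1) (r + 1))"
proof -
  note inv = inv_f_f[OF bij_is_inj[OF bij_trans]]
  have "trans_op 0 (charged (p - 1) q r) = charged p q r" by (simp add: trans_op_charged)
  then have "inv (trans_op 0) (charged p q r) = charged (p - 1) q r" by (metis inv)
  then show "T1 (charged p q r) = fscale (sg (p - 1)) (charged (p - 1) (q + 1) r)"
    by (simp add: T_ops trans_op_charged)
  have "trans_op 1 (fscale (sg p) (charged p (q - 1) r)) = charged p q r"
    by (simp add: trans_op_charged flinearD(4)[OF trans_linear(1)])
  then have "inv (trans_op 1) (charged p q r) = fscale (sg p) (charged p (q - 1) r)" by (metis inv)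
  then show "T2 (charged p q r) = fscale (sg (q - 1)) (charged p (q - 1) (r + 1))"
    by (simp add: T_ops trans_op_charged flinearD(4)[OF trans_linear(1)]) (simp add: sg_def)
qed

lemma T_powers_v0:
  "int_power T1 k (int_power T2 l v0) = fscale (sg (triangle k + triangle l)) (charged (- k) (k - l) l)"
proof -
  have v0: "v0 = charged 0 (- 0) 0" by (simp add: charged_def)
  have "int_power T2 l v0 = fscale (sg (triangle l)) (charged 0 (- l) l)"
    unfolding v0
  proof (rule int_power_orbit[OF bij_T(2) flinear_T(2), where w = "\<lambda>l. charged 0 (- l) l"])
    show "T2 (charged 0 (- n) n) = fscale (sg (n + 1)) (charged 0 (- (n + 1)) (n + 1))" for n
      by (simp add: T_charged) (simp add: sg_def)
  qed
  moreover have "int_power T1 k (charged (- 0) (0 - l) l) = fscale (sg (triangle k)) (charged (- k) (k - l) l)"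
  proof (rule int_power_orbit[OF bij_T(1) flinear_T(1), where w = "\<lambda>k. charged (- k) (k - l) l"])
    fix n
    have "- (n + 1) = - n - 1" "n + 1 - l = n - l + 1" by simp_all
    then show "T1 (charged (- n) (n - l) l) = fscale (sg (n + 1)) (charged (- (n + 1)) (n + 1 - l) l)"
      by (simp only: T_charged) (simp add: sg_def)
  qed
  ultimately show ?thesis
    by (simp add: flinearD(4)[OF flinear_int_power[OF bij_T(1) flinear_T(1)]] sg_add mult.commute)
qed

lemma g_op_charged:
  "g_op 0 0 (fock_const (charged (- \<alpha>) (- \<beta>) 0)) m =
    int_power (trans_op 0) (- \<alpha>) (int_power (trans_op 1) (- \<beta>) (g_op \<alpha> \<beta> (fock_const v0) m))"
proof -
  \<comment> \<open>Indexed by \<open>j = - \<alpha>\<close> or \<open>j = - \<beta>\<close>, these families are shifted by one when a translation passes.\<close>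
  have 0: "g_op (- j) 0 (fock_const (trans_op 0 v)) m = fscale 1 (trans_op 0 (g_op (- (j + 1)) 0 (fock_const v) m))" for j v
    using g_op_intertwine[OF trans_linear(1), of 0 "- (j + 1)" 0 "- j" 0 v m] by (simp add: var_op_trans_op)
  have 1: "g_op \<alpha> (- j) (fock_const (trans_op 1 v)) m = fscale 1 (trans_op 1 (g_op \<alpha> (- (j + 1)) (fock_const v) m))" for j v
    using g_op_intertwine[OF trans_linear(1), of 1 \<alpha> "- (j + 1)" \<alpha> "- j" v m] by (simp add: var_op_trans_op)
  have "g_op (- 0) 0 (fock_const (int_power (trans_op 0) (- \<alpha>) w)) m =
      fscale (1 powi (- \<alpha>)) (int_power (trans_op 0) (- \<alpha>) (g_op (- (0 + - \<alpha> * 1)) 0 (fock_const w) m))" for w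
    by (rule trans_int_power_commute[where F = "\<lambda>j v. g_op (- j) 0 (fock_const v) m", OF _ 0]) simp
  moreover have "g_op \<alpha> (- 0) (fock_const (int_power (trans_op 1) (- \<beta>) w)) m =
      fscale (1 powi (- \<beta>)) (int_power (trans_op 1) (- \<beta>) (g_op \<alpha> (- (0 + - \<beta> * 1)) (fock_const w) m))" for w
    by (rule trans_int_power_commute[where F = "\<lambda>j v. g_op \<alpha> (- j) (fock_const v) m", OF _ 1]) simp
  ultimately show ?thesis by (simp add: charged_def)
qed

text \<open>
  Applying \<open>Q\<^sub>0\<^sup>-\<^sup>\<alpha> Q\<^sub>1\<^sup>-\<^sup>\<beta>\<close> to both arguments of the form removes the twists from the group element; the
  sign \<open>(- 1)\<^sup>\<beta>\<^sup>k\<close> comes from moving \<open>Q\<^sub>1\<^sup>-\<^sup>\<beta>\<close> past \<open>Q\<^sub>0\<^sup>-\<^sup>k\<close>.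
\<close>
lemma tau_eq:
  "tau k l \<alpha> \<beta> = sg (triangle k + triangle l + \<beta> * k) *
     mat_coeff (charged (- k - \<alpha>) (k - l - \<beta>) l) (charged (- \<alpha>) (- \<beta>) 0)"
proof (rule fseries_eqI)
  fix m
  let ?y = "g_op \<alpha> \<beta> (fock_const v0) m"
  let ?Q = "\<lambda>v. int_power (trans_op 0) (- \<alpha>) (int_power (trans_op 1) (- \<beta>) v)"
  have Q: "?Q (charged (- k) (k - l) l) = fscale (sg (\<beta> * k)) (charged (- k - \<alpha>) (k - l - \<beta>) l)"
    by (simp add: int_power_charged flinearD(4)[OF flinear_int_power[OF bij_trans trans_linear(1)]])
  have "fs_coeff (tau k l \<alpha> \<beta>) m = sg (triangle k + triangle l) * fock_form (charged (- k) (k - l) l) ?y"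
    by (simp add: tau_def T_powers_v0 bilinD[OF bilin_fock_form])
  also have "fock_form (charged (- k) (k - l) l) ?y = fock_form (?Q (charged (- k) (k - l) l)) (?Q ?y)"
    by (simp add: fock_form_int_power)
  also have "\<dots> = sg (\<beta> * k) * fs_coeff (mat_coeff (charged (- k - \<alpha>) (k - l - \<beta>) l) (charged (- \<alpha>) (- \<beta>) 0)) m"
    unfolding Q by (simp add: mat_coeff_def g_op_charged bilinD[OF bilin_fock_form])
  finally show "fs_coeff (tau k l \<alpha> \<beta>) m = fs_coeff (sg (triangle k + triangle l + \<beta> * k) *
     mat_coeff (charged (- k - \<alpha>) (k - l - \<beta>) l) (charged (- \<alpha>) (- \<beta>) 0)) m"
    by (simp add: fs_coeff_sg sg_add mult.assoc)
qed

abbreviation mc :: "int \<Rightarrow> int \<Rightarrow> int \<Rightarrow> int \<Rightarrow> int \<Rightarrow> svar fseries" where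
  "mc p q r a b \<equiv> mat_coeff (charged p q r) (charged a b 0)"

section \<open>The system of equations\<close>

lemma sg_sq_left: "sg n * (sg n * x) = (x :: 'a::ring_1)"
  by (simp add: sg_def)

lemma sg_diff: "sg (m - n) = sg m * sg n" and sg_values: "sg 0 = 1" "sg 1 = - 1" "sg 2 = 1" "sg 3 = - 1" "sg (n * 2) = 1" "sg (n * 3) = sg n"
  and sg_minus: "sg (- n) = sg n"
  by (auto simp: sg_def)

lemmas sg_arith = sg_add sg_diff sg_minus sg_values sg_sq_left algebra_simps

lemma sg_cancel:
  fixes x y :: "'a::ring_1"
  assumes "sg n * x = sg n * y"
  shows "x = y"
  using arg_cong[OF assms, of "(*) (sg n)"] by (simp add: sg_sq_left)

lemma mc_shift:
  "mat_coeff (charged p q r) (charged a b 1) = sg (q + b) * mc (p - 1) (q - 1) (r - 1) (a - 1) (b - 1)"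
  using mat_coeff_shift[of "p - 1" "q - 1" "r - 1" "a - 1" "b - 1" 0] by (simp add: sg_def)

text \<open>
  In \<open>bilinear_identity_first\<close> take \<open>u\<close> of charge \<open>(a, b + 1, 1)\<close> and \<open>v\<close> of charge \<open>(a + 1, b, 0)\<close>.
  Moving one mode gives the charges \<open>(a + 1, b + 1, 1)\<close> and \<open>(a, b, 0)\<close>, which differ by the
  translation \<open>(1,1,1)\<close>, so the right side is a square. The same translation brings \<open>u\<close> to the charge \<open>(a - 1, b, 0)\<close>.
\<close>
lemma mc_square_first:
  "(mc p q r a b)\<^sup>2 =
     mc (p - 1) q r (a - 1) b * mc (p + 1) q r (a + 1) b
     + mc p (q - 1) r (a - 1) b * mc p (q + 1) r (a + 1) b
     + mc p q (r - 1) (a - 1) b * mc p q (r + 1) (a + 1) b"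
  using bilinear_identity_first[of b "b + 1" 0 1 p q r a]
  by - (rule sg_cancel[of "q + b"], simp add: mc_shift, simp add: sg_arith power2_eq_square)

text \<open>
  The same argument with \<open>u\<close> of charge \<open>(a + 1, b, 1)\<close> and \<open>v\<close> of charge \<open>(a, b + 1, 0)\<close>.
\<close>
lemma mc_square_second:
  "(mc p q r a b)\<^sup>2 =
     mc (p - 1) q r a (b - 1) * mc (p + 1) q r a (b + 1)
     + mc p (q - 1) r a (b - 1) * mc p (q + 1) r a (b + 1)
     + mc p q (r - 1) a (b - 1) * mc p q (r + 1) a (b + 1)"
  using bilinear_identity_second[of a "a + 1" 0 1 p q r b]
  by - (rule sg_cancel[of "q + b + 1"], simp add: mc_shift, simp add: sg_arith power2_eq_square)

lemma tau_eqI: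
  assumes "p = - k - \<alpha>" "q = k - l - \<beta>" "a = - \<alpha>" "b = - \<beta>"
  shows "tau k l \<alpha> \<beta> = sg (triangle k + triangle l + \<beta> * k) * mc p q l a b"
  unfolding assms by (rule tau_eq)

lemma triangle_pred: "triangle (n - 1) = triangle n - n"
  using triangle_succ[of "n - 1"] by simp

theorem theorem3p8:
  fixes k l \<alpha> \<beta> :: int
  assumes "k \<ge> 0" and "l \<ge> 0"
  shows
    "(tau k l (\<alpha> + 1) \<beta>)\<^sup>2 =
       tau k l \<alpha> \<beta> * tau k l (\<alpha> + 2) \<beta>
       + tau (k + 1) (l + 1) \<alpha> \<beta> * tau (k - 1) (l - 1) (\<alpha> + 2) \<beta>
       - tau (k + 1) l \<alpha> \<beta> * tau (k - 1) l (\<alpha> + 2) \<beta> \<and>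
     tau (k - 1) (l - 1) (\<alpha> + 2) \<beta> * tau (k + 1) l (\<alpha> + 1) \<beta>
       + tau k l (\<alpha> + 1) \<beta> * tau k (l - 1) (\<alpha> + 2) \<beta> =
       tau k (l - 1) (\<alpha> + 1) \<beta> * tau k l (\<alpha> + 2) \<beta> \<and>
     (tau k l \<alpha> (\<beta> + 1))\<^sup>2 =
       tau k l \<alpha> \<beta> * tau k l \<alpha> (\<beta> + 2)
       - tau k (l - 1) \<alpha> (\<beta> + 2) * tau k (l + 1) \<alpha> \<beta>
       - tau (k + 1) l \<alpha> (\<beta> + 2) * tau (k - 1) l \<alpha> \<beta> \<and>
     tau (k - 1) (l + 1) \<alpha> \<beta> * tau k l \<alpha> (\<beta> + 1)
       + tau (k - 1) l \<alpha> (\<beta> + 1) * tau k (l + 1) \<alpha> \<beta> =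
       tau (k - 1) l \<alpha> \<beta> * tau k (l + 1) \<alpha> (\<beta> + 1)"
proof (intro conjI)
  let ?t = triangle
  note signs = triangle_succ triangle_pred
  show "(tau k l (\<alpha> + 1) \<beta>)\<^sup>2 =
       tau k l \<alpha> \<beta> * tau k l (\<alpha> + 2) \<beta>
       + tau (k + 1) (l + 1) \<alpha> \<beta> * tau (k - 1) (l - 1) (\<alpha> + 2) \<beta>
       - tau (k + 1) l \<alpha> \<beta> * tau (k - 1) l (\<alpha> + 2) \<beta>"
  proof -
    \<comment> \<open>The charges of the two vacua in \<open>tau k l (\<alpha> + 1) \<beta>\<close>.\<close>
    define p q a b where "p = - k - \<alpha> - 1" and "q = k - l - \<beta>" and "a = - \<alpha> - 1" and "b = - \<beta>"
    note defs = p_def q_def a_def b_def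
    have \<tau>:
      "tau k l (\<alpha> + 1) \<beta> = sg (?t k + ?t l + \<beta> * k) * mc p q l a b"
      "tau k l \<alpha> \<beta> = sg (?t k + ?t l + \<beta> * k) * mc (p + 1) q l (a + 1) b"
      "tau k l (\<alpha> + 2) \<beta> = sg (?t k + ?t l + \<beta> * k) * mc (p - 1) q l (a - 1) b"
      "tau (k + 1) (l + 1) \<alpha> \<beta> = sg (?t (k + 1) + ?t (l + 1) + \<beta> * (k + 1)) * mc p q (l + 1) (a + 1) b"
      "tau (k - 1) (l - 1) (\<alpha> + 2) \<beta> = sg (?t (k - 1) + ?t (l - 1) + \<beta> * (k - 1)) * mc p q (l - 1) (a - 1) b"
      "tau (k + 1) l \<alpha> \<beta> = sg (?t (k + 1) + ?t l + \<beta> * (k + 1)) * mc p (q + 1) l (a + 1) b"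
      "tau (k - 1) l (\<alpha> + 2) \<beta> = sg (?t (k - 1) + ?t l + \<beta> * (k - 1)) * mc p (q - 1) l (a - 1) b"
      by (rule tau_eqI; simp add: defs)+
    show ?thesis
      unfolding \<tau> power_mult_distrib mc_square_first signs by (simp add: sg_arith power2_eq_square)
  qed
  show "tau (k - 1) (l - 1) (\<alpha> + 2) \<beta> * tau (k + 1) l (\<alpha> + 1) \<beta>
       + tau k l (\<alpha> + 1) \<beta> * tau k (l - 1) (\<alpha> + 2) \<beta> =
       tau k (l - 1) (\<alpha> + 1) \<beta> * tau k l (\<alpha> + 2) \<beta>"
  proof -
    \<comment> \<open>Here \<open>(p, q, r + 1)\<close> is the left charge of \<open>tau k l (\<alpha> + 2) \<beta>\<close>; the equation is the vanishing
      three-term identity multiplied by the sign \<open>sg r\<close>.\<close>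
    define p q r a b where "p = - k - \<alpha> - 2" and "q = k - l - \<beta>" and "r = l - 1"
      and "a = - \<alpha> - 1" and "b = - \<beta>"
    note defs = p_def q_def r_def a_def b_def
    have \<tau>:
      "tau (k - 1) r (\<alpha> + 2) \<beta> = sg (?t (k - 1) + ?t r + \<beta> * (k - 1)) * mc (p + 1) q r (a - 1) b"
      "tau (k + 1) (r + 1) (\<alpha> + 1) \<beta> = sg (?t (k + 1) + ?t (r + 1) + \<beta> * (k + 1)) * mc p (q + 1) (r + 1) a b"
      "tau k (r + 1) (\<alpha> + 1) \<beta> = sg (?t k + ?t (r + 1) + \<beta> * k) * mc (p + 1) q (r + 1) a b"
      "tau k r (\<alpha> + 2) \<beta> = sg (?t k + ?t r + \<beta> * k) * mc p (q + 1) r (a - 1) b"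
      "tau k r (\<alpha> + 1) \<beta> = sg (?t k + ?t r + \<beta> * k) * mc (p + 1) (q + 1) r a b"
      "tau k (r + 1) (\<alpha> + 2) \<beta> = sg (?t k + ?t (r + 1) + \<beta> * k) * mc p q (r + 1) (a - 1) b"
      by (rule tau_eqI; simp add: defs)+
    have "mc p (q + 1) (r + 1) a b * mc (p + 1) q r (a - 1) b
        - mc (p + 1) q (r + 1) a b * mc p (q + 1) r (a - 1) b
        + mc (p + 1) (q + 1) r a b * mc p q (r + 1) (a - 1) b = 0" (is "?B = 0")
      by (rule bilinear_identity_vanishing) simp_all
    then have B: "sg r * ?B = 0" by simp
    have l: "l - 1 = r" "l = r + 1" by (simp_all add: r_def)
    show ?thesis
      unfolding l(1) unfolding l(2) \<tau> signs
      by (rule eq_iff_diff_eq_0[THEN iffD2], rule trans[of _ "sg r * ?B"])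
        (simp add: sg_arith, rule B)
  qed
  show "(tau k l \<alpha> (\<beta> + 1))\<^sup>2 =
       tau k l \<alpha> \<beta> * tau k l \<alpha> (\<beta> + 2)
       - tau k (l - 1) \<alpha> (\<beta> + 2) * tau k (l + 1) \<alpha> \<beta>
       - tau (k + 1) l \<alpha> (\<beta> + 2) * tau (k - 1) l \<alpha> \<beta>"
  proof -
    \<comment> \<open>The charges of the two vacua in \<open>tau k l \<alpha> (\<beta> + 1)\<close>.\<close>
    define p q a b where "p = - k - \<alpha>" and "q = k - l - \<beta> - 1" and "a = - \<alpha>" and "b = - \<beta> - 1"
    note defs = p_def q_def a_def b_def
    have \<tau>:
      "tau k l \<alpha> (\<beta> + 1) = sg (?t k + ?t l + (\<beta> + 1) * k) * mc p q l a b"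
      "tau k l \<alpha> \<beta> = sg (?t k + ?t l + \<beta> * k) * mc p (q + 1) l a (b + 1)"
      "tau k l \<alpha> (\<beta> + 2) = sg (?t k + ?t l + (\<beta> + 2) * k) * mc p (q - 1) l a (b - 1)"
      "tau k (l - 1) \<alpha> (\<beta> + 2) = sg (?t k + ?t (l - 1) + (\<beta> + 2) * k) * mc p q (l - 1) a (b - 1)"
      "tau k (l + 1) \<alpha> \<beta> = sg (?t k + ?t (l + 1) + \<beta> * k) * mc p q (l + 1) a (b + 1)"
      "tau (k + 1) l \<alpha> (\<beta> + 2) = sg (?t (k + 1) + ?t l + (\<beta> + 2) * (k + 1)) * mc (p - 1) q l a (b - 1)"
      "tau (k - 1) l \<alpha> \<beta> = sg (?t (k - 1) + ?t l + \<beta> * (k - 1)) * mc (p + 1) q l a (b + 1)"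
      by (rule tau_eqI; simp add: defs)+
    show ?thesis
      unfolding \<tau> power_mult_distrib mc_square_second signs by (simp add: sg_arith power2_eq_square)
  qed
  show "tau (k - 1) (l + 1) \<alpha> \<beta> * tau k l \<alpha> (\<beta> + 1)
       + tau (k - 1) l \<alpha> (\<beta> + 1) * tau k (l + 1) \<alpha> \<beta> =
       tau (k - 1) l \<alpha> \<beta> * tau k (l + 1) \<alpha> (\<beta> + 1)"
  proof -
    \<comment> \<open>Here \<open>(p, q, l + 1)\<close> is the left charge of \<open>tau k (l + 1) \<alpha> (\<beta> + 1)\<close>; the factor is
      \<open>sg (l + \<beta>)\<close>.\<close>
    define p q a b where "p = - k - \<alpha>" and "q = k - l - \<beta> - 2" and "a = - \<alpha>" and "b = - \<beta>"
    note defs = p_def q_def a_def b_def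
    have \<tau>:
      "tau (k - 1) (l + 1) \<alpha> \<beta> = sg (?t (k - 1) + ?t (l + 1) + \<beta> * (k - 1)) * mc (p + 1) q (l + 1) a b"
      "tau k l \<alpha> (\<beta> + 1) = sg (?t k + ?t l + (\<beta> + 1) * k) * mc p (q + 1) l a (b - 1)"
      "tau (k - 1) l \<alpha> (\<beta> + 1) = sg (?t (k - 1) + ?t l + (\<beta> + 1) * (k - 1)) * mc (p + 1) q l a (b - 1)"
      "tau k (l + 1) \<alpha> \<beta> = sg (?t k + ?t (l + 1) + \<beta> * k) * mc p (q + 1) (l + 1) a b"
      "tau (k - 1) l \<alpha> \<beta> = sg (?t (k - 1) + ?t l + \<beta> * (k - 1)) * mc (p + 1) (q + 1) l a b"
      "tau k (l + 1) \<alpha> (\<beta> + 1) = sg (?t k + ?t (l + 1) + (\<beta> + 1) * k) * mc p q (l + 1) a (b - 1)"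
      by (rule tau_eqI; simp add: defs)+
    have "mc p (q + 1) (l + 1) a b * mc (p + 1) q l a (b - 1)
        - mc (p + 1) q (l + 1) a b * mc p (q + 1) l a (b - 1)
        + mc (p + 1) (q + 1) l a b * mc p q (l + 1) a (b - 1) = 0" (is "?B = 0")
      by (rule bilinear_identity_vanishing) simp_all
    then have B: "sg (l + \<beta>) * ?B = 0" by simp
    show ?thesis
      unfolding \<tau> signs
      by (rule eq_iff_diff_eq_0[THEN iffD2], rule trans[of _ "sg (l + \<beta>) * ?B"])
        (simp add: sg_arith, rule B)
  qed
qed

end
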